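(* Let $d\in\mathbb N$, $d\geq2$, write points of $\mathbb R^d$ as $z=(x,t)\in\mathbb R^{d-1}\times\mathbb R$, let $\frac12\leq\kappa\leq1$ and $q=\frac{2(d+1)}{d-3+4\kappa}$. Then there is $C>0$ such that for all $v\in\mathcal S(\mathbb R^d)$ $$\|v\|_q\leq C\,\|i\partial_t v-\Delta v\|_2^{1-\kappa}\,\|v\|_2^{\kappa},$$ where $\Delta$ is the Laplacian in $x\in\mathbb R^{d-1}$.
   Context: $\|\cdot\|_p$ denotes the $L^p(\mathbb R^d)$-norm; $x^0:=1$. *)

theory Defs
  imports "HOL-Analysis.Analysis"
begin

text \<open>Points of R^d are pairs z = (x,t) with x :: real^'n (so d - 1 = CARD('n)) and t :: real.\<close>

definition pderiv_dir :: "'a::euclidean_space \<Rightarrow> ('a \<Rightarrow> complex) \<Rightarrow> 'a \<Rightarrow> complex" where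
  "pderiv_dir b f z = vector_derivative (\<lambda>s::real. f (z + s *\<^sub>R b)) (at 0)"

fun iter_pderiv :: "'a::euclidean_space list \<Rightarrow> ('a \<Rightarrow> complex) \<Rightarrow> 'a \<Rightarrow> complex" where
  "iter_pderiv [] f = f"
| "iter_pderiv (b # bs) f = pderiv_dir b (iter_pderiv bs f)"

definition schwartz :: "('a::euclidean_space \<Rightarrow> complex) \<Rightarrow> bool" where
  "schwartz f \<longleftrightarrow>
     (\<forall>bs. set bs \<subseteq> Basis \<longrightarrow>
        (\<forall>z. iter_pderiv bs f differentiable (at z)) \<and>
        (\<forall>N::nat. \<exists>M. \<forall>z. norm z ^ N * norm (iter_pderiv bs f z) \<le> M))"

definition Lp_norm :: "real \<Rightarrow> ('a::euclidean_space \<Rightarrow> complex) \<Rightarrow> real" where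
  "Lp_norm p f = (\<integral>z. norm (f z) powr p \<partial>lborel) powr (1 / p)"

text \<open>Real power with the convention x^0 = 1 (Isabelle's powr has 0 powr 0 = 0).\<close>
definition rpow :: "real \<Rightarrow> real \<Rightarrow> real" where
  "rpow x a = (if a = 0 then 1 else x powr a)"

definition schrod_op :: "((real^'n::finite) \<times> real \<Rightarrow> complex) \<Rightarrow> (real^'n) \<times> real \<Rightarrow> complex" where
  "schrod_op v z = \<i> * pderiv_dir (0, 1) v z
     - (\<Sum>b\<in>(Basis :: (real^'n) set). pderiv_dir (b, 0) (pderiv_dir (b, 0) v) z)"

end

theory Submission
  imports Defs "HOL-Probability.Probability" "HOL-Real_Asymp.Real_Asymp"
begin

text \<open>
  The heart is the case \<open>\<kappa> = 1/2\<close>; the others follow by log-convexity of \<open>L\<^sup>p\<close> norms.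
  Let \<open>U(\<tau>)\<close> be the Schroedinger propagator. Integrating the derivative of
  \<open>e\<^bsup>-\<delta>\<tau>\<^esup> U(\<tau>) v(t - \<tau>)\<close> over \<open>\<tau> > 0\<close> gives
  \<open>v = R (\<delta> v - i f)\<close> with \<open>f = i v\<^sub>t - \<Delta> v\<close> and
  \<open>R h(t) = \<integral> e\<^bsup>-\<delta>\<tau>\<^esup> U(\<tau>) h(t - \<tau>) d\<tau>\<close>.
  The operator \<open>R R\<^sup>*\<close> is, up to the factor \<open>1/(2\<delta>)\<close>, convolution in time
  with \<open>e\<^bsup>-\<delta>|r|\<^esup> U(r)\<close>, so the dispersive estimate for \<open>U(r)\<close> and the
  Hardy-Littlewood-Sobolev inequality in time bound \<open>\<parallel>R\<^sup>* g\<parallel>\<^sub>2\<close> by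
  \<open>\<delta>\<^bsup>-1/2\<^esup> \<parallel>g\<parallel>\<^sub>p\<close> for the dual exponent \<open>p\<close>. Testing \<open>v\<close> against
  \<open>g = |v|\<^bsup>q-2\<^esup> v\<close> and optimising in \<open>\<delta>\<close> yields
  \<open>\<parallel>v\<parallel>\<^sub>q\<^sup>2 \<le> C \<parallel>f\<parallel>\<^sub>2 \<parallel>v\<parallel>\<^sub>2\<close>. No Fourier transform is needed: \<open>U(\<tau>)\<close> is replaced by
  the heat kernel at complex time \<open>\<epsilon> - i \<tau>\<close>, whose semigroup law gives both the
  \<open>L\<^sup>2\<close> contraction and the formula for \<open>R R\<^sup>*\<close>, and \<open>\<epsilon>\<close> tends to \<open>0\<close> at the end.
\<close>

section \<open>Integration over Euclidean space\<close>

text \<open>Put \<open>n = d - 1\<close>. The exponent is forced: interpolation between the kernel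
  bound \<open>(4 \<pi> r)^(-n/2)\<close> and the L^2 contraction gives decay
  \<open>r^(-(n/2)(2/p - 1))\<close>, while Hardy-Littlewood-Sobolev on the line needs
  \<open>r^(-(2 - 2/p))\<close>. The two agree exactly for \<open>p = 2(n+2)/(n+4)\<close>, whose
  conjugate exponent \<open>2(n+2)/n\<close> is the value of \<open>q\<close> at \<kappa> = 1/2.
  Since n is at least 1, this \<open>p\<close> lies strictly between 1 and 2. Without damping the
  time integral behind the Gram kernel diverges. Its price is the term \<delta> v, and this is how
  the L^2 norm of v enters; \<delta> comparable to the quotient of the norms of f and v balances
  both contributions. The obstacle behind \<epsilon> is that the Schroedinger kernel has constant
  modulus in space, so no exchange of integrals is absolutely convergent. Bounds that depend on
  \<epsilon> serve only to justify such exchanges; those that enter the estimates are uniform in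
  \<epsilon>. In place of complex interpolation and of Cauchy-Schwarz, arithmetic-geometric mean
  inequalities with free weights are used, and the weights are chosen last.\<close>

lemma integrable_lborel_shift:
  fixes f :: "'a::euclidean_space \<Rightarrow> 'b::{banach, second_countable_topology}"
  assumes "integrable lborel f"
  shows "integrable lborel (\<lambda>x. f (c + x))"
proof -
  have "integrable (distr lborel borel ((+) c)) f"
    using assms by (simp add: lborel_distr_plus)
  then show ?thesis using assms by (subst (asm) integrable_distr_eq) auto
qed

lemma integral_lborel_shift:
  fixes f :: "'a::euclidean_space \<Rightarrow> 'b::{banach, second_countable_topology}"
  assumes "f \<in> borel_measurable borel"
  shows "(LBINT x. f (c + x)) = integral\<^sup>L lborel f"
proof -
  have "integral\<^sup>L lborel f = integral\<^sup>L (distr lborel borel ((+) c)) f"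
    by (simp add: lborel_distr_plus)
  also have "\<dots> = (LBINT x. f (c + x))"
    using assms by (subst integral_distr) auto
  finally show ?thesis by simp
qed

lemma lborel_distr_uminus_euclidean:
  "distr lborel borel uminus = (lborel :: 'a::euclidean_space measure)"
  using lborel_affine[of "-1" "0::'a"] by (simp add: density_1)

lemma integrable_lborel_reflect:
  fixes f :: "'a::euclidean_space \<Rightarrow> 'b::{banach, second_countable_topology}"
  assumes "integrable lborel f"
  shows "integrable lborel (\<lambda>x. f (c - x))"
proof -
  have "integrable (distr lborel borel uminus) (\<lambda>x. f (c + x))"
    using integrable_lborel_shift[OF assms] by (simp add: lborel_distr_uminus_euclidean)
  moreover have [measurable]: "f \<in> borel_measurable borel" using assms by auto
  ultimately show ?thesis by (subst (asm) integrable_distr_eq) auto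
qed

lemma integral_lborel_reflect:
  fixes f :: "'a::euclidean_space \<Rightarrow> 'b::{banach, second_countable_topology}"
  assumes [measurable]: "f \<in> borel_measurable borel"
  shows "(LBINT x. f (c - x)) = integral\<^sup>L lborel f"
proof -
  have "(LBINT x. f (c + x)) = integral\<^sup>L (distr lborel borel uminus) (\<lambda>x. f (c + x))"
    by (simp add: lborel_distr_uminus_euclidean)
  also have "\<dots> = (LBINT x. f (c - x))"
    by (subst integral_distr) auto
  finally show ?thesis by (simp add: integral_lborel_shift)
qed

text \<open>A product majorant makes Tonelli trivial; most applications of Fubini's theorem to
  kernels below are justified this way.\<close>

lemma integrable_lborel_pair_bound:
  fixes f :: "'a::euclidean_space \<times> 'b::euclidean_space \<Rightarrow> 'c::{banach, second_countable_topology}"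
    and g h :: "_ \<Rightarrow> real"
  assumes [measurable]: "f \<in> borel_measurable borel"
    and g: "integrable lborel g" and h: "integrable lborel h"
    and le: "\<And>x y. norm (f (x, y)) \<le> g x * h y"
  shows "integrable (lborel \<Otimes>\<^sub>M lborel) f"
proof (rule integrableI_bounded)
  have [measurable]: "g \<in> borel_measurable borel" "h \<in> borel_measurable borel"
    using g h by auto
  show [measurable]: "f \<in> borel_measurable (lborel \<Otimes>\<^sub>M lborel)"
    by (simp add: lborel_prod)
  have "(\<integral>\<^sup>+ x. norm (f x) \<partial>(lborel \<Otimes>\<^sub>M lborel)) = (\<integral>\<^sup>+x. \<integral>\<^sup>+y. norm (f (x, y)) \<partial>lborel \<partial>lborel)"
    by (rule lborel.nn_integral_fst[symmetric]) simp
  also have "\<dots> \<le> (\<integral>\<^sup>+x. \<integral>\<^sup>+y. ennreal \<bar>g x\<bar> * ennreal \<bar>h y\<bar> \<partial>lborel \<partial>lborel)"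
  proof (intro nn_integral_mono)
    fix x y
    have "norm (f (x, y)) \<le> \<bar>g x\<bar> * \<bar>h y\<bar>"
      using le[of x y] abs_ge_self[of "g x * h y"] by (simp add: abs_mult)
    then show "ennreal (norm (f (x, y))) \<le> ennreal \<bar>g x\<bar> * ennreal \<bar>h y\<bar>"
      by (simp flip: ennreal_mult add: ennreal_leI)
  qed
  also have "\<dots> = (\<integral>\<^sup>+x. ennreal \<bar>g x\<bar> \<partial>lborel) * (\<integral>\<^sup>+y. ennreal \<bar>h y\<bar> \<partial>lborel)"
    by (simp add: nn_integral_cmult nn_integral_multc)
  also have "\<dots> < \<infinity>"
    using g h unfolding integrable_iff_bounded by (auto simp: ennreal_mult_less_top)
  finally show "(\<integral>\<^sup>+ x. norm (f x) \<partial>(lborel \<Otimes>\<^sub>M lborel)) < \<infinity>" .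
qed

text \<open>Lebesgue measure is the image of the product of the measures on the coordinate axes.
  This reduces Gaussian integrals and integrable weights to the line.\<close>

lemma integral_lborel_prod_Basis:
  fixes f :: "'a::euclidean_space \<Rightarrow> real \<Rightarrow> complex"
  assumes f: "\<And>b. b \<in> Basis \<Longrightarrow> integrable lborel (f b)"
  shows "integrable lborel (\<lambda>x. \<Prod>b\<in>Basis. f b (x \<bullet> b))" (is ?A)
    and "(LBINT x. (\<Prod>b\<in>Basis. f b (x \<bullet> b))) = (\<Prod>b\<in>Basis. integral\<^sup>L lborel (f b))" (is ?B)
proof -
  interpret product_sigma_finite "\<lambda>b::'a. lborel :: real measure" ..
  have [measurable]: "f b \<in> borel_measurable borel" if "b \<in> Basis" for b
    using f[OF that] by auto
  let ?g = "\<lambda>f. \<Sum>b\<in>Basis. f b *\<^sub>R b :: 'a"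
  have [measurable]: "?g \<in> measurable (Pi\<^sub>M Basis (\<lambda>b. lborel)) borel" by measurable
  have eq: "(\<Prod>b\<in>Basis. f b (?g x \<bullet> b)) = (\<Prod>b\<in>Basis. f b (x b))" for x
    by (intro prod.cong refl) simp
  show ?A
    unfolding lborel_eq[where 'a='a]
    by (subst integrable_distr_eq) (auto simp: eq intro!: product_integrable_prod f)
  show ?B
    unfolding lborel_eq[where 'a='a]
    by (subst integral_distr) (auto simp: eq intro!: product_integral_prod f)
qed

text \<open>By translation invariance \<open>F (z + b) - F z\<close> has integral 0. It is also the
  integral over \<open>s\<close> in [0,1] of \<open>F' (z + s b)\<close>, and each of these
  translates has the same integral as \<open>F'\<close>. Hence no boundary terms and no decay of
  \<open>F\<close> along lines have to be discussed.\<close>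

lemma integral_dirderiv_eq_0:
  fixes F F' :: "'a::euclidean_space \<Rightarrow> complex"
  assumes F: "integrable lborel F" and F': "integrable lborel F'"
    and cont: "continuous_on UNIV F'"
    and deriv: "\<And>z s. ((\<lambda>s. F (z + s *\<^sub>R b)) has_vector_derivative F' (z + s *\<^sub>R b)) (at s)"
  shows "integral\<^sup>L lborel F' = 0"
proof -
  have mF'[measurable]: "F' \<in> borel_measurable borel" and mF: "F \<in> borel_measurable borel"
    using F F' by auto
  define G where "G = (\<lambda>(s::real, y). indicator {0..1} s *\<^sub>R F' (y + s *\<^sub>R b))"
  have [measurable]: "G \<in> borel_measurable (lborel \<Otimes>\<^sub>M lborel)"
    unfolding G_def by measurable
  have sh: "(LBINT y. F' (y + c)) = integral\<^sup>L lborel F'" for c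
    using integral_lborel_shift[OF mF', of c] by (simp add: add.commute)
  have shn: "(LBINT y. norm (F' (y + c))) = (LBINT y. norm (F' y))" for c
    using integral_lborel_shift[of "\<lambda>y. norm (F' y)" c] by (simp add: add.commute)
  have ish: "integrable lborel (\<lambda>y. F' (y + c))" for c
    using integrable_lborel_shift[OF F', of c] by (simp add: add.commute)
  have iG: "integrable (lborel \<Otimes>\<^sub>M lborel) G"
  proof (rule lborel_pair.Fubini_integrable)
    show "integrable lborel (\<lambda>s. LBINT y. norm (G (s, y)))"
      by (simp add: G_def shn)
    show "AE s in lborel. integrable lborel (\<lambda>y. G (s, y))"
      unfolding G_def using ish by simp
  qed simp
  have inner: "(LBINT s. G (s, y)) = F (b + y) - F y" for y
  proof -
    have "(LBINT s. indicator {0..1} s *\<^sub>R F' (y + s *\<^sub>R b)) = F (y + 1 *\<^sub>R b) - F (y + 0 *\<^sub>R b)"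
    proof (rule integral_FTC_atLeastAtMost)
      show "continuous_on {0..1} (\<lambda>s. F' (y + s *\<^sub>R b))"
        by (intro continuous_intros continuous_on_compose2[OF cont]) auto
    qed (auto intro!: has_vector_derivative_at_within deriv)
    then show ?thesis by (simp add: G_def add.commute)
  qed
  have "integral\<^sup>L lborel F' = (LBINT s. indicator {0..1::real} s *\<^sub>R integral\<^sup>L lborel F')"
    using integral_scaleR_left[of "integral\<^sup>L lborel F'" lborel "indicator {0..1::real}"] by simp
  also have "\<dots> = (LBINT s. (LBINT y. G (s, y)))"
    by (simp add: G_def sh)
  also have "\<dots> = (LBINT y. (LBINT s. G (s, y)))"
    using iG by (intro lborel_pair.Fubini_integral[symmetric]) (simp add: case_prod_eta)
  also have "\<dots> = (LBINT y. F (b + y) - F y)"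
    by (simp only: inner)
  also have "\<dots> = 0"
    using integrable_lborel_shift[OF F, of b] F integral_lborel_shift[OF mF, of b] by simp
  finally show ?thesis .
qed

lemma power_times_exp_bounded:
  fixes c :: real
  assumes "c > 0"
  shows "\<exists>M>0. \<forall>s\<ge>0. (1 + s) ^ k * exp (- c * s) \<le> M"
proof (cases "k = 0")
  case True
  then show ?thesis using assms by (intro exI[of _ 1]) auto
next
  case False
  then have k: "real k > 0" by simp
  \<comment> \<open>Both bounds on \<open>m\<close> are needed for
    \<open>1 + s \<le> m * (1 + c * s / k)\<close>; then \<open>1 + x \<le> exp x\<close> is raised
    to the power \<open>k\<close>.\<close>
  define m where "m = max 1 (real k / c)"
  have "(1 + s) ^ k * exp (- c * s) \<le> m ^ k" if "s \<ge> 0" for s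
  proof -
    have "1 + s \<le> m * (1 + c * s / k)"
    proof -
      have "s = (real k / c) * (c * s / k)" using assms k by simp
      also have "\<dots> \<le> m * (c * s / k)"
        using assms k that by (intro mult_right_mono) (auto simp: m_def)
      finally show ?thesis by (simp add: m_def distrib_left)
    qed
    also have "\<dots> \<le> m * exp (c * s / k)"
      by (intro mult_left_mono) (auto simp: m_def)
    finally have "(1 + s) ^ k \<le> (m * exp (c * s / k)) ^ k"
      using that by (intro power_mono) auto
    also have "\<dots> = m ^ k * exp (c * s)"
      using k by (simp add: power_mult_distrib flip: exp_of_nat_mult)
    finally show ?thesis
      by (simp add: exp_minus field_simps)
  qed
  moreover have "m ^ k > 0" by (simp add: m_def)
  ultimately show ?thesis by blast
qed

section \<open>Complex Gaussians and the heat kernel at complex time\<close>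

lemma integrable_inverse_1_plus_square: "integrable lborel (\<lambda>x::real. 1 / (1 + x\<^sup>2))"
  using integrable_inverse_1_plus_square
  by (simp add: set_integrable_def einterval_def inverse_eq_divide)

text \<open>The sector \<open>\<bar>Im r\<bar> < Re r\<close> is convex and contains 1, so on the
  whole segment from 1 to \<open>r\<close> the square of the leading coefficient keeps a positive
  real part. Half of the quadratic term then absorbs the cross term, which gives one Gaussian
  majorant for all \<open>u\<close>.\<close>

lemma exp_complex_square_bound:
  fixes r m :: complex
  assumes r: "\<bar>Im r\<bar> < Re r"
  shows "\<exists>c>0. \<exists>M\<ge>0. \<forall>u\<in>{0..1}. \<forall>y::real.
    norm (exp (- (((1 + of_real u * (r - 1)) * of_real y + of_real u * m)\<^sup>2))) \<le> M * exp (- c * y\<^sup>2)"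
proof -
  \<comment> \<open>A lower bound for \<open>Re s - \<bar>Im s\<bar>\<close> at both ends of the
    segment, hence on all of it.\<close>
  define e where "e = min 1 (Re r - \<bar>Im r\<bar>)"
  define R where "R = 1 + norm r"
  \<comment> \<open>The first summand is what completing the square leaves after the cross term is
    absorbed, the second bounds the constant term.\<close>
  define K where "K = 2 * (R * norm m / e)\<^sup>2 + (norm m)\<^sup>2"
  have e: "e > 0" using r by (simp add: e_def)
  have "norm (exp (- (((1 + of_real u * (r - 1)) * of_real y + of_real u * m)\<^sup>2)))
          \<le> exp K * exp (- (e\<^sup>2 / 2) * y\<^sup>2)" if u: "u \<in> {0..1}" for u y :: real
  proof -
    define s where "s = 1 + of_real u * (r - 1)"
    define t where "t = of_real u * m"
    have "e \<le> (1 - u) * 1 + u * (Re r - \<bar>Im r\<bar>)"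
    proof -
      have "e = (1 - u) * e + u * e" by (simp add: algebra_simps)
      also have "\<dots> \<le> (1 - u) * 1 + u * (Re r - \<bar>Im r\<bar>)"
        using u by (intro add_mono mult_left_mono) (auto simp: e_def)
      finally show ?thesis .
    qed
    also have "\<dots> = Re s - \<bar>Im s\<bar>"
      using u by (simp add: s_def abs_mult algebra_simps)
    finally have es: "e \<le> Re s - \<bar>Im s\<bar>" .
    have "e\<^sup>2 \<le> (Re s - \<bar>Im s\<bar>) * (Re s + \<bar>Im s\<bar>)"
      unfolding power2_eq_square using e es by (intro mult_mono) auto
    then have Re_s: "e\<^sup>2 \<le> Re (s\<^sup>2)" by (simp add: power2_eq_square algebra_simps)
    have "s = (1 - of_real u) + of_real u * r" by (simp add: s_def algebra_simps)
    then have "norm s \<le> norm (1 - of_real u :: complex) + norm (of_real u * r)"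
      by (simp only: norm_triangle_ineq)
    also have "norm (1 - of_real u :: complex) = 1 - u"
      using u by (metis atLeastAtMost_iff diff_ge_0_iff_ge norm_of_real of_real_1 of_real_diff abs_of_nonneg)
    also have "(1 - u) + norm (of_real u * r) \<le> R"
      using u mult_right_mono[of u 1 "norm r"] by (simp add: R_def norm_mult)
    finally have ns: "norm s \<le> R" .
    have nt: "norm t \<le> norm m"
      using u mult_right_mono[of u 1 "norm m"] by (simp add: t_def norm_mult)
    have "norm (s * t) \<le> R * norm m"
      unfolding norm_mult using ns nt by (intro mult_mono) (auto simp: R_def)
    then have st: "\<bar>Re (s * t)\<bar> \<le> R * norm m"
      using abs_Re_le_cmod order_trans by blast
    have "\<bar>Re (t\<^sup>2)\<bar> \<le> norm (t\<^sup>2)" by (rule abs_Re_le_cmod)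
    also have "\<dots> \<le> (norm m)\<^sup>2" unfolding norm_power using nt by (intro power_mono) auto
    finally have t2: "\<bar>Re (t\<^sup>2)\<bar> \<le> (norm m)\<^sup>2" .
    have "(s * of_real y + t)\<^sup>2 = of_real (y\<^sup>2) * s\<^sup>2 + of_real (2 * y) * (s * t) + t\<^sup>2"
      by (simp add: power2_eq_square algebra_simps)
    then have "Re ((s * of_real y + t)\<^sup>2) = y\<^sup>2 * Re (s\<^sup>2) + 2 * y * Re (s * t) + Re (t\<^sup>2)"
      by (simp del: of_real_mult of_real_power)
    moreover have "y\<^sup>2 * Re (s\<^sup>2) \<ge> y\<^sup>2 * e\<^sup>2" using Re_s by (intro mult_left_mono) auto
    moreover have "2 * y * Re (s * t) \<ge> - (2 * \<bar>y\<bar> * (R * norm m))"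
    proof -
      have "\<bar>2 * y * Re (s * t)\<bar> \<le> 2 * \<bar>y\<bar> * (R * norm m)"
        unfolding abs_mult using st by (intro mult_mono) auto
      then show ?thesis by linarith
    qed
    moreover have "y\<^sup>2 * e\<^sup>2 / 2 - 2 * \<bar>y\<bar> * (R * norm m) + 2 * (R * norm m / e)\<^sup>2 \<ge> 0"
    proof -
      have "0 \<le> (\<bar>y\<bar> * e - 2 * (R * norm m / e))\<^sup>2 / 2" by simp
      also have "\<dots> = y\<^sup>2 * e\<^sup>2 / 2 - 2 * \<bar>y\<bar> * (R * norm m) + 2 * (R * norm m / e)\<^sup>2"
        using e unfolding power2_diff by (simp add: power_mult_distrib field_simps)
      finally show ?thesis .
    qed
    ultimately have "Re ((s * of_real y + t)\<^sup>2) \<ge> e\<^sup>2 / 2 * y\<^sup>2 - K"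
      using t2 mult.commute[of "y\<^sup>2" "e\<^sup>2"] unfolding K_def by linarith
    then show ?thesis
      by (simp add: s_def[symmetric] t_def[symmetric] flip: exp_add)
  qed
  then show ?thesis
    using e by (intro exI[of _ "e\<^sup>2 / 2"] conjI exI[of _ "exp K"]) auto
qed

lemma integral_exp_minus_square: "has_bochner_integral lborel (\<lambda>x::real. exp (- x\<^sup>2)) (sqrt pi)"
  using has_bochner_integral_even_function[OF gaussian_moment_0] by simp

text \<open>With \<open>\<zeta> = r\<^sub>u y + m\<^sub>u\<close>, where \<open>r\<^sub>u = 1 + u (r - 1)\<close> and \<open>m\<^sub>u = u m\<close>, the form
  \<open>exp (-\<zeta>\<^sup>2) d\<zeta>\<close> is closed, so the \<open>u\<close>-derivative of the integrand is a \<open>y\<close>-derivative and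
  integrates to \<open>0\<close>.\<close>
lemma integral_complex_gaussian:
  fixes r m :: complex
  assumes r: "\<bar>Im r\<bar> < Re r"
  shows "integrable lborel (\<lambda>y::real. exp (- ((r * of_real y + m)\<^sup>2)))"
    and "(LBINT y. exp (- ((r * of_real y + m)\<^sup>2))) = sqrt pi / r"
proof -
  define E where "E = (\<lambda>(u::real) (y::real). exp (- (((1 + of_real u * (r - 1)) * of_real y + of_real u * m)\<^sup>2)))"
  \<comment> \<open>\<open>D\<close> is at once the \<open>u\<close>-derivative of
    \<open>(1 + of_real u * (r - 1)) * E u y\<close> and the \<open>y\<close>-derivative of
    \<open>((r - 1) * of_real y + m) * E u y\<close>; each reading is integrated once below.\<close>
  define D where "D = (\<lambda>u y. E u y * ((r - 1) - 2 * ((1 + of_real u * (r - 1)) * of_real y + of_real u * m)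
      * (1 + of_real u * (r - 1)) * ((r - 1) * of_real y + m)))"
  obtain c M where c: "c > 0" and M: "M \<ge> 0"
    and E: "\<And>u y. u \<in> {0..1} \<Longrightarrow> norm (E u y) \<le> M * exp (- c * y\<^sup>2)"
    unfolding E_def using exp_complex_square_bound[OF r, of m] by blast
  obtain M2 where M2: "M2 > 0" "\<And>s. s \<ge> 0 \<Longrightarrow> (1 + s) ^ 2 * exp (- c * s) \<le> M2"
    using power_times_exp_bounded[OF c] by blast
  \<comment> \<open>Two factors \<open>1 + y^2\<close> are gained: one pays for the quadratic growth
    of the polynomial in \<open>D\<close>, the other leaves the integrable majorant
    \<open>1 / (1 + y^2)\<close>.\<close>
  have E': "(1 + y\<^sup>2)\<^sup>2 * norm (E u y) \<le> M * M2" if "u \<in> {0..1}" for u y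
  proof -
    have "(1 + y\<^sup>2)\<^sup>2 * norm (E u y) \<le> M * ((1 + y\<^sup>2)\<^sup>2 * exp (- c * y\<^sup>2))"
      using mult_left_mono[OF E[OF that, of y], of "(1 + y\<^sup>2)\<^sup>2"] by (simp add: mult_ac)
    also have "\<dots> \<le> M * M2" using M2(2)[of "y\<^sup>2"] M by (intro mult_left_mono) auto
    finally show ?thesis .
  qed
  have poly: "norm (E u y * P) \<le> M * M2 * C * (1 / (1 + y\<^sup>2))"
    if "u \<in> {0..1}" "norm P \<le> C * (1 + y\<^sup>2)" "C \<ge> 0" for u y P C
  proof -
    have "norm (E u y * P) * (1 + y\<^sup>2) \<le> norm (E u y) * (C * (1 + y\<^sup>2)) * (1 + y\<^sup>2)"
      unfolding norm_mult using that by (intro mult_right_mono mult_left_mono) auto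
    also have "\<dots> = C * ((1 + y\<^sup>2)\<^sup>2 * norm (E u y))" by (simp add: power2_eq_square)
    also have "\<dots> \<le> C * (M * M2)" using E'[OF that(1)] that(3) by (intro mult_left_mono) auto
    finally show ?thesis by (simp add: field_simps add_pos_nonneg)
  qed
  define R where "R = 1 + norm r + norm m"
  have y_le: "\<bar>y\<bar> \<le> 1 + y\<^sup>2" for y :: real
    using power2_diff[of "\<bar>y\<bar>" 1] zero_le_power2[of "\<bar>y\<bar> - 1"] by (simp add: power2_eq_square) 
  have y_le2: "(1 + \<bar>y\<bar>)\<^sup>2 \<le> 2 * (1 + y\<^sup>2)" for y :: real
    using zero_le_power2[of "\<bar>y\<bar> - 1"] by (simp add: power2_eq_square algebra_simps)
  have R: "R \<ge> 1" by (simp add: R_def)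
  have nr: "norm (r - 1) \<le> R" using norm_triangle_ineq4[of r 1] norm_ge_zero[of m] unfolding R_def norm_one by linarith
  have lin1: "norm ((r - 1) * of_real y + m) \<le> 2 * R * (1 + \<bar>y\<bar>)" for y
  proof -
    have "norm ((r - 1) * of_real y + m) \<le> norm (r - 1) * \<bar>y\<bar> + norm m"
      using norm_triangle_ineq[of "(r - 1) * of_real y" m] by (simp only: norm_mult norm_of_real)
    also have "\<dots> \<le> R * \<bar>y\<bar> + R" using nr by (intro add_mono mult_right_mono) (auto simp: R_def)
    also have "\<dots> \<le> 2 * R * (1 + \<bar>y\<bar>)" using R by (simp add: algebra_simps)
    finally show ?thesis .
  qed
  have su: "norm (1 + of_real u * (r - 1)) \<le> 2 * R" if "u \<in> {0..1}" for u
  proof -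
    have "norm (1 + of_real u * (r - 1)) \<le> 1 + \<bar>u\<bar> * norm (r - 1)"
      using norm_triangle_ineq[of 1 "of_real u * (r - 1)"] by (simp only: norm_mult norm_of_real norm_one)
    also have "\<dots> \<le> R + 1 * R" using that nr R by (intro add_mono mult_mono) auto
    finally show ?thesis by simp
  qed
  have lin2: "norm ((1 + of_real u * (r - 1)) * of_real y + of_real u * m) \<le> 2 * R * (1 + \<bar>y\<bar>)"
    if "u \<in> {0..1}" for u y
  proof -
    have "norm ((1 + of_real u * (r - 1)) * of_real y + of_real u * m)
        \<le> norm (1 + of_real u * (r - 1)) * \<bar>y\<bar> + \<bar>u\<bar> * norm m"
      using norm_triangle_ineq[of "(1 + of_real u * (r - 1)) * of_real y" "of_real u * m"]
      by (simp only: norm_mult norm_of_real)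
    also have "\<dots> \<le> (2 * R) * \<bar>y\<bar> + 1 * (2 * R)" using su[OF that] that
      by (intro add_mono mult_right_mono mult_mono) (auto simp: R_def)
    finally show ?thesis by (simp add: algebra_simps)
  qed
  \<comment> \<open>The first \<open>R\<close> bounds \<open>r - 1\<close>. In the product the three
    linear factors give \<open>2 * R\<close> each, two of them times
    \<open>1 + \<bar>y\<bar>\<close>, and the square of the latter costs the last 2.\<close>
  define C where "C = R + 2 * (2 * R) * (2 * R) * (2 * R) * 2"
  have C: "C \<ge> 0" using R by (simp add: C_def)
  have D: "norm (D u y) \<le> M * M2 * C * (1 / (1 + y\<^sup>2))" if "u \<in> {0..1}" for u y
    unfolding D_def
  proof (rule poly[OF that _ C])
    let ?q = "2 * ((1 + of_real u * (r - 1)) * of_real y + of_real u * m)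
      * (1 + of_real u * (r - 1)) * ((r - 1) * of_real y + m)"
    have "norm ?q \<le> 2 * (2 * R * (1 + \<bar>y\<bar>)) * (2 * R) * (2 * R * (1 + \<bar>y\<bar>))"
      unfolding norm_mult using lin1[of y] lin2[OF that, of y] su[OF that] R
      by (intro mult_mono) (auto intro!: mult_nonneg_nonneg)
    also have "\<dots> = 2 * (2 * R) * (2 * R) * (2 * R) * (1 + \<bar>y\<bar>)\<^sup>2"
      by (simp add: power2_eq_square)
    also have "\<dots> \<le> 2 * (2 * R) * (2 * R) * (2 * R) * (2 * (1 + y\<^sup>2))"
      using R y_le2[of y] by (intro mult_left_mono) auto
    finally have q: "norm ?q \<le> 2 * (2 * R) * (2 * R) * (2 * R) * (2 * (1 + y\<^sup>2))" .
    have "R \<le> R * (1 + y\<^sup>2)" using R by simp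
    with q have "norm ((r - 1) - ?q) \<le> R * (1 + y\<^sup>2) + 2 * (2 * R) * (2 * R) * (2 * R) * (2 * (1 + y\<^sup>2))"
      using norm_triangle_ineq4[of "r - 1" ?q] nr by linarith
    then show "norm ((r - 1) - ?q) \<le> C * (1 + y\<^sup>2)" by (simp add: C_def algebra_simps)
  qed
  have mE: "(\<lambda>y. E u y) \<in> borel_measurable borel" for u
    unfolding E_def by (intro borel_measurable_continuous_onI continuous_intros)
  have E1: "integrable lborel (\<lambda>y. E u y * P y)"
    if "u \<in> {0..1}" "\<And>y. norm (P y) \<le> C * (1 + y\<^sup>2)" "C \<ge> 0" "continuous_on UNIV P" for u P C
  proof (rule Bochner_Integration.integrable_bound)
    show "integrable lborel (\<lambda>y::real. M * M2 * C * (1 / (1 + y\<^sup>2)))"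
      by (intro integrable_mult_right integrable_inverse_1_plus_square)
    have [measurable]: "P \<in> borel_measurable borel" by (intro borel_measurable_continuous_onI that)
    show "(\<lambda>y. E u y * P y) \<in> borel_measurable lborel" using mE by measurable
    show "AE y in lborel. norm (E u y * P y) \<le> norm (M * M2 * C * (1 / (1 + y\<^sup>2)))"
      unfolding real_norm_def by (intro always_eventually allI order_trans[OF poly[OF that(1-3)] abs_ge_self])
  qed
  have E0: "integrable lborel (E u)" if "u \<in> {0..1}" for u
    using E1[OF that, of "\<lambda>_. 1" 1] by simp
  have E1eq: "E 1 = (\<lambda>y. exp (- ((r * of_real y + m)\<^sup>2)))" by (simp add: E_def fun_eq_iff)
  show "integrable lborel (\<lambda>y::real. exp (- ((r * of_real y + m)\<^sup>2)))"
    using E0[of 1] by (simp add: E1eq)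
  define G where "G = (\<lambda>(u::real, y). indicator {0..1} u *\<^sub>R D u y)"
  have "(\<lambda>(u, y). D u y) \<in> borel_measurable borel"
    unfolding D_def E_def case_prod_unfold
    by (intro borel_measurable_continuous_onI continuous_intros)
  then have [measurable]: "(\<lambda>p. D (fst p) (snd p)) \<in> borel_measurable (borel \<Otimes>\<^sub>M borel)"
    by (simp add: case_prod_unfold borel_prod)
  have "(\<lambda>p::real\<times>real. indicator {0..1} (fst p) *\<^sub>R D (fst p) (snd p)) \<in> borel_measurable (borel \<Otimes>\<^sub>M borel)"
    by measurable
  then have mG: "G \<in> borel_measurable borel" by (simp add: G_def case_prod_unfold borel_prod)
  have iG: "integrable (lborel \<Otimes>\<^sub>M lborel) G"
  proof (rule integrable_lborel_pair_bound[OF mG])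
    show "integrable lborel (\<lambda>u. indicator {0..1::real} u :: real)" by simp
    show "integrable lborel (\<lambda>y::real. M * M2 * C * (1 / (1 + y\<^sup>2)))"
      by (intro integrable_mult_right integrable_inverse_1_plus_square)
    show "norm (G (u, y)) \<le> indicator {0..1} u * (M * M2 * C * (1 / (1 + y\<^sup>2)))" for u y
      using D[of u y] by (auto simp: G_def indicator_def)
  qed
  have "(LBINT y. G (u, y)) = 0" for u
  proof (cases "u \<in> {0..1}")
    case True
    have "(LBINT y. D u y) = 0"
    proof (rule integral_dirderiv_eq_0[where b="1::real" and F="\<lambda>y. E u y * ((r - 1) * of_real y + m)"])
      show "integrable lborel (\<lambda>y. E u y * ((r - 1) * of_real y + m))"
      proof (rule E1[OF True, where C="2 * R * 2"])
        show "norm ((r - 1) * of_real y + m) \<le> 2 * R * 2 * (1 + y\<^sup>2)" for y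
        proof -
          have "2 * R * (1 + \<bar>y\<bar>) \<le> 2 * R * (2 * (1 + y\<^sup>2))"
          proof (rule mult_left_mono)
            show "1 + \<bar>y\<bar> \<le> 2 * (1 + y\<^sup>2)" using y_le[of y] zero_le_power2[of y] by argo
            show "0 \<le> 2 * R" using R by simp
          qed
          from order_trans[OF lin1 this] show ?thesis by (simp only: mult.assoc)
        qed
      qed (use R in \<open>auto intro!: continuous_intros\<close>)
      show c: "continuous_on UNIV (D u)"
        unfolding D_def E_def by (intro continuous_intros)
      have [measurable]: "D u \<in> borel_measurable borel" by (intro borel_measurable_continuous_onI c)
      show "integrable lborel (D u)"
      proof (rule Bochner_Integration.integrable_bound)
        show "integrable lborel (\<lambda>y::real. M * M2 * C * (1 / (1 + y\<^sup>2)))"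
          by (intro integrable_mult_right integrable_inverse_1_plus_square)
        show "AE y in lborel. norm (D u y) \<le> norm (M * M2 * C * (1 / (1 + y\<^sup>2)))"
          unfolding real_norm_def by (intro always_eventually allI order_trans[OF D[OF True] abs_ge_self])
      qed simp
      fix z s :: real
      show "((\<lambda>s. E u (z + s *\<^sub>R 1) * ((r - 1) * of_real (z + s *\<^sub>R 1) + m)) has_vector_derivative D u (z + s *\<^sub>R 1)) (at s)"
      proof -
        let ?f = "\<lambda>w. exp (- (((1 + of_real u * (r - 1)) * (of_real z + w) + of_real u * m)\<^sup>2)) * ((r - 1) * (of_real z + w) + m)"
        have "(?f has_field_derivative D u (z + s)) (at (of_real s))"
          unfolding D_def E_def by (rule derivative_eq_intros refl | simp)+ (simp add: algebra_simps power2_eq_square)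
        from has_vector_derivative_real_field[OF this] show ?thesis by (simp add: E_def)
      qed
    qed
    then show ?thesis using True by (simp add: G_def)
  qed (simp add: G_def)
  \<comment> \<open>Exchanging the order of integration turns the vanishing of all
    \<open>y\<close>-integrals into an identity between the two ends of the deformation, the real
    Gaussian and the wanted one.\<close>
  then have "0 = (LBINT u. (LBINT y. G (u, y)))" by simp
  also have "\<dots> = (LBINT y. (LBINT u. G (u, y)))"
    using iG by (intro lborel_pair.Fubini_integral[symmetric]) (simp add: case_prod_eta)
  also have "\<dots> = (LBINT y. r * E 1 y - E 0 y)"
  proof (intro Bochner_Integration.integral_cong refl)
    fix y
    let ?H = "\<lambda>u. (1 + of_real u * (r - 1)) * E u y"
    have "(LBINT u. indicator {0..1} u *\<^sub>R D u y) = ?H 1 - ?H 0"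
    proof (rule integral_FTC_atLeastAtMost)
      show "continuous_on {0..1} (\<lambda>u. D u y)"
        unfolding D_def E_def by (intro continuous_intros)
      show "(?H has_vector_derivative D u y) (at u within {0..1})" for u
      proof -
        let ?f = "\<lambda>w. (1 + w * (r - 1)) * exp (- (((1 + w * (r - 1)) * of_real y + w * m)\<^sup>2))"
        have "(?f has_field_derivative D u y) (at (of_real u))"
          unfolding D_def E_def by (rule derivative_eq_intros refl | simp)+ (simp add: algebra_simps power2_eq_square)
        from has_vector_derivative_real_field[OF this] show ?thesis by (simp add: E_def)
      qed
    qed simp
    then show "(LBINT u. G (u, y)) = r * E 1 y - E 0 y" by (simp add: G_def)
  qed
  also have "\<dots> = r * (LBINT y. E 1 y) - (LBINT y. E 0 y)"
    using E0[of 0] E0[of 1] by simp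
  also have "(LBINT y. E 0 y) = (LBINT y. complex_of_real (exp (- y\<^sup>2)))"
    by (simp add: E_def exp_of_real[symmetric])
  also have "\<dots> = sqrt pi"
    using integral_exp_minus_square by (simp add: has_bochner_integral_iff)
  finally show "(LBINT y. exp (- ((r * of_real y + m)\<^sup>2))) = sqrt pi / r"
    using r by (auto simp: E1eq field_simps)
qed

text \<open>Half of the sector condition becomes a condition on the square, which in the
  applications is rational in the complex times while \<open>r\<close> itself is built from square
  roots.\<close>

lemma Re_gt_abs_Im_iff: "\<bar>Im r\<bar> < Re r \<longleftrightarrow> Re r > 0 \<and> Re (r\<^sup>2) > 0"
proof -
  have "Re (r\<^sup>2) = (Re r - \<bar>Im r\<bar>) * (Re r + \<bar>Im r\<bar>)"
    by (simp add: power2_eq_square algebra_simps)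
  then show ?thesis by (auto simp: zero_less_mult_iff)
qed

lemma Re_of_real_mult: "Re (of_real c * w) = c * Re w"
  by simp

lemma csqrt_Re_pos:
  assumes "Re z > 0"
  shows "Re (csqrt z) > 0" "z \<notin> \<real>\<^sub>\<le>\<^sub>0"
proof -
  show "z \<notin> \<real>\<^sub>\<le>\<^sub>0" using assms by (auto simp: complex_nonpos_Reals_iff)
  have "Re (csqrt z) \<ge> 0" using csqrt_principal[of z] by auto
  moreover have "Re (csqrt z) \<noteq> 0"
  proof
    assume "Re (csqrt z) = 0"
    then have "Re ((csqrt z)\<^sup>2) \<le> 0" by (simp add: power2_eq_square)
    then show False using assms by simp
  qed
  ultimately show "Re (csqrt z) > 0" by simp
qed

text \<open>The square of \<open>r\<close> has positive real part, so \<open>Re r\<close> cannot vanish; its sign is found by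
  moving \<open>z\<close> to \<open>w\<close> along a segment.\<close>
lemma csqrt_add_quotient:
  fixes z w :: complex
  assumes z: "Re z > 0" and w: "Re w > 0"
  defines "r \<equiv> csqrt (z + w) / (2 * csqrt z * csqrt w)"
  shows "r\<^sup>2 = (z + w) / (4 * z * w)" "\<bar>Im r\<bar> < Re r"
proof -
  define g where "g = (\<lambda>z. csqrt (z + w) / (2 * csqrt z * csqrt w))"
  define p where "p = (\<lambda>u::real. w + of_real u * (z - w))"
  have sq: "(g z)\<^sup>2 = (z + w) / (4 * z * w)" for z
    by (simp add: g_def power_divide power_mult_distrib)
  then show "r\<^sup>2 = (z + w) / (4 * z * w)" by (simp add: r_def g_def)
  have Re_sq: "Re ((g z)\<^sup>2) > 0" if "Re z > 0" for z
  proof -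
    have nz: "z \<noteq> 0" "w \<noteq> 0" using that w by auto
    then have "(g z)\<^sup>2 = (1 / z + 1 / w) / 4" unfolding sq by (simp add: field_simps)
    then have "Re ((g z)\<^sup>2) = (Re (1 / z) + Re (1 / w)) / 4"
      by (simp only: Re_divide_numeral plus_complex.simps)
    moreover have "Re (1 / z) > 0" "Re (1 / w) > 0"
      using that w nz by (auto simp: Re_divide sum_power2_gt_zero_iff complex_eq_iff intro!: divide_pos_pos)
    ultimately show ?thesis by simp
  qed
  have Rep: "Re (p u) > 0" if "u \<in> {0..1}" for u
  proof -
    have "Re (p u) = (1 - u) * Re w + u * Re z" by (simp add: p_def algebra_simps)
    moreover have "(1 - u) * Re w \<ge> 0" "u * Re z \<ge> 0" using that z w by auto
    moreover have "(1 - u) * Re w > 0 \<or> u * Re z > 0" using that z w by (cases "u = 0") auto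
    ultimately show ?thesis by linarith
  qed
  have nz: "Re (g (p u)) \<noteq> 0" if "u \<in> {0..1}" for u
    using Re_sq[OF Rep[OF that]] by (auto simp: power2_eq_square)
  have cont: "continuous_on {0..1} (\<lambda>u. Re (g (p u)))"
  proof -
    have "continuous_on {z. Re z > 0} csqrt"
      using csqrt_Re_pos(2) by (intro continuous_on_subset[OF continuous_on_csqrt]) auto
    note c = continuous_on_compose2[OF this]
    have p: "continuous_on {0..1} p" unfolding p_def by (intro continuous_intros)
    have 1: "continuous_on {0..1} (\<lambda>u. csqrt (p u + w))"
      using Rep w by (intro c continuous_on_add continuous_on_const p) (auto intro!: add_pos_pos)
    have 2: "continuous_on {0..1} (\<lambda>u. csqrt (p u))"
      using Rep by (intro c p) auto
    have 3: "2 * csqrt (p u) * csqrt w \<noteq> 0" if "u \<in> {0..1}" for u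
      using Rep[OF that] w by auto
    show ?thesis
      unfolding g_def using 3 by (intro continuous_on_Re continuous_on_divide continuous_on_mult continuous_on_const 1 2) auto
  qed
  \<comment> \<open>At the start of the path both arguments are \<open>w\<close> and the quotient is
    explicit, a positive multiple of \<open>1 / csqrt w\<close>.\<close>
  have g0: "Re (g (p 0)) > 0"
  proof -
    have "csqrt (w + w) = of_real (sqrt 2) * csqrt w"
      using csqrt_Re_pos(1)[OF w] by (intro csqrt_unique) (auto simp: power_mult_distrib simp flip: of_real_power)
    then have "g (p 0) = of_real (sqrt 2 / 2) * (1 / csqrt w)"
      using w by (auto simp: g_def p_def)
    then have "Re (g (p 0)) = (sqrt 2 / 2) * Re (1 / csqrt w)" by (simp only: Re_of_real_mult)
    moreover have "Re (1 / csqrt w) > 0"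
      using csqrt_Re_pos(1)[OF w] by (auto simp: Re_divide intro!: divide_pos_pos add_pos_nonneg)
    ultimately show ?thesis by (simp only:) (intro mult_pos_pos, auto)
  qed
  have "Re (g (p 1)) > 0"
  proof (rule ccontr)
    assume "\<not> Re (g (p 1)) > 0"
    then obtain u where "0 \<le> u" "u \<le> 1" "Re (g (p u)) = 0"
      using IVT2'[of "\<lambda>u. Re (g (p u))" 1 0 0] g0 cont by auto
    then show False using nz[of u] by auto
  qed
  then show "\<bar>Im r\<bar> < Re r"
    unfolding Re_gt_abs_Im_iff using Re_sq[OF z] by (simp add: r_def g_def p_def)
qed


text \<open>This is \<open>(4 \<pi> z)^(-n/2) exp (-|x|^2 / (4 z))\<close>. The half-integer power
  is the n-th power of the principal root, a branch that is holomorphic for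
  \<open>Re z > 0\<close>.\<close>

definition heat_kernel :: "complex \<Rightarrow> 'a::euclidean_space \<Rightarrow> complex" where
  "heat_kernel z x = exp (- (of_real ((norm x)\<^sup>2) / (4 * z))) / (2 * of_real (sqrt pi) * csqrt z) ^ DIM('a)"

lemma heat_kernel_eq_prod:
  "heat_kernel z x = (\<Prod>b\<in>Basis. exp (- (of_real ((x \<bullet> b)\<^sup>2) / (4 * z))) / (2 * of_real (sqrt pi) * csqrt z))"
proof -
  have "(norm x)\<^sup>2 = (\<Sum>b\<in>Basis. (x \<bullet> b)\<^sup>2)"
    by (subst power2_norm_eq_inner, subst euclidean_inner) (simp add: power2_eq_square)
  then show ?thesis
    by (simp add: heat_kernel_def prod_dividef exp_sum[symmetric] sum_negf sum_divide_distrib)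
qed

text \<open>Completing the square in \<open>y\<close> gives the leading coefficient
  \<open>r^2 = (z + w) / (4 z w)\<close>. The choice of root matters: only with \<open>r\<close>
  built from principal roots does the factor \<open>1 / r\<close> of the Gaussian integral combine
  with both normalizations into the principal root of \<open>z + w\<close>.\<close>

lemma heat_kernel_convolution_1D:
  fixes x x' :: real
  assumes z: "Re z > 0" and w: "Re w > 0"
  defines "k \<equiv> \<lambda>z (s::real). exp (- (of_real (s\<^sup>2) / (4 * z))) / (2 * of_real (sqrt pi) * csqrt z)"
  shows "integrable lborel (\<lambda>y. k z (x - y) * k w (x' - y))"
    and "(LBINT y. k z (x - y) * k w (x' - y)) = k (z + w) (x - x')"
proof -
  define r where "r = csqrt (z + w) / (2 * csqrt z * csqrt w)"
  have r: "r\<^sup>2 = (z + w) / (4 * z * w)" "\<bar>Im r\<bar> < Re r"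
    using csqrt_add_quotient[OF z w] by (auto simp: r_def)
  \<comment> \<open>Half of the linear coefficient in \<open>y\<close> of the two exponents, divided
    by \<open>r\<close>.\<close>
  define m where "m = - ((of_real x * w + of_real x' * z) / (2 * z * w)) / (2 * r)"
  have nz: "z \<noteq> 0" "w \<noteq> 0" "z + w \<noteq> 0" "r \<noteq> 0"
    using z w r by (auto simp: complex_eq_iff)
  have nz4: "w * 4 + z * 4 \<noteq> 0"
    using nz(3) by (metis add.commute distrib_right mult_eq_0_iff zero_neq_numeral)
  define c where "c = 1 / (2 * of_real (sqrt pi) * csqrt z) * (1 / (2 * of_real (sqrt pi) * csqrt w))
      * exp (- (of_real ((x - x')\<^sup>2) / (4 * (z + w))))"
  have quad: "(r * of_real y + m)\<^sup>2 + of_real ((x - x')\<^sup>2) / (4 * (z + w))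
      = of_real ((x - y)\<^sup>2) / (4 * z) + of_real ((x' - y)\<^sup>2) / (4 * w)" for y
  proof -
    have "m\<^sup>2 = ((of_real x * w + of_real x' * z) / (2 * z * w))\<^sup>2 / (4 * r\<^sup>2)"
      by (simp add: m_def power_divide power_mult_distrib)
    also have "\<dots> = (of_real x * w + of_real x' * z)\<^sup>2 / (4 * z * w * (z + w))"
    proof -
      have "(S / (2 * z * w))\<^sup>2 / (4 * (T / (4 * z * w))) = S\<^sup>2 / (4 * z * w * T)" if "T \<noteq> 0" for S T
        using nz that by (simp add: divide_simps) (simp add: power2_eq_square)
      then show ?thesis unfolding r(1) using nz by blast
    qed
    finally have m2: "m\<^sup>2 = (of_real x * w + of_real x' * z)\<^sup>2 / (4 * z * w * (z + w))" .
    have rm: "r * m = - ((of_real x * w + of_real x' * z) / (4 * z * w))"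
      using nz by (simp add: m_def)
    have "(r * of_real y + m)\<^sup>2 = r\<^sup>2 * of_real (y\<^sup>2) + 2 * of_real y * (r * m) + m\<^sup>2"
      by (simp add: power2_eq_square algebra_simps)
    also have "\<dots> + of_real ((x - x')\<^sup>2) / (4 * (z + w))
      = of_real ((x - y)\<^sup>2) / (4 * z) + of_real ((x' - y)\<^sup>2) / (4 * w)"
      unfolding r(1) m2 rm using nz nz4
      by (simp add: divide_simps) (simp add: algebra_simps power2_eq_square)
    finally show ?thesis .
  qed
  have eq: "k z (x - y) * k w (x' - y) = c * exp (- ((r * of_real y + m)\<^sup>2))" for y
  proof -
    have "k z (x - y) * k w (x' - y) = 1 / (2 * of_real (sqrt pi) * csqrt z) * (1 / (2 * of_real (sqrt pi) * csqrt w))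
       * exp (- (of_real ((x - y)\<^sup>2) / (4 * z) + of_real ((x' - y)\<^sup>2) / (4 * w)))"
      by (simp add: k_def exp_add[symmetric])
    also have "\<dots> = c * exp (- ((r * of_real y + m)\<^sup>2))"
      unfolding quad[symmetric] c_def by (simp add: exp_add[symmetric] exp_diff exp_minus field_simps)
    finally show ?thesis .
  qed
  show "integrable lborel (\<lambda>y. k z (x - y) * k w (x' - y))"
    unfolding eq by (intro integrable_mult_right integral_complex_gaussian r)
  have "(LBINT y. k z (x - y) * k w (x' - y)) = c * (sqrt pi / r)"
    unfolding eq by (simp add: integral_complex_gaussian r)
  also have "\<dots> = k (z + w) (x - x')"
    using nz unfolding c_def k_def r_def by (simp add: field_simps flip: of_real_mult)
  finally show "(LBINT y. k z (x - y) * k w (x' - y)) = k (z + w) (x - x')" .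
qed

text \<open>The semigroup law, written with two centres and a common integration point: the shape in
  which a kernel meets its conjugate in a Gram kernel. As the kernel is even, \<open>x' = 0\<close>
  gives the usual form.\<close>

lemma heat_kernel_convolution:
  fixes x x' :: "'a::euclidean_space"
  assumes z: "Re z > 0" and w: "Re w > 0"
  shows "integrable lborel (\<lambda>y. heat_kernel z (x - y) * heat_kernel w (x' - y))"
    and "(LBINT y. heat_kernel z (x - y) * heat_kernel w (x' - y)) = heat_kernel (z + w) (x - x')"
proof -
  have eq: "heat_kernel z (x - y) * heat_kernel w (x' - y) =
    (\<Prod>b\<in>Basis. exp (- (of_real (((x \<bullet> b) - y \<bullet> b)\<^sup>2) / (4 * z))) / (2 * of_real (sqrt pi) * csqrt z)
      * (exp (- (of_real (((x' \<bullet> b) - y \<bullet> b)\<^sup>2) / (4 * w))) / (2 * of_real (sqrt pi) * csqrt w)))" for y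
    unfolding heat_kernel_eq_prod prod.distrib inner_diff_left ..
  show "integrable lborel (\<lambda>y. heat_kernel z (x - y) * heat_kernel w (x' - y))"
    unfolding eq by (intro integral_lborel_prod_Basis heat_kernel_convolution_1D z w)
  show "(LBINT y. heat_kernel z (x - y) * heat_kernel w (x' - y)) = heat_kernel (z + w) (x - x')"
    unfolding eq
    by (subst integral_lborel_prod_Basis)
      (simp_all only: heat_kernel_convolution_1D[OF z w] heat_kernel_eq_prod inner_diff_left)
qed

lemma heat_kernel_integral:
  assumes z: "Re z > 0"
  shows "integrable lborel (heat_kernel z :: 'a::euclidean_space \<Rightarrow> complex)"
    and "integral\<^sup>L lborel (heat_kernel z :: 'a::euclidean_space \<Rightarrow> complex) = 1"
proof -
  define r where "r = 1 / (2 * csqrt z)"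
  have nz: "z \<noteq> 0" using z by auto
  have "r\<^sup>2 = of_real (1/4) * (1 / z)" by (simp add: r_def power_divide power_mult_distrib)
  then have "Re (r\<^sup>2) = 1/4 * Re (1 / z)" by (simp only: Re_of_real_mult)
  moreover have "Re (1 / z) > 0" using z by (auto simp: Re_divide intro!: divide_pos_pos add_pos_nonneg)
  moreover have "r = of_real (1/2) * (1 / csqrt z)" by (simp add: r_def)
  then have "Re r = 1/2 * Re (1 / csqrt z)" by (simp only: Re_of_real_mult)
  moreover have "Re (1 / csqrt z) > 0"
    using csqrt_Re_pos(1)[OF z] by (auto simp: Re_divide intro!: divide_pos_pos add_pos_nonneg)
  ultimately have r: "\<bar>Im r\<bar> < Re r" unfolding Re_gt_abs_Im_iff by simp
  have eq: "exp (- (of_real (y\<^sup>2) / (4 * z))) = exp (- ((r * of_real y + 0)\<^sup>2))" for y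
    by (simp add: r_def power_divide power_mult_distrib)
  have i: "integrable lborel (\<lambda>y::real. exp (- (of_real (y\<^sup>2) / (4 * z))) / (2 * of_real (sqrt pi) * csqrt z))"
    unfolding eq by (intro integrable_divide integral_complex_gaussian r)
  have v: "(LBINT y. exp (- (of_real (y\<^sup>2) / (4 * z))) / (2 * of_real (sqrt pi) * csqrt z)) = 1"
    unfolding eq using nz by (simp only: integral_divide_zero integral_complex_gaussian[OF r]) (simp add: r_def)
  show "integrable lborel (heat_kernel z :: 'a \<Rightarrow> complex)"
    unfolding heat_kernel_eq_prod[abs_def] by (intro integral_lborel_prod_Basis i)
  show "integral\<^sup>L lborel (heat_kernel z :: 'a \<Rightarrow> complex) = 1"
    unfolding heat_kernel_eq_prod[abs_def] by (subst integral_lborel_prod_Basis) (simp_all only: i v prod.neutral_const)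
qed

lemma heat_kernel_commute: "heat_kernel z (x - y) = heat_kernel z (y - x)"
  by (simp add: heat_kernel_def norm_minus_commute)

lemma cnj_heat_kernel:
  assumes "Re z > 0"
  shows "cnj (heat_kernel z x) = heat_kernel (cnj z) x"
  using csqrt_Re_pos(2)[OF assms] by (simp add: heat_kernel_def exp_cnj cnj_csqrt)

lemma norm_heat_kernel:
  fixes x :: "'a::euclidean_space"
  shows "norm (heat_kernel z x) = exp (- ((norm x)\<^sup>2 * Re z / (4 * (norm z)\<^sup>2))) / (2 * sqrt pi * sqrt (norm z)) ^ DIM('a)"
proof -
  have "Re (of_real ((norm x)\<^sup>2) / (4 * z)) = (norm x)\<^sup>2 / 4 * Re (1 / z)"
  proof -
    have "of_real ((norm x)\<^sup>2) / (4 * z) = of_real ((norm x)\<^sup>2 / 4) * (1 / z)" by simp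
    then show ?thesis by (simp only: Re_of_real_mult)
  qed
  moreover have "Re (1 / z) = Re z / (norm z)\<^sup>2"
    by (simp add: Re_divide cmod_power2)
  ultimately show ?thesis
    by (simp add: heat_kernel_def norm_divide norm_power norm_mult)
qed

lemma norm_heat_kernel_le:
  fixes x :: "'a::euclidean_space"
  assumes "Re z \<ge> 0"
  shows "norm (heat_kernel z x) \<le> 1 / (2 * sqrt pi * sqrt (norm z)) ^ DIM('a)"
  unfolding norm_heat_kernel using assms by (intro divide_right_mono) auto

text \<open>The modulus is a multiple of the heat kernel at the real time
  \<open>r = |z|^2 / Re z\<close>. For fixed nonzero imaginary part the value blows up as
  \<open>Re z\<close> tends to 0, so at nonreal times it can only justify exchanges of
  integrals.\<close>

lemma integral_norm_heat_kernel:
  assumes z: "Re z > 0"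
  shows "(LBINT x. norm (heat_kernel z (x::'a::euclidean_space))) = sqrt (norm z / Re z) ^ DIM('a)"
proof -
  define r where "r = (norm z)\<^sup>2 / Re z"
  have nz: "norm z > 0" using z by auto
  have r: "r > 0" using z nz by (simp add: r_def)
  have eq: "of_real (norm (heat_kernel z x)) = of_real (sqrt (norm z / Re z) ^ DIM('a)) * heat_kernel (of_real r) x"
    for x :: 'a
  proof -
    have "csqrt (of_real r) = of_real (sqrt r)" using r by (simp add: csqrt_of_real)
    moreover have "sqrt r = sqrt (norm z) * sqrt (norm z / Re z)"
      using z nz by (simp add: r_def real_sqrt_mult[symmetric] power2_eq_square)
    ultimately have "heat_kernel (of_real r) x = of_real (exp (- ((norm x)\<^sup>2 / (4 * r))) /
        (2 * sqrt pi * (sqrt (norm z) * sqrt (norm z / Re z))) ^ DIM('a))"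
      by (simp add: heat_kernel_def exp_of_real[symmetric])
    moreover have "norm (heat_kernel z x) = sqrt (norm z / Re z) ^ DIM('a) * (exp (- ((norm x)\<^sup>2 / (4 * r))) /
        (2 * sqrt pi * (sqrt (norm z) * sqrt (norm z / Re z))) ^ DIM('a))"
      using z nz unfolding norm_heat_kernel r_def by (simp add: power_mult_distrib)
    ultimately show ?thesis by (simp only: of_real_mult)
  qed
  have "complex_of_real (LBINT x. norm (heat_kernel z (x::'a))) = (LBINT x. of_real (norm (heat_kernel z (x::'a))))"
    by simp
  also have "\<dots> = of_real (sqrt (norm z / Re z) ^ DIM('a))"
    unfolding eq using r by (simp add: heat_kernel_integral)
  finally show ?thesis by (simp only: of_real_eq_iff)
qed

lemma borel_measurable_cnj [measurable (raw)]:
  "f \<in> borel_measurable M \<Longrightarrow> (\<lambda>x. cnj (f x)) \<in> borel_measurable M"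
  by (rule borel_measurable_continuous_on) (intro continuous_intros)

section \<open>The \<open>TT\<^sup>*\<close> identity and the \<open>L\<^sup>2\<close> contraction\<close>

text \<open>Expanding \<open>|S w|^2\<close> as a double integral and integrating over
  \<open>w\<close> first produces the Gram kernel of \<open>P\<close>. For absolute convergence one
  factor \<open>P\<close> is bounded by \<open>c\<close> and the other is integrated; neither
  \<open>c\<close> nor \<open>c'\<close> enters the resulting identity.\<close>

lemma square_integral_kernel:
  fixes P :: "'a::euclidean_space \<times> 'b::euclidean_space \<Rightarrow> complex" and g :: "'b \<Rightarrow> complex"
  assumes mP: "P \<in> borel_measurable borel" and bP: "\<And>w z. norm (P (w, z)) \<le> c"
    and iP: "\<And>z. integrable lborel (\<lambda>w. P (w, z))"
    and nP: "\<And>z. (LBINT w. norm (P (w, z))) \<le> c'"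
    and g: "integrable lborel g"
  defines "S \<equiv> \<lambda>w. LBINT z. P (w, z) * g z"
    and "Q \<equiv> \<lambda>p. g (fst p) * cnj (g (snd p)) * (LBINT w. P (w, fst p) * cnj (P (w, snd p)))"
  shows "integrable lborel (\<lambda>w. (norm (S w))\<^sup>2)" "integrable lborel Q"
    and "of_real (LBINT w. (norm (S w))\<^sup>2) = (LBINT p. Q p)"
proof -
  have [measurable]: "g \<in> borel_measurable borel" using g by auto
  have mP'[measurable]: "P \<in> borel_measurable (borel \<Otimes>\<^sub>M borel)" using mP by (simp add: borel_prod)
  define F where "F = (\<lambda>(p, w). P (w, fst p) * g (fst p) * cnj (P (w, snd p) * g (snd p)))"
  have mF: "F \<in> borel_measurable ((borel \<Otimes>\<^sub>M borel) \<Otimes>\<^sub>M borel)"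
    unfolding F_def by measurable
  have [measurable]: "F \<in> borel_measurable (lborel \<Otimes>\<^sub>M lborel)"
    using mF by (simp add: borel_prod lborel_prod)
  have c: "c \<ge> 0" using bP[of undefined undefined] norm_ge_zero order_trans by blast
  have i1: "integrable lborel (\<lambda>w. F (p, w))" for p
  proof (rule Bochner_Integration.integrable_bound)
    show "integrable lborel (\<lambda>w. norm (g (fst p)) * norm (g (snd p)) * c * P (w, fst p))"
      by (intro integrable_mult_right iP)
    show "(\<lambda>w. F (p, w)) \<in> borel_measurable lborel" by measurable
    have "norm (F (p, w)) \<le> norm (norm (g (fst p)) * norm (g (snd p)) * c * P (w, fst p))" for w
    proof -
      have "norm (F (p, w)) = norm (g (fst p)) * norm (g (snd p)) * norm (P (w, snd p)) * norm (P (w, fst p))"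
        by (simp add: F_def norm_mult)
      also have "\<dots> \<le> norm (g (fst p)) * norm (g (snd p)) * c * norm (P (w, fst p))"
        by (intro mult_right_mono mult_left_mono bP) auto
      finally show ?thesis using c by (simp add: norm_mult)
    qed
    then show "AE w in lborel. norm (F (p, w)) \<le> norm (norm (g (fst p)) * norm (g (snd p)) * c * P (w, fst p))"
      by simp
  qed
  have gg: "integrable lborel (\<lambda>p. c * c' * (norm (g (fst p)) * norm (g (snd p))))"
  proof -
    have m: "(\<lambda>p. norm (g (fst p)) * norm (g (snd p))) \<in> borel_measurable (borel \<Otimes>\<^sub>M borel)" by measurable
    have "integrable (lborel \<Otimes>\<^sub>M lborel) (\<lambda>p. norm (g (fst p)) * norm (g (snd p)))"
      by (rule integrable_lborel_pair_bound[where g="\<lambda>x. norm (g x)" and h="\<lambda>x. norm (g x)"])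
        (use g m in \<open>auto simp: borel_prod\<close>)
    then show ?thesis by (simp add: lborel_prod)
  qed
  have i2: "integrable lborel (\<lambda>p. LBINT w. norm (F (p, w)))"
  proof (rule Bochner_Integration.integrable_bound[OF gg])
    show "(\<lambda>p. LBINT w. norm (F (p, w))) \<in> borel_measurable lborel" by measurable
    have "(LBINT w. norm (F (p, w))) \<le> c * c' * (norm (g (fst p)) * norm (g (snd p)))" for p
    proof -
      have "(LBINT w. norm (F (p, w))) \<le> (LBINT w. norm (g (fst p)) * norm (g (snd p)) * c * norm (P (w, fst p)))"
      proof (rule integral_mono)
        show "norm (F (p, w)) \<le> norm (g (fst p)) * norm (g (snd p)) * c * norm (P (w, fst p))" for w
          using mult_right_mono[OF bP[of w "snd p"], of "norm (g (fst p)) * norm (g (snd p)) * norm (P (w, fst p))"]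
          by (simp add: F_def norm_mult mult_ac)
      qed (use i1 iP in auto)
      also have "\<dots> \<le> norm (g (fst p)) * norm (g (snd p)) * c * c'"
        using nP[of "fst p"] c by (simp add: mult_left_mono)
      finally show ?thesis by (simp add: mult_ac)
    qed
    then show "AE p in lborel. norm (LBINT w. norm (F (p, w))) \<le> norm (c * c' * (norm (g (fst p)) * norm (g (snd p))))"
      by (intro always_eventually allI) (simp add: order_trans[OF _ abs_ge_self])
  qed
  have iF: "integrable (lborel \<Otimes>\<^sub>M lborel) F"
    using i1 i2 by (intro lborel_pair.Fubini_integrable) auto
  have Q: "(LBINT w. F (p, w)) = Q p" for p
  proof -
    have "(LBINT w. F (p, w)) = (LBINT w. g (fst p) * cnj (g (snd p)) * (P (w, fst p) * cnj (P (w, snd p))))"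
      by (simp add: F_def mult_ac)
    also have "\<dots> = Q p" unfolding Q_def by (rule integral_mult_right_zero)
    finally show ?thesis .
  qed
  have S: "(LBINT p. F (p, w)) = of_real ((norm (S w))\<^sup>2)" for w
  proof -
    have "(\<lambda>p. P (w, fst p) * g (fst p) * cnj (P (w, snd p) * g (snd p))) \<in> borel_measurable (borel \<Otimes>\<^sub>M borel)"
      by measurable
    then have m: "(\<lambda>p. F (p, w)) \<in> borel_measurable (borel \<Otimes>\<^sub>M borel)"
      by (simp add: F_def)
    have "integrable (lborel \<Otimes>\<^sub>M lborel) (\<lambda>p. F (p, w))"
    proof (rule integrable_lborel_pair_bound[where g="\<lambda>z. c * norm (g z)" and h="\<lambda>z. c * norm (g z)"])
      show "norm (F ((x, y), w)) \<le> c * norm (g x) * (c * norm (g y))" for x y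
        unfolding F_def using bP c by (auto simp: norm_mult intro!: mult_mono)
    qed (use g m in \<open>auto simp: borel_prod\<close>)
    then have "(\<integral>p. F (p, w) \<partial>(lborel \<Otimes>\<^sub>M lborel)) = (LBINT x. (LBINT y. F ((x, y), w)))"
      by (rule lborel_pair.integral_fst'[symmetric])
    also have "\<dots> = (LBINT x. (LBINT y. (P (w, x) * g x) * cnj (P (w, y) * g y)))"
      by (simp add: F_def)
    also have "\<dots> = (LBINT x. (P (w, x) * g x) * cnj (S w))"
      by (simp only: integral_mult_right_zero Bochner_Integration.integral_cnj S_def)
    also have "\<dots> = S w * cnj (S w)"
      by (simp only: integral_mult_left_zero S_def)
    finally show ?thesis by (simp only: lborel_prod complex_norm_square)
  qed
  have "integrable lborel (\<lambda>w. LBINT p. F (p, w))"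
    using lborel_pair.integrable_snd[of "\<lambda>p w. F (p, w)"] iF by (simp add: case_prod_eta)
  then have "integrable lborel (\<lambda>w. complex_of_real ((norm (S w))\<^sup>2))" unfolding S .
  then show "integrable lborel (\<lambda>w. (norm (S w))\<^sup>2)"
    using complex_of_real_integrable_eq by blast
  show "integrable lborel Q"
    using lborel_pair.integrable_fst'[OF iF] unfolding Q .
  have "complex_of_real (LBINT w. (norm (S w))\<^sup>2) = (LBINT w. of_real ((norm (S w))\<^sup>2))"
    by (rule integral_complex_of_real[symmetric])
  also have "\<dots> = (LBINT w. (LBINT p. F (p, w)))" by (simp only: S)
  also have "\<dots> = (LBINT p. (LBINT w. F (p, w)))"
    using iF lborel_pair.Fubini_integral[of "\<lambda>p w. F (p, w)"] by (simp add: case_prod_eta)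
  finally show "of_real (LBINT w. (norm (S w))\<^sup>2) = (LBINT p. Q p)" by (simp only: Q)
qed

lemma continuous_on_heat_kernel:
  fixes f :: "'c::topological_space \<Rightarrow> complex" and g :: "'c \<Rightarrow> 'a::euclidean_space"
  assumes f: "continuous_on S f" and g: "continuous_on S g" and Re: "\<And>s. s \<in> S \<Longrightarrow> Re (f s) > 0"
  shows "continuous_on S (\<lambda>s. heat_kernel (f s) (g s))"
proof -
  have "continuous_on {z. Re z > 0} csqrt"
    using csqrt_Re_pos(2) by (intro continuous_on_subset[OF continuous_on_csqrt]) auto
  then have 1: "continuous_on S (\<lambda>s. csqrt (f s))"
    using Re by (intro continuous_on_compose2[OF _ f]) auto
  have 2: "f s \<noteq> 0" if "s \<in> S" for s using Re[OF that] by auto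
  show ?thesis
    unfolding heat_kernel_def using 2 by (intro continuous_intros f g 1) auto
qed

lemma integrable_bounded_square:
  fixes g :: "'a::euclidean_space \<Rightarrow> complex"
  assumes g: "integrable lborel g" and b: "\<And>x. norm (g x) \<le> B"
  shows "integrable lborel (\<lambda>x. (norm (g x))\<^sup>2)"
proof (rule Bochner_Integration.integrable_bound)
  show "integrable lborel (\<lambda>x. B * norm (g x))" using g by auto
  show "(\<lambda>x. (norm (g x))\<^sup>2) \<in> borel_measurable lborel" using g by measurable
  have "(norm (g x))\<^sup>2 \<le> B * norm (g x)" for x
    unfolding power2_eq_square by (intro mult_right_mono b) auto
  then show "AE x in lborel. norm ((norm (g x))\<^sup>2) \<le> norm (B * norm (g x))"
    by (intro always_eventually allI) (simp add: order_trans[OF _ abs_ge_self])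
qed

text \<open>By the semigroup law the Gram kernel is the heat kernel at the real time
  \<open>z + cnj z = 2 Re z\<close>, a probability density whatever the imaginary part is. Schur's
  test then gives operator norm at most 1, as Plancherel's theorem would.\<close>

lemma heat_kernel_L2_contraction:
  fixes g :: "'a::euclidean_space \<Rightarrow> complex"
  assumes z: "Re z > 0" and g: "integrable lborel g" and b: "\<And>x. norm (g x) \<le> B"
  defines "S \<equiv> \<lambda>x. LBINT y. heat_kernel z (x - y) * g y"
  shows "integrable lborel (\<lambda>x. (norm (S x))\<^sup>2)"
    and "(LBINT x. (norm (S x))\<^sup>2) \<le> (LBINT x. (norm (g x))\<^sup>2)"
proof -
  have [measurable]: "g \<in> borel_measurable borel" using g by auto
  have hk_m: "heat_kernel z \<in> borel_measurable (borel :: 'a measure)" if "Re z > 0" for z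
    using borel_measurable_integrable[OF heat_kernel_integral(1)[OF that, where 'a='a]] by simp
  define P :: "'a \<times> 'a \<Rightarrow> complex" where "P = (\<lambda>(w, y). heat_kernel z (w - y))"
  have mP: "P \<in> borel_measurable borel"
    unfolding P_def case_prod_unfold
    by (intro borel_measurable_continuous_onI continuous_on_heat_kernel continuous_intros z)
  have iP: "integrable lborel (\<lambda>w. P (w, y))" for y
    using integrable_lborel_shift[OF heat_kernel_integral(1)[OF z], of "- y"] by (simp add: P_def)
  have nP: "(LBINT w. norm (P (w, y))) \<le> sqrt (norm z / Re z) ^ DIM('a)" for y
    using integral_lborel_shift[of "\<lambda>x. norm (heat_kernel z x)" "- y"] hk_m[OF z]
      integral_norm_heat_kernel[OF z, where 'a='a] by (simp add: P_def)
  have bP: "norm (P (w, y)) \<le> 1 / (2 * sqrt pi * sqrt (norm z)) ^ DIM('a)" for w y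
    using norm_heat_kernel_le[of z "w - y"] z by (simp add: P_def)
  note TT = square_integral_kernel[OF mP bP iP nP g]
  have Seq: "S = (\<lambda>w. LBINT y. P (w, y) * g y)" by (simp add: S_def P_def)
  show "integrable lborel (\<lambda>x. (norm (S x))\<^sup>2)" unfolding Seq by (rule TT)
  define r where "r = 2 * Re z"
  have r: "r > 0" using z by (simp add: r_def)
  have inner: "(LBINT w. P (w, y) * cnj (P (w, y'))) = heat_kernel (of_real r) (y - y')" for y y'
  proof -
    have "(LBINT w. P (w, y) * cnj (P (w, y'))) = (LBINT w. heat_kernel z (y - w) * heat_kernel (cnj z) (y' - w))"
      by (simp add: P_def cnj_heat_kernel[OF z] heat_kernel_commute[of _ y] heat_kernel_commute[of _ y'])
    also have "\<dots> = heat_kernel (z + cnj z) (y - y')"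
      using z by (intro heat_kernel_convolution) auto
    also have "z + cnj z = of_real r" by (simp add: r_def complex_add_cnj)
    finally show ?thesis .
  qed
  define Q where "Q = (\<lambda>p. g (fst p) * cnj (g (snd p)) * heat_kernel (of_real r) (fst p - snd p))"
  have iQ: "integrable lborel Q" and eqQ: "of_real (LBINT w. (norm (S w))\<^sup>2) = (LBINT p. Q p)"
    using TT(2,3) unfolding inner Q_def Seq by simp_all
  define N where "N = (LBINT x. (norm (g x))\<^sup>2)"
  have g2: "integrable lborel (\<lambda>x. (norm (g x))\<^sup>2)" by (rule integrable_bounded_square[OF g b])
  \<comment> \<open>The Schur majorant: the modulus of \<open>Q\<close> is at most the mean of
    \<open>R\<close> and of \<open>R\<close> with its arguments swapped, and both have integral
    \<open>N\<close>.\<close>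
  define R where "R = (\<lambda>p. (norm (g (fst p)))\<^sup>2 * norm (heat_kernel (of_real r) (fst p - snd p)))"
  have hk1: "integrable lborel (\<lambda>y. norm (heat_kernel (of_real r) (x - y)))" for x :: 'a
    using integrable_lborel_reflect[OF heat_kernel_integral(1), of "of_real r" x] r by simp
  have hk2: "(LBINT y. norm (heat_kernel (of_real r) (x - y))) = 1" for x :: 'a
    using integral_lborel_reflect[of "\<lambda>y. norm (heat_kernel (of_real r) y)" x] hk_m[of "of_real r"]
      integral_norm_heat_kernel[of "of_real r", where 'a='a] r by simp
  have mhk: "(\<lambda>p::'a\<times>'a. heat_kernel (of_real r) (fst p - snd p)) \<in> borel_measurable borel"
    using r by (intro borel_measurable_continuous_onI continuous_on_heat_kernel continuous_intros) auto
  then have [measurable]: "(\<lambda>p::'a\<times>'a. heat_kernel (of_real r) (fst p - snd p)) \<in> borel_measurable (borel \<Otimes>\<^sub>M borel)"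
    by (simp add: borel_prod)
  have mR: "R \<in> borel_measurable (borel \<Otimes>\<^sub>M borel)" unfolding R_def by measurable
  have iR: "integrable (lborel \<Otimes>\<^sub>M lborel) R"
  proof (rule lborel_pair.Fubini_integrable)
    show "R \<in> borel_measurable (lborel \<Otimes>\<^sub>M lborel)" using mR by (simp add: borel_prod lborel_prod)
    show "integrable lborel (\<lambda>x. LBINT y. norm (R (x, y)))"
      using g2 by (simp add: R_def hk2)
    show "AE x in lborel. integrable lborel (\<lambda>y. R (x, y))"
      using hk1 by (simp add: R_def)
  qed
  have R: "(\<integral>p. R p \<partial>(lborel \<Otimes>\<^sub>M lborel)) = N"
    using lborel_pair.integral_fst'[OF iR, symmetric] by (simp add: R_def hk2 N_def)
  have iR': "integrable (lborel \<Otimes>\<^sub>M lborel) (\<lambda>(x, y). R (y, x))"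
    by (rule lborel_pair.integrable_product_swap[OF iR])
  have R': "(\<integral>(x, y). R (y, x) \<partial>(lborel \<Otimes>\<^sub>M lborel)) = N"
    unfolding R[symmetric] by (rule lborel_pair.integral_product_swap) (use iR in auto)
  have "(LBINT w. (norm (S w))\<^sup>2) = norm (LBINT p. Q p)"
    unfolding eqQ[symmetric] by simp
  also have "\<dots> \<le> (LBINT p. norm (Q p))" by (rule integral_norm_bound)
  also have "\<dots> = (\<integral>p. norm (Q p) \<partial>(lborel \<Otimes>\<^sub>M lborel))" by (simp only: lborel_prod)
  also have "\<dots> \<le> (\<integral>p. (R p + (case p of (x, y) \<Rightarrow> R (y, x))) / 2 \<partial>(lborel \<Otimes>\<^sub>M lborel))"
  proof (rule integral_mono)
    show "integrable (lborel \<Otimes>\<^sub>M lborel) (\<lambda>p. norm (Q p))" using iQ by (simp add: lborel_prod)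
    show "integrable (lborel \<Otimes>\<^sub>M lborel) (\<lambda>p. (R p + (case p of (x, y) \<Rightarrow> R (y, x))) / 2)"
      using iR iR' by auto
    fix p
    have am: "a * b \<le> (a\<^sup>2 + b\<^sup>2) / 2" for a b :: real
      using zero_le_power2[of "a - b"] by (simp add: power2_diff)
    have "norm (Q p) = norm (g (fst p)) * norm (g (snd p)) * norm (heat_kernel (of_real r) (fst p - snd p))"
      by (simp add: Q_def norm_mult)
    also have "\<dots> \<le> ((norm (g (fst p)))\<^sup>2 + (norm (g (snd p)))\<^sup>2) / 2 * norm (heat_kernel (of_real r) (fst p - snd p))"
      by (intro mult_right_mono am) auto
    also have "\<dots> = (R p + (case p of (x, y) \<Rightarrow> R (y, x))) / 2"
      using heat_kernel_commute[of "of_real r" "fst p" "snd p"]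
      by (simp add: R_def case_prod_unfold distrib_right add_divide_distrib)
    finally show "norm (Q p) \<le> (R p + (case p of (x, y) \<Rightarrow> R (y, x))) / 2" .
  qed
  also have "\<dots> = N" using iR iR' R R' by simp
  finally show "(LBINT x. (norm (S x))\<^sup>2) \<le> (LBINT x. (norm (g x))\<^sup>2)" by (simp add: N_def)
qed

text \<open>A sum of squares instead of a product of norms: the interpolation below rescales
  \<open>g\<close> and \<open>h\<close> against each other and so chooses the weights of the two
  squares itself.\<close>

lemma norm_heat_kernel_bilinear_L2:
  fixes g h :: "'a::euclidean_space \<Rightarrow> complex"
  assumes z: "Re z > 0" and g: "integrable lborel g" "\<And>x. norm (g x) \<le> B"
    and h: "integrable lborel h" "\<And>x. norm (h x) \<le> B'"
  shows "norm (LBINT x. h x * (LBINT y. heat_kernel z (x - y) * g y))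
    \<le> ((LBINT x. (norm (g x))\<^sup>2) + (LBINT x. (norm (h x))\<^sup>2)) / 2"
proof -
  define S where "S = (\<lambda>x. LBINT y. heat_kernel z (x - y) * g y)"
  have S: "integrable lborel (\<lambda>x. (norm (S x))\<^sup>2)"
    "(LBINT x. (norm (S x))\<^sup>2) \<le> (LBINT x. (norm (g x))\<^sup>2)"
    unfolding S_def using heat_kernel_L2_contraction[OF z g] by auto
  have h2: "integrable lborel (\<lambda>x. (norm (h x))\<^sup>2)" by (rule integrable_bounded_square[OF h])
  have am: "a * b \<le> (a\<^sup>2 + b\<^sup>2) / 2" for a b :: real
    using zero_le_power2[of "a - b"] by (simp add: power2_diff)
  have "norm (LBINT x. h x * S x) \<le> (LBINT x. norm (h x * S x))" by (rule integral_norm_bound)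
  also have "\<dots> \<le> (LBINT x. ((norm (h x))\<^sup>2 + (norm (S x))\<^sup>2) / 2)"
    using h2 S(1) am by (intro integral_mono_AE') (auto simp: norm_mult)
  also have "\<dots> \<le> ((LBINT x. (norm (g x))\<^sup>2) + (LBINT x. (norm (h x))\<^sup>2)) / 2"
    using h2 S by simp
  finally show ?thesis by (simp add: S_def)
qed

section \<open>The Hardy-Littlewood-Sobolev inequality on the line\<close>

lemma nn_integral_powr_from_0:
  assumes "a > (-1::real)" "c \<ge> 0"
  shows "(\<integral>\<^sup>+t. ennreal (t powr a) * indicator {0..c} t \<partial>lborel) = ennreal (c powr (a + 1) / (a + 1))"
  using has_integral_powr_from_0[OF assms] by (intro nn_integral_has_integral_lebesgue') auto

lemma nn_integral_powr_to_inf: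
  assumes "a < (-1::real)" "c > 0"
  shows "(\<integral>\<^sup>+t. ennreal (t powr a) * indicator {c..} t \<partial>lborel) = ennreal (- (c powr (a + 1)) / (a + 1))"
  using has_integral_powr_to_inf[OF assms] by (intro nn_integral_has_integral_lebesgue') auto

lemma nn_integral_abs_diff_le:
  fixes f :: "real \<Rightarrow> ennreal"
  assumes [measurable]: "f \<in> borel_measurable borel"
  shows "(\<integral>\<^sup>+b. f \<bar>a - b\<bar> \<partial>lborel) \<le> 2 * (\<integral>\<^sup>+t. f t * indicator {0..} t \<partial>lborel)"
proof -
  define h where "h = (\<lambda>t. f t * indicator {0..} t)"
  have [measurable]: "h \<in> borel_measurable borel" by (simp add: h_def)
  have "(\<integral>\<^sup>+b. f \<bar>a - b\<bar> \<partial>lborel) \<le> (\<integral>\<^sup>+b. h (a + (-1) * b) + h (- a + 1 * b) \<partial>lborel)"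
    by (intro nn_integral_mono) (auto simp: h_def abs_if indicator_def)
  also have "\<dots> = (\<integral>\<^sup>+b. h (a + (-1) * b) \<partial>lborel) + (\<integral>\<^sup>+b. h (- a + 1 * b) \<partial>lborel)"
    by (rule nn_integral_add) auto
  also have "\<dots> = 2 * (\<integral>\<^sup>+t. h t \<partial>lborel)"
    using nn_integral_real_affine[of h "-1" a] nn_integral_real_affine[of h 1 "-a"]
    by (simp add: mult_2)
  finally show ?thesis by (simp add: h_def)
qed

text \<open>By symmetry only the region \<open>G b \<le> G a\<close> matters. There \<open>G b\<close> is bounded by \<open>L = G a\<close>
  for \<open>b\<close> within distance \<open>\<rho> = L\<^bsup>-p\<^esup>\<close> of \<open>a\<close>; further away,
  \<open>L G(b) |a - b|\<^bsup>-\<alpha>\<^esup>\<close> is at most \<open>|a - b|\<^bsup>-2\<^esup> + L\<^sup>p G(b)\<^sup>p\<close>.\<close>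
lemma Hardy_Littlewood_Sobolev_normalized:
  fixes G :: "real \<Rightarrow> real"
  assumes p: "1 < p" "p < 2" and mG[measurable]: "G \<in> borel_measurable borel" and G0: "\<And>t. 0 \<le> G t"
    and N: "(\<integral>\<^sup>+t. ennreal (G t powr p) \<partial>lborel) \<le> 1"
  shows "(\<integral>\<^sup>+a. (\<integral>\<^sup>+b. ennreal (G a * G b * \<bar>a - b\<bar> powr - (2 - 2 / p)) \<partial>lborel) \<partial>lborel)
    \<le> ennreal (2 * (2 / (2 / p - 1) + 3))"
proof -
  define \<alpha> where "\<alpha> = 2 - 2 / p"
  \<comment> \<open>The near region contributes \<open>2 / (1 - \<alpha>)\<close>, the tail of
    \<open>\<bar>a - b\<bar> powr - 2\<close> contributes 2, and the comparison term
    \<open>L^p G(b)^p\<close> contributes 1.\<close>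
  define C where "C = 2 / (2 / p - 1) + 3"
  have C: "C \<ge> 0" using p by (simp add: C_def)
  have \<alpha>: "0 < \<alpha>" "\<alpha> < 1" "1 - \<alpha> = 2 / p - 1" "p * (1 - \<alpha>) = 2 - p" "(2 - \<alpha>) * (p - 1) = \<alpha>"
    using p by (auto simp: \<alpha>_def field_simps)
  define F where "F = (\<lambda>a b. ennreal (G a * G b * \<bar>a - b\<bar> powr - \<alpha> * indicator {0..G a} (G b)))"
  have mF: "case_prod F \<in> borel_measurable (lborel \<Otimes>\<^sub>M lborel)"
  proof -
    have "case_prod F \<in> borel_measurable (borel \<Otimes>\<^sub>M borel)" unfolding F_def case_prod_unfold by (simp add: indicator_def cong: measurable_cong)
    then show ?thesis by (simp add: borel_prod lborel_prod)
  qed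
  have [measurable]: "F a \<in> borel_measurable borel" for a
    unfolding F_def by (simp add: indicator_def cong: measurable_cong)
  have inner: "(\<integral>\<^sup>+b. F a b \<partial>lborel) \<le> ennreal C * ennreal (G a powr p)" for a
  proof (cases "G a = 0")
    case True
    then show ?thesis by (simp add: F_def)
  next
    case False
    define L where "L = G a"
    have L: "L > 0" using False G0[of a] by (simp add: L_def)
    \<comment> \<open>For this radius both \<open>L^2 * \<rho> powr (1 - \<alpha>)\<close> and
      \<open>1 / \<rho>\<close> equal \<open>L powr p\<close>, because
      \<open>p * (1 - \<alpha>) = 2 - p\<close>.\<close>
    define \<rho> where "\<rho> = L powr - p"
    have \<rho>: "\<rho> > 0" using L by (simp add: \<rho>_def)
    have pt: "F a b \<le> ennreal (L ^ 2) * (ennreal (\<bar>a - b\<bar> powr - \<alpha>) * indicator {0..\<rho>} \<bar>a - b\<bar>)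
        + (ennreal (\<bar>a - b\<bar> powr - 2) * indicator {\<rho>..} \<bar>a - b\<bar>
        + ennreal (L powr p) * ennreal (G b powr p))" for b
    proof -
      define s where "s = \<bar>a - b\<bar>"
      have s0: "s \<ge> 0" by (simp add: s_def)
      define y where "y = G b"
      have y0: "y \<ge> 0" using G0 by (simp add: y_def)
      have real: "L * y * s powr - \<alpha> * indicator {0..L} y \<le>
         L ^ 2 * (s powr - \<alpha> * indicator {0..\<rho>} s) + (s powr - 2 * indicator {\<rho>..} s + L powr p * y powr p)"
      proof (cases "y \<in> {0..L}")
        case False
        then show ?thesis by simp
      next
        case yL: True
        show ?thesis
        proof (cases "s \<le> \<rho>")
          case True
          have 1: "L * y * s powr - \<alpha> \<le> L * L * s powr - \<alpha>"
            using yL L by (intro mult_right_mono mult_left_mono) auto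
          have 2: "0 \<le> s powr - 2 * indicator {\<rho>..} s + L powr p * y powr p" by simp
          show ?thesis using add_mono[OF 1 2] True yL s0 by (simp add: power2_eq_square)
        next
          case s: False
          then have spos: "s > 0" using \<rho> by simp
          have "L * y * s powr - \<alpha> \<le> s powr - 2 + L powr p * y powr p"
          \<comment> \<open>At equality the left side and both summands on the right coincide. Below
            the threshold the first summand dominates; above it the second does, by
            \<open>(2 - \<alpha>) * (p - 1) = \<alpha>\<close>.\<close>
          proof (cases "L * y \<le> s powr - (2 - \<alpha>)")
            case True
            have "L * y * s powr - \<alpha> \<le> s powr - (2 - \<alpha>) * s powr - \<alpha>"
              using True by (intro mult_right_mono) auto
            also have "\<dots> = s powr - 2" by (simp flip: powr_add)
            finally show ?thesis by (simp add: add_increasing2)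
          next
            case False
            then have Ly: "L * y > s powr - (2 - \<alpha>)" by simp
            then have Ly0: "L * y > 0" using powr_ge_zero[of s] by (meson less_le_trans not_le order_trans)
            then have ypos: "y > 0" using L by (simp add: zero_less_mult_iff)
            have "s powr - \<alpha> = (s powr - (2 - \<alpha>)) powr (p - 1)"
              unfolding powr_powr mult_minus_left \<alpha>(5) ..
            also have "\<dots> \<le> (L * y) powr (p - 1)" using Ly p by (intro powr_mono2) auto
            finally have "L * y * s powr - \<alpha> \<le> L * y * (L * y) powr (p - 1)"
              using Ly0 by (intro mult_left_mono) auto
            also have "\<dots> = (L * y) powr (1 + (p - 1))"
              using Ly0 by (subst powr_add) simp
            also have "\<dots> = L powr p * y powr p" using L ypos by (simp add: powr_mult)
            finally show ?thesis by (simp add: add_increasing)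
          qed
          then show ?thesis using s yL by simp
        qed
      qed
      have "F a b = ennreal (L * y * s powr - \<alpha> * indicator {0..L} y)"
        by (simp add: F_def L_def y_def s_def)
      also have "\<dots> \<le> ennreal (L ^ 2 * (s powr - \<alpha> * indicator {0..\<rho>} s) + (s powr - 2 * indicator {\<rho>..} s + L powr p * y powr p))"
        by (rule ennreal_leI[OF real])
      also have "\<dots> = ennreal (L ^ 2) * (ennreal (s powr - \<alpha>) * indicator {0..\<rho>} s)
        + (ennreal (s powr - 2) * indicator {\<rho>..} s + ennreal (L powr p) * ennreal (y powr p))"
        by (simp add: ennreal_mult ennreal_indicator)
      finally show ?thesis by (simp add: s_def y_def)
    qed
    have "(\<integral>\<^sup>+b. F a b \<partial>lborel) \<le> (\<integral>\<^sup>+b. ennreal (L ^ 2) * (ennreal (\<bar>a - b\<bar> powr - \<alpha>) * indicator {0..\<rho>} \<bar>a - b\<bar>)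
        + (ennreal (\<bar>a - b\<bar> powr - 2) * indicator {\<rho>..} \<bar>a - b\<bar>
        + ennreal (L powr p) * ennreal (G b powr p)) \<partial>lborel)"
      by (intro nn_integral_mono pt)
    also have "\<dots> = ennreal (L ^ 2) * (\<integral>\<^sup>+b. ennreal (\<bar>a - b\<bar> powr - \<alpha>) * indicator {0..\<rho>} \<bar>a - b\<bar> \<partial>lborel)
        + ((\<integral>\<^sup>+b. ennreal (\<bar>a - b\<bar> powr - 2) * indicator {\<rho>..} \<bar>a - b\<bar> \<partial>lborel)
        + ennreal (L powr p) * (\<integral>\<^sup>+b. ennreal (G b powr p) \<partial>lborel))"
      by (subst nn_integral_add, measurable)+ (simp add: nn_integral_cmult)
    also have "\<dots> \<le> ennreal (L ^ 2) * (2 * ennreal (\<rho> powr (1 - \<alpha>) / (1 - \<alpha>)))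
        + (2 * ennreal (1 / \<rho>) + ennreal (L powr p) * 1)"
    proof (intro add_mono mult_left_mono N)
      have "(\<integral>\<^sup>+b. ennreal (\<bar>a - b\<bar> powr - \<alpha>) * indicator {0..\<rho>} \<bar>a - b\<bar> \<partial>lborel)
          \<le> 2 * (\<integral>\<^sup>+t. (ennreal (t powr - \<alpha>) * indicator {0..\<rho>} t) * indicator {0..} t \<partial>lborel)"
        by (rule nn_integral_abs_diff_le[where f="\<lambda>t. ennreal (t powr - \<alpha>) * indicator {0..\<rho>} t"]) simp
      also have "(\<integral>\<^sup>+t. (ennreal (t powr - \<alpha>) * indicator {0..\<rho>} t) * indicator {0..} t \<partial>lborel)
          = (\<integral>\<^sup>+t. ennreal (t powr - \<alpha>) * indicator {0..\<rho>} t \<partial>lborel)"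
        by (intro nn_integral_cong) (auto simp: indicator_def)
      also have "\<dots> = ennreal (\<rho> powr (1 - \<alpha>) / (1 - \<alpha>))"
        using nn_integral_powr_from_0[of "-\<alpha>" \<rho>] \<alpha>(2) \<rho> by simp
      finally show "(\<integral>\<^sup>+b. ennreal (\<bar>a - b\<bar> powr - \<alpha>) * indicator {0..\<rho>} \<bar>a - b\<bar> \<partial>lborel)
          \<le> 2 * ennreal (\<rho> powr (1 - \<alpha>) / (1 - \<alpha>))" .
      have "(\<integral>\<^sup>+b. ennreal (\<bar>a - b\<bar> powr - 2) * indicator {\<rho>..} \<bar>a - b\<bar> \<partial>lborel)
          \<le> 2 * (\<integral>\<^sup>+t. (ennreal (t powr - 2) * indicator {\<rho>..} t) * indicator {0..} t \<partial>lborel)"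
        by (rule nn_integral_abs_diff_le[where f="\<lambda>t. ennreal (t powr - 2) * indicator {\<rho>..} t"]) simp
      also have "(\<integral>\<^sup>+t. (ennreal (t powr - 2) * indicator {\<rho>..} t) * indicator {0..} t \<partial>lborel)
          = (\<integral>\<^sup>+t. ennreal (t powr - 2) * indicator {\<rho>..} t \<partial>lborel)"
        using \<rho> by (intro nn_integral_cong) (auto simp: indicator_def)
      also have "\<dots> = ennreal (1 / \<rho>)"
        using nn_integral_powr_to_inf[of "-2" \<rho>] \<rho> by (simp add: powr_minus_divide)
      finally show "(\<integral>\<^sup>+b. ennreal (\<bar>a - b\<bar> powr - 2) * indicator {\<rho>..} \<bar>a - b\<bar> \<partial>lborel)
          \<le> 2 * ennreal (1 / \<rho>)" .
    qed auto
    also have "\<dots> = ennreal (L ^ 2 * (2 * (\<rho> powr (1 - \<alpha>) / (1 - \<alpha>))) + (2 * (1 / \<rho>) + L powr p))"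
    proof -
      have aux: "ennreal u * (2 * ennreal x) + (2 * ennreal y + ennreal v) = ennreal (u * (2 * x) + (2 * y + v))"
        if "0 \<le> u" "0 \<le> x" "0 \<le> y" "0 \<le> v" for u v x y
        using that by (simp add: ennreal_mult)
      show ?thesis using \<alpha>(2) \<rho> unfolding mult_1_right by (intro aux) auto
    qed
    also have "L ^ 2 * (2 * (\<rho> powr (1 - \<alpha>) / (1 - \<alpha>))) + (2 * (1 / \<rho>) + L powr p) = C * L powr p"
    proof -
      have "\<rho> powr (1 - \<alpha>) = L powr (p - 2)"
        using \<alpha>(4) by (simp add: \<rho>_def powr_powr)
      moreover have "L ^ 2 * L powr (p - 2) = L powr p"
        using L by (simp add: powr_diff)
      moreover have "1 / \<rho> = L powr p" by (simp add: \<rho>_def powr_minus_divide)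
      ultimately show ?thesis unfolding C_def \<alpha>(3)[symmetric] by (simp add: algebra_simps)
    qed
    finally show ?thesis using C by (simp add: L_def ennreal_mult)
  qed
  have "(\<integral>\<^sup>+a. (\<integral>\<^sup>+b. F a b \<partial>lborel) \<partial>lborel) \<le> (\<integral>\<^sup>+a. ennreal C * ennreal (G a powr p) \<partial>lborel)"
    by (intro nn_integral_mono inner)
  also have "\<dots> = ennreal C * (\<integral>\<^sup>+a. ennreal (G a powr p) \<partial>lborel)" by (rule nn_integral_cmult) simp
  also have "\<dots> \<le> ennreal C * 1" by (intro mult_left_mono N) simp
  finally have J: "(\<integral>\<^sup>+a. (\<integral>\<^sup>+b. F a b \<partial>lborel) \<partial>lborel) \<le> ennreal C" by simp
  have J': "(\<integral>\<^sup>+a. (\<integral>\<^sup>+b. F b a \<partial>lborel) \<partial>lborel) = (\<integral>\<^sup>+a. (\<integral>\<^sup>+b. F a b \<partial>lborel) \<partial>lborel)"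
    by (rule lborel_pair.Fubini'[OF mF])
  have mF': "(\<lambda>x. \<integral>\<^sup>+b. F x b \<partial>lborel) \<in> borel_measurable lborel" "(\<lambda>x. \<integral>\<^sup>+b. F b x \<partial>lborel) \<in> borel_measurable lborel"
      "(\<lambda>b. F b a) \<in> borel_measurable lborel" for a
    using mF by measurable
  have "(\<integral>\<^sup>+a. (\<integral>\<^sup>+b. ennreal (G a * G b * \<bar>a - b\<bar> powr - \<alpha>) \<partial>lborel) \<partial>lborel)
     \<le> (\<integral>\<^sup>+a. (\<integral>\<^sup>+b. F a b + F b a \<partial>lborel) \<partial>lborel)"
    using G0 by (intro nn_integral_mono) (auto simp: F_def indicator_def abs_minus_commute mult_ac)
  also have "\<dots> = (\<integral>\<^sup>+a. (\<integral>\<^sup>+b. F a b \<partial>lborel) + (\<integral>\<^sup>+b. F b a \<partial>lborel) \<partial>lborel)"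
    using mF' by (intro nn_integral_cong nn_integral_add) auto
  also have "\<dots> = (\<integral>\<^sup>+a. (\<integral>\<^sup>+b. F a b \<partial>lborel) \<partial>lborel) + (\<integral>\<^sup>+a. (\<integral>\<^sup>+b. F b a \<partial>lborel) \<partial>lborel)"
    using mF' by (intro nn_integral_add) auto
  also have "\<dots> \<le> ennreal C + ennreal C" using J J' by (intro add_mono) auto
  also have "\<dots> = ennreal (2 * C)" using C by (simp flip: ennreal_plus)
  finally show ?thesis by (simp add: \<alpha>_def C_def)
qed

text \<open>The form is homogeneous of degree 2 in \<open>G\<close>, so normalizing by
  \<open>c = N powr (1 / p)\<close> costs the factor \<open>c^2 = N powr (2 / p)\<close>.\<close>

theorem Hardy_Littlewood_Sobolev:
  fixes G :: "real \<Rightarrow> real"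
  assumes p: "1 < p" "p < 2" and mG[measurable]: "G \<in> borel_measurable borel" and G0: "\<And>t. 0 \<le> G t"
    and N: "(\<integral>\<^sup>+t. ennreal (G t powr p) \<partial>lborel) \<le> ennreal N" "N > 0"
  shows "(\<integral>\<^sup>+a. (\<integral>\<^sup>+b. ennreal (G a * G b * \<bar>a - b\<bar> powr - (2 - 2 / p)) \<partial>lborel) \<partial>lborel)
    \<le> ennreal (2 * (2 / (2 / p - 1) + 3) * N powr (2 / p))"
proof -
  define c where "c = N powr (1 / p)"
  have c: "c > 0" using N by (simp add: c_def)
  have cp: "c powr p = N" using p N by (simp add: c_def powr_powr)
  have c2: "c * c = N powr (2 / p)" using N by (simp add: c_def powr_add[symmetric])
  have "(\<integral>\<^sup>+t. ennreal ((G t / c) powr p) \<partial>lborel) = (\<integral>\<^sup>+t. ennreal (1 / N) * ennreal (G t powr p) \<partial>lborel)"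
    using c G0 N(2) by (intro nn_integral_cong) (simp add: powr_divide cp flip: ennreal_mult)
  also have "\<dots> = ennreal (1 / N) * (\<integral>\<^sup>+t. ennreal (G t powr p) \<partial>lborel)"
    by (rule nn_integral_cmult) simp
  also have "\<dots> \<le> ennreal (1 / N) * ennreal N" by (intro mult_left_mono N) simp
  also have "\<dots> = 1" using N(2) by (simp flip: ennreal_mult)
  finally have N1: "(\<integral>\<^sup>+t. ennreal ((G t / c) powr p) \<partial>lborel) \<le> 1" .
  have "(\<integral>\<^sup>+a. (\<integral>\<^sup>+b. ennreal (G a * G b * \<bar>a - b\<bar> powr - (2 - 2 / p)) \<partial>lborel) \<partial>lborel)
    = (\<integral>\<^sup>+a. (\<integral>\<^sup>+b. ennreal (c * c) * ennreal (G a / c * (G b / c) * \<bar>a - b\<bar> powr - (2 - 2 / p)) \<partial>lborel) \<partial>lborel)"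
    using c G0 by (intro nn_integral_cong) (simp flip: ennreal_mult)
  also have "\<dots> = ennreal (c * c) * (\<integral>\<^sup>+a. (\<integral>\<^sup>+b. ennreal (G a / c * (G b / c) * \<bar>a - b\<bar> powr - (2 - 2 / p)) \<partial>lborel) \<partial>lborel)"
    by (subst nn_integral_cmult, measurable)+
  also have "\<dots> \<le> ennreal (c * c) * ennreal (2 * (2 / (2 / p - 1) + 3))"
    using c G0 by (intro mult_left_mono Hardy_Littlewood_Sobolev_normalized[OF p _ _ N1]) auto
  also have "\<dots> = ennreal (2 * (2 / (2 / p - 1) + 3) * N powr (2 / p))"
  proof -
    have "2 * (2 / (2 / p - 1) + 3) \<ge> 0" using p by simp
    then show ?thesis unfolding c2 using ennreal_mult'[of "2 * (2 / (2 / p - 1) + 3)" "N powr (2 / p)"]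
      by (simp only: mult.commute)
  qed
  finally show ?thesis .
qed

section \<open>Interpolation of bilinear forms\<close>

text \<open>Write \<open>h\<close> as the integral over heights \<open>l > 0\<close> of the phase of \<open>h\<close> restricted to
  \<open>|h| > l\<close> and cut \<open>g\<close> at height \<open>s / l\<close>. The large part of \<open>g\<close> is paired by means of the
  bound \<open>A\<close> of the kernel, the small part by the \<open>L\<^sup>2\<close> bound; \<open>s\<close> and the weight \<open>w\<close> in the
  arithmetic-geometric mean inequality balance the resulting terms.\<close>
theorem bilinear_interpolation:
  fixes k :: "'a::euclidean_space \<times> 'a \<Rightarrow> complex" and g h :: "'a \<Rightarrow> complex"
  assumes p: "1 < p" "p < 2" and A: "A > 0"
    and mk: "k \<in> borel_measurable borel" and kA: "\<And>x y. norm (k (x, y)) \<le> A"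
    and L2: "\<And>g h B B'. \<lbrakk>integrable lborel g; \<And>x. norm (g x) \<le> B; integrable lborel h; \<And>x. norm (h x) \<le> B'\<rbrakk> \<Longrightarrow>
       norm (LBINT x. h x * (LBINT y. k (x, y) * g y))
         \<le> ((LBINT x. (norm (g x))\<^sup>2) + (LBINT x. (norm (h x))\<^sup>2)) / 2"
    and g: "integrable lborel g" "\<And>x. norm (g x) \<le> B"
    and h: "integrable lborel h" "\<And>x. norm (h x) \<le> B'"
    and Gp: "(\<integral>\<^sup>+x. ennreal (norm (g x) powr p) \<partial>lborel) = ennreal Gp" "Gp > 0"
    and Hp: "(\<integral>\<^sup>+x. ennreal (norm (h x) powr p) \<partial>lborel) = ennreal Hp" "Hp > 0"
  shows "norm (LBINT x. h x * (LBINT y. k (x, y) * g y))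
     \<le> (3 / (2 * p) + 1 / (2 * (2 - p))) * A powr (2 / p - 1) * Gp powr (1 / p) * Hp powr (1 / p)"
proof -
  have ennreal_lin: "ennreal (a * x + b * y) = ennreal a * ennreal x + ennreal b * ennreal y"
    if "0 \<le> a" "0 \<le> x" "0 \<le> b" "0 \<le> y" for a b x y
    using that by (simp add: ennreal_mult)
  have [measurable]: "g \<in> borel_measurable borel" "h \<in> borel_measurable borel" using g h by auto
  have mk'[measurable]: "k \<in> borel_measurable (borel \<Otimes>\<^sub>M borel)" using mk by (simp add: borel_prod)
  define T where "T = (\<lambda>g x. LBINT y. k (x, y) * g y)"
  have T_int: "integrable lborel (\<lambda>y. k (x, y) * u y)" if "integrable lborel u" for u x
  proof (rule Bochner_Integration.integrable_bound)
    show "integrable lborel (\<lambda>y. A * norm (u y))" using that by auto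
    have [measurable]: "u \<in> borel_measurable borel" using that by auto
    show "(\<lambda>y. k (x, y) * u y) \<in> borel_measurable lborel" by measurable
    show "AE y in lborel. norm (k (x, y) * u y) \<le> norm (A * norm (u y))"
      using kA A by (auto simp: norm_mult intro!: mult_right_mono)
  qed
  have T_bound: "norm (T u x) \<le> A * (LBINT y. norm (u y))" if "integrable lborel u" for u x
  proof -
    have "norm (T u x) \<le> (LBINT y. norm (k (x, y) * u y))"
      unfolding T_def by (rule integral_norm_bound)
    also have "\<dots> \<le> (LBINT y. A * norm (u y))"
    proof (rule integral_mono)
      show "norm (k (x, y) * u y) \<le> A * norm (u y)" for y
        unfolding norm_mult by (intro mult_right_mono kA) auto
    qed (use that T_int in auto)
    finally show ?thesis by simp
  qed
  have mT: "T u \<in> borel_measurable borel" if "u \<in> borel_measurable borel" for u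
  proof -
    have [measurable]: "u \<in> borel_measurable borel" by fact
    have "(\<lambda>x. LBINT y. k (x, y) * u y) \<in> borel_measurable lborel" by measurable
    then show ?thesis by (simp add: T_def)
  qed
  have [measurable]: "T g \<in> borel_measurable borel" by (rule mT) simp
  \<comment> \<open>Where \<open>h\<close> vanishes, division by zero makes the phase 0.\<close>
  define sg where "sg = (\<lambda>x. h x / of_real (norm (h x)))"
  have [measurable]: "sg \<in> borel_measurable borel" unfolding sg_def by measurable
  have nsg: "norm (sg x) \<le> 1" for x by (simp add: sg_def norm_divide)
  define H where "H = (\<lambda>(l::real) x. if 0 < l \<and> l < norm (h x) then sg x else 0)"
  have mH: "(\<lambda>p. H (fst p) (snd p)) \<in> borel_measurable (borel \<Otimes>\<^sub>M borel)" unfolding H_def by measurable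
  have [measurable]: "H l \<in> borel_measurable borel" for l unfolding H_def by measurable
  have nH: "norm (H l x) \<le> 1" for l x using nsg by (simp add: H_def)
  have H_int: "integrable lborel (H l)" for l
  proof (rule Bochner_Integration.integrable_bound)
    show "integrable lborel (\<lambda>x. inverse l * norm (h x))" using h by auto
    have "norm (H l x) \<le> norm (inverse l * norm (h x))" for x
    proof (cases "0 < l \<and> l < norm (h x)")
      case True
      then have "1 \<le> inverse l * norm (h x)" by (simp add: field_simps)
      then have "norm (sg x) \<le> inverse l * norm (h x)" using nsg[of x] by linarith
      then show ?thesis using True by (simp add: H_def abs_mult)
    qed (auto simp: H_def)
    then show "AE x in lborel. norm (H l x) \<le> norm (inverse l * norm (h x))" by simp
  qed simp
  have H_layer: "(LBINT l. H l x) = h x" for x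
  proof -
    have "(LBINT l. H l x) = (LBINT l. indicator {0<..<norm (h x)} l *\<^sub>R sg x)"
      by (intro Bochner_Integration.integral_cong) (auto simp: H_def)
    also have "\<dots> = (LBINT l. indicator {0<..<norm (h x)} l) *\<^sub>R sg x"
      by (rule integral_scaleR_left) simp
    also have "\<dots> = norm (h x) *\<^sub>R sg x" by simp
    also have "\<dots> = h x" by (simp add: sg_def scaleR_conv_of_real)
    finally show ?thesis .
  qed
  have H_layer_norm: "(LBINT l. norm (H l x)) = norm (h x)" "integrable lborel (\<lambda>l. H l x)" for x
  proof -
    have "(LBINT l. norm (H l x)) = (LBINT l. indicator {0<..<norm (h x)} l *\<^sub>R norm (sg x))"
      by (intro Bochner_Integration.integral_cong) (auto simp: H_def)
    also have "\<dots> = (LBINT l. indicator {0<..<norm (h x)} l) *\<^sub>R norm (sg x)"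
      by (rule integral_scaleR_left) simp
    also have "\<dots> = norm (h x) * norm (sg x)" by simp
    also have "\<dots> = norm (h x)" by (simp add: sg_def norm_divide)
    finally show "(LBINT l. norm (H l x)) = norm (h x)" .
    have "integrable lborel (\<lambda>l. indicator {0<..<norm (h x)} l *\<^sub>R sg x)"
      by (intro integrable_scaleR_left integrable_real_indicator) auto
    also have "(\<lambda>l. indicator {0<..<norm (h x)} l *\<^sub>R sg x) = (\<lambda>l. H l x)"
      by (auto simp: H_def fun_eq_iff)
    finally show "integrable lborel (\<lambda>l. H l x)" .
  qed
  define G1 where "G1 = (LBINT y. norm (g y))"
  have G1: "G1 \<ge> 0" by (simp add: G1_def)
  define I where "I = (LBINT x. h x * T g x)"
  have mF[measurable]: "(\<lambda>(l, x). H l x * T g x) \<in> borel_measurable (lborel \<Otimes>\<^sub>M lborel)"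
  proof -
    have "(\<lambda>p. H (fst p) (snd p) * T g (snd p)) \<in> borel_measurable (borel \<Otimes>\<^sub>M borel)"
      using mH by measurable
    then show ?thesis by (simp add: case_prod_unfold borel_prod lborel_prod)
  qed
  have iF: "integrable (lborel \<Otimes>\<^sub>M lborel) (\<lambda>(x, l). H l x * T g x)"
  proof (rule lborel_pair.Fubini_integrable)
    have "(\<lambda>p. H (snd p) (fst p) * T g (fst p)) \<in> borel_measurable (borel \<Otimes>\<^sub>M borel)"
      unfolding H_def by measurable
    then show "(\<lambda>(x, l). H l x * T g x) \<in> borel_measurable (lborel \<Otimes>\<^sub>M lborel)"
      by (simp add: case_prod_unfold borel_prod lborel_prod)
    have "integrable lborel (\<lambda>x. norm (h x) * norm (T g x))"
    proof (rule Bochner_Integration.integrable_bound)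
      show "integrable lborel (\<lambda>x. norm (h x) * (A * G1))" using h by auto
      show "AE x in lborel. norm (norm (h x) * norm (T g x)) \<le> norm (norm (h x) * (A * G1))"
        using T_bound[OF g(1)] A G1 by (auto simp: G1_def abs_mult intro!: mult_left_mono)
    qed measurable
    then show "integrable lborel (\<lambda>x. LBINT l. norm (case (x, l) of (x, l) \<Rightarrow> H l x * T g x))"
      by (simp add: norm_mult H_layer_norm)
    show "AE x in lborel. integrable lborel (\<lambda>l. case (x, l) of (x, l) \<Rightarrow> H l x * T g x)"
      using H_layer_norm by auto
  qed
  have I_eq: "I = (LBINT l. (LBINT x. H l x * T g x))"
    using lborel_pair.Fubini_integral[OF iF] by (simp add: I_def H_layer)
  have iI: "integrable lborel (\<lambda>l. LBINT x. H l x * T g x)"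
    using lborel_pair.integrable_snd[OF iF] .
  \<comment> \<open>Solves \<open>A * s powr (1 - p) * P = sqrt (s powr (2 - p) * P)\<close> with
    \<open>P = Gp * Hp\<close>. Both sides then equal the target product, called \<open>V\<close>
    further down, so the large and the small part of \<open>g\<close> contribute alike.\<close>
  define s where "s = A powr (2 / p) * (Gp * Hp) powr (1 / p)"
  have s: "s > 0" using A Gp Hp by (simp add: s_def)
  \<comment> \<open>Equalizes the two halves of the mean inequality:
    \<open>w * s powr (2 - p) * Gp\<close> and \<open>Hp / w\<close> both become
    \<open>V\<close>.\<close>
  define w where "w = sqrt (Hp / (Gp * s powr (2 - p)))"
  have w: "w > 0" using Gp Hp s by (simp add: w_def)
  define a1 where "a1 = A * s powr (1 - p) * Gp + 1 / (2 * w)"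
  have a1: "a1 \<ge> 0" using A Gp w by (simp add: a1_def)
  \<comment> \<open>The powers of \<open>l\<close> are such that integration over all heights
    returns p-th powers: \<open>|h|^p / p\<close> from \<Phi> and at most
    \<open>s powr (2 - p) / (2 - p) * |g|^p\<close> from \<Psi>, where \<open>p < 2\<close> gives
    convergence at height 0.\<close>
  define \<Phi> where "\<Phi> = (\<lambda>l x. ennreal (l powr (p - 1)) * indicator {0..norm (h x)} l)"
  define \<Psi> where "\<Psi> = (\<lambda>l y. ennreal (l powr (1 - p) * (norm (g y))\<^sup>2) * (if 0 < l \<and> norm (g y) \<le> s / l then 1 else 0))"
  have bound: "ennreal (norm (LBINT x. H l x * T g x)) \<le>
     ennreal a1 * (\<integral>\<^sup>+x. \<Phi> l x \<partial>lborel) + ennreal (w / 2) * (\<integral>\<^sup>+y. \<Psi> l y \<partial>lborel)" for l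
  proof (cases "l > 0")
    case False
    then have "H l = (\<lambda>x. 0)" by (auto simp: H_def)
    then show ?thesis by simp
  next
    case l: True
    define m where "m = (LBINT x. norm (H l x))"
    have m0: "m \<ge> 0" by (simp add: m_def)
    have mnn: "ennreal (l powr (p - 1) * m) \<le> (\<integral>\<^sup>+x. \<Phi> l x \<partial>lborel)"
    proof -
      have "ennreal (l powr (p - 1) * m) = ennreal (l powr (p - 1)) * (\<integral>\<^sup>+x. ennreal (norm (H l x)) \<partial>lborel)"
        using H_int[of l] by (simp add: m_def ennreal_mult nn_integral_eq_integral)
      also have "\<dots> = (\<integral>\<^sup>+x. ennreal (l powr (p - 1)) * ennreal (norm (H l x)) \<partial>lborel)"
        by (rule nn_integral_cmult[symmetric]) measurable
      also have "\<dots> \<le> (\<integral>\<^sup>+x. \<Phi> l x \<partial>lborel)"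
      proof (rule nn_integral_mono)
        fix x
        show "ennreal (l powr (p - 1)) * ennreal (norm (H l x)) \<le> \<Phi> l x"
        proof (cases "l < norm (h x)")
          case True
          then have "\<Phi> l x = ennreal (l powr (p - 1)) * 1" using l by (simp add: \<Phi>_def)
          moreover have "ennreal (norm (H l x)) \<le> 1" using ennreal_leI[OF nH[of l x]] by simp
          ultimately show ?thesis by (simp only:) (intro mult_left_mono, auto)
        qed (auto simp: H_def)
      qed
      finally show ?thesis .
    qed
    define g1 where "g1 = (\<lambda>y. if norm (g y) \<le> s / l then 0 else g y)"
    define g2 where "g2 = (\<lambda>y. if norm (g y) \<le> s / l then g y else 0)"
    have [measurable]: "g1 \<in> borel_measurable borel" "g2 \<in> borel_measurable borel"
      unfolding g1_def g2_def by measurable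
    have ig1: "integrable lborel g1" and ig2: "integrable lborel g2"
      by (rule Bochner_Integration.integrable_bound[OF g(1)]; auto simp: g1_def g2_def)+
    have bg2: "norm (g2 y) \<le> s / l" for y using s l by (simp add: g2_def)
    have Tsum: "T g x = T g1 x + T g2 x" for x
    proof -
      have "T g x = (LBINT y. k (x, y) * g1 y + k (x, y) * g2 y)"
        unfolding T_def by (intro Bochner_Integration.integral_cong) (auto simp: g1_def g2_def)
      then show ?thesis unfolding T_def using T_int ig1 ig2 by simp
    qed
    have HT_int: "integrable lborel (\<lambda>x. H l x * T u x)" if "integrable lborel u" for u
    proof (rule Bochner_Integration.integrable_bound)
      have [measurable]: "u \<in> borel_measurable borel" using that by auto
      have [measurable]: "T u \<in> borel_measurable borel" by (rule mT) simp
      show "(\<lambda>x. H l x * T u x) \<in> borel_measurable lborel" by measurable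
      show "integrable lborel (\<lambda>x. norm (H l x) * (A * (LBINT y. norm (u y))))" using H_int by auto
      show "AE x in lborel. norm (H l x * T u x) \<le> norm (norm (H l x) * (A * (LBINT y. norm (u y))))"
        using T_bound[OF that] A by (auto simp: norm_mult abs_mult intro!: mult_left_mono)
    qed
    have split: "(LBINT x. H l x * T g x) = (LBINT x. H l x * T g1 x) + (LBINT x. H l x * T g2 x)"
      unfolding Tsum distrib_left using HT_int ig1 ig2 by simp
    \<comment> \<open>Chebyshev's argument: where \<open>|g| > s / l\<close>, the negative exponent
      gives \<open>|g| powr (1 - p) \<le> (s / l) powr (1 - p)\<close>.\<close>
    have ng1: "(LBINT y. norm (g1 y)) \<le> (s / l) powr (1 - p) * Gp"
    proof -
      have "ennreal (LBINT y. norm (g1 y)) = (\<integral>\<^sup>+y. ennreal (norm (g1 y)) \<partial>lborel)"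
        using ig1 by (simp add: nn_integral_eq_integral)
      also have "\<dots> \<le> (\<integral>\<^sup>+y. ennreal ((s / l) powr (1 - p)) * ennreal (norm (g y) powr p) \<partial>lborel)"
      proof (rule nn_integral_mono)
        fix y
        have "norm (g1 y) \<le> (s / l) powr (1 - p) * norm (g y) powr p"
        proof (cases "norm (g y) \<le> s / l")
          case False
          define t where "t = norm (g y)"
          have t: "t > s / l" "s / l > 0" using False s l by (auto simp: t_def)
          have "t powr (1 - p) \<le> (s / l) powr (1 - p)" using t p by (intro powr_mono2') auto
          then have "t powr (1 - p) * t powr p \<le> (s / l) powr (1 - p) * t powr p"
            by (intro mult_right_mono) auto
          then show ?thesis using False t by (simp add: g1_def t_def flip: powr_add)
        qed (simp add: g1_def)
        then show "ennreal (norm (g1 y)) \<le> ennreal ((s / l) powr (1 - p)) * ennreal (norm (g y) powr p)"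
          by (simp add: ennreal_leI flip: ennreal_mult)
      qed
      also have "\<dots> = ennreal ((s / l) powr (1 - p)) * ennreal Gp"
        by (subst nn_integral_cmult) (auto simp: Gp)
      also have "\<dots> = ennreal ((s / l) powr (1 - p) * Gp)" using Gp by (simp add: ennreal_mult)
      finally show ?thesis using Gp by (simp add: ennreal_le_iff)
    qed
    have part1: "norm (LBINT x. H l x * T g1 x) \<le> A * s powr (1 - p) * Gp * (l powr (p - 1) * m)"
    proof -
      have "norm (LBINT x. H l x * T g1 x) \<le> (LBINT x. norm (H l x * T g1 x))"
        by (rule integral_norm_bound)
      also have "\<dots> \<le> (LBINT x. norm (H l x) * (A * ((s / l) powr (1 - p) * Gp)))"
      proof (rule integral_mono)
        fix x
        have "norm (T g1 x) \<le> A * ((s / l) powr (1 - p) * Gp)"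
          using order_trans[OF T_bound[OF ig1, of x] mult_left_mono[OF ng1, of A]] A by simp
        then show "norm (H l x * T g1 x) \<le> norm (H l x) * (A * ((s / l) powr (1 - p) * Gp))"
          unfolding norm_mult by (intro mult_left_mono) auto
      qed (use HT_int[OF ig1] H_int in auto)
      also have "\<dots> = m * (A * ((s / l) powr (1 - p) * Gp))" by (simp add: m_def)
      also have "(s / l) powr (1 - p) = s powr (1 - p) * l powr (p - 1)"
        using s l powr_minus_divide[of l "1 - p"] by (simp add: powr_divide)
      finally show ?thesis by (simp add: mult_ac)
    qed
    \<comment> \<open>Multiplying \<open>g2\<close> by \<open>c\<close> and \<open>H l\<close> by
      \<open>1 / c\<close> leaves the pairing unchanged and puts the weight
      \<open>w * l powr (1 - p)\<close> on the square of \<open>g2\<close> and its reciprocal on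
      that of \<open>H l\<close>.\<close>
    define c where "c = sqrt (w * l powr (1 - p))"
    have c: "c > 0" "c\<^sup>2 = w * l powr (1 - p)" using w l by (auto simp: c_def)
    have Hm: "(LBINT x. (norm (H l x))\<^sup>2) \<le> m"
      unfolding m_def
    proof (rule integral_mono)
      show "integrable lborel (\<lambda>x. (norm (H l x))\<^sup>2)" by (rule integrable_bounded_square[OF H_int nH])
      show "(norm (H l x))\<^sup>2 \<le> norm (H l x)" for x
        unfolding power2_eq_square using nH[of l x] by (intro mult_left_le) auto
    qed (use H_int in auto)
    have part2: "norm (LBINT x. H l x * T g2 x) \<le> w / 2 * (l powr (1 - p) * (LBINT y. (norm (g2 y))\<^sup>2)) + 1 / (2 * w) * (l powr (p - 1) * m)"
    proof -
      have "norm (LBINT x. (of_real (1 / c) * H l x) * (LBINT y. k (x, y) * (of_real c * g2 y)))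
         \<le> ((LBINT x. (norm (of_real c * g2 x))\<^sup>2) + (LBINT x. (norm (of_real (1 / c) * H l x))\<^sup>2)) / 2"
      proof (rule L2[where B="c * (s / l)" and B'="1 / c"])
        show "norm (of_real c * g2 x) \<le> c * (s / l)" for x
          using mult_left_mono[OF bg2[of x], of c] c by (simp add: norm_mult)
        show "norm (of_real (1 / c) * H l x) \<le> 1 / c" for x
          using divide_right_mono[OF nH[of l x], of c] c by (simp add: norm_mult norm_divide)
      qed (use ig2 H_int in auto)
      also have "(LBINT x. (of_real (1 / c) * H l x) * (LBINT y. k (x, y) * (of_real c * g2 y))) = (LBINT x. H l x * T g2 x)"
      proof -
        have "(LBINT y. k (x, y) * (of_real c * g2 y)) = of_real c * T g2 x" for x
        proof -
          have "(LBINT y. k (x, y) * (of_real c * g2 y)) = (LBINT y. of_real c * (k (x, y) * g2 y))"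
            by (simp add: mult_ac)
          then show ?thesis unfolding T_def by (simp only: integral_mult_right_zero)
        qed
        then show ?thesis using c by (simp add: field_simps)
      qed
      also have "(LBINT x. (norm (of_real c * g2 x))\<^sup>2) = c\<^sup>2 * (LBINT y. (norm (g2 y))\<^sup>2)"
        by (simp add: norm_mult power_mult_distrib)
      also have "(LBINT x. (norm (of_real (1 / c) * H l x))\<^sup>2) = 1 / c\<^sup>2 * (LBINT x. (norm (H l x))\<^sup>2)"
        by (simp add: norm_mult power_mult_distrib norm_divide power_divide)
      finally have "norm (LBINT x. H l x * T g2 x)
          \<le> (c\<^sup>2 * (LBINT y. (norm (g2 y))\<^sup>2) + 1 / c\<^sup>2 * (LBINT x. (norm (H l x))\<^sup>2)) / 2" .
      also have "\<dots> \<le> (c\<^sup>2 * (LBINT y. (norm (g2 y))\<^sup>2) + 1 / c\<^sup>2 * m) / 2"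
        by (intro divide_right_mono add_left_mono mult_left_mono Hm) auto
      also have "1 / c\<^sup>2 = 1 / w * l powr (p - 1)"
        unfolding c(2) using l powr_minus_divide[of l "1 - p"] by simp
      finally show ?thesis unfolding c(2) by (simp add: algebra_simps add_divide_distrib)
    qed
    have g2nn: "ennreal (l powr (1 - p) * (LBINT y. (norm (g2 y))\<^sup>2)) = (\<integral>\<^sup>+y. \<Psi> l y \<partial>lborel)"
    proof -
      have i: "integrable lborel (\<lambda>y. (norm (g2 y))\<^sup>2)" by (rule integrable_bounded_square[OF ig2 bg2])
      have "ennreal (l powr (1 - p) * (LBINT y. (norm (g2 y))\<^sup>2)) = ennreal (LBINT y. l powr (1 - p) * (norm (g2 y))\<^sup>2)"
        by simp
      also have "\<dots> = (\<integral>\<^sup>+y. ennreal (l powr (1 - p) * (norm (g2 y))\<^sup>2) \<partial>lborel)"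
        using i by (intro nn_integral_eq_integral[symmetric]) auto
      also have "\<dots> = (\<integral>\<^sup>+y. \<Psi> l y \<partial>lborel)"
        using l by (intro nn_integral_cong) (auto simp: \<Psi>_def g2_def)
      finally show ?thesis .
    qed
    have G2: "(LBINT y. (norm (g2 y))\<^sup>2) \<ge> 0" by simp
    have "norm (LBINT x. H l x * T g x) \<le> a1 * (l powr (p - 1) * m) + w / 2 * (l powr (1 - p) * (LBINT y. (norm (g2 y))\<^sup>2))"
      using part1 part2 norm_triangle_ineq[of "LBINT x. H l x * T g1 x" "LBINT x. H l x * T g2 x"]
      unfolding split a1_def distrib_right by linarith
    then have "ennreal (norm (LBINT x. H l x * T g x)) \<le> ennreal (a1 * (l powr (p - 1) * m) + w / 2 * (l powr (1 - p) * (LBINT y. (norm (g2 y))\<^sup>2)))"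
      by (rule ennreal_leI)
    also have "\<dots> = ennreal a1 * ennreal (l powr (p - 1) * m) + ennreal (w / 2) * ennreal (l powr (1 - p) * (LBINT y. (norm (g2 y))\<^sup>2))"
      using a1 m0 w G2 by (intro ennreal_lin) auto
    also have "\<dots> \<le> ennreal a1 * (\<integral>\<^sup>+x. \<Phi> l x \<partial>lborel) + ennreal (w / 2) * (\<integral>\<^sup>+y. \<Psi> l y \<partial>lborel)"
      unfolding g2nn by (intro add_mono mult_left_mono mnn) auto
    finally show ?thesis .
  qed
  have mPhi: "(\<lambda>(l, x). \<Phi> l x) \<in> borel_measurable (lborel \<Otimes>\<^sub>M lborel)"
    and mPsi: "(\<lambda>(l, x). \<Psi> l x) \<in> borel_measurable (lborel \<Otimes>\<^sub>M lborel)"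
  proof -
    have "(\<lambda>p. \<Phi> (fst p) (snd p)) \<in> borel_measurable (borel \<Otimes>\<^sub>M borel)"
      unfolding \<Phi>_def by (simp add: indicator_def cong: measurable_cong)
    then show "(\<lambda>(l, x). \<Phi> l x) \<in> borel_measurable (lborel \<Otimes>\<^sub>M lborel)"
      by (simp add: case_prod_unfold borel_prod lborel_prod)
    have "(\<lambda>p. \<Psi> (fst p) (snd p)) \<in> borel_measurable (borel \<Otimes>\<^sub>M borel)"
      unfolding \<Psi>_def by measurable
    then show "(\<lambda>(l, x). \<Psi> l x) \<in> borel_measurable (lborel \<Otimes>\<^sub>M lborel)"
      by (simp add: case_prod_unfold borel_prod lborel_prod)
  qed
  have "(\<integral>\<^sup>+l. (\<integral>\<^sup>+x. \<Phi> l x \<partial>lborel) \<partial>lborel) = (\<integral>\<^sup>+x. (\<integral>\<^sup>+l. \<Phi> l x \<partial>lborel) \<partial>lborel)"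
    by (rule lborel_pair.Fubini'[OF mPhi, symmetric])
  also have "\<dots> = (\<integral>\<^sup>+x. ennreal (1 / p) * ennreal (norm (h x) powr p) \<partial>lborel)"
  proof (rule nn_integral_cong)
    fix x
    show "(\<integral>\<^sup>+l. \<Phi> l x \<partial>lborel) = ennreal (1 / p) * ennreal (norm (h x) powr p)"
      using nn_integral_powr_from_0[of "p - 1" "norm (h x)"] p by (simp add: \<Phi>_def flip: ennreal_mult)
  qed
  also have "\<dots> = ennreal (1 / p) * ennreal Hp"
    by (subst nn_integral_cmult) (auto simp: Hp)
  finally have Phi: "(\<integral>\<^sup>+l. (\<integral>\<^sup>+x. \<Phi> l x \<partial>lborel) \<partial>lborel) = ennreal (Hp / p)"
    using p Hp by (simp flip: ennreal_mult)
  have "(\<integral>\<^sup>+l. (\<integral>\<^sup>+x. \<Psi> l x \<partial>lborel) \<partial>lborel) = (\<integral>\<^sup>+x. (\<integral>\<^sup>+l. \<Psi> l x \<partial>lborel) \<partial>lborel)"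
    by (rule lborel_pair.Fubini'[OF mPsi, symmetric])
  also have "\<dots> \<le> (\<integral>\<^sup>+x. ennreal (s powr (2 - p) / (2 - p)) * ennreal (norm (g x) powr p) \<partial>lborel)"
  proof (rule nn_integral_mono)
    fix x
    show "(\<integral>\<^sup>+l. \<Psi> l x \<partial>lborel) \<le> ennreal (s powr (2 - p) / (2 - p)) * ennreal (norm (g x) powr p)"
    proof (cases "g x = 0")
      case True
      then show ?thesis by (simp add: \<Psi>_def)
    next
      case False
      define t where "t = norm (g x)"
      have t: "t > 0" using False by (simp add: t_def)
      have "(\<integral>\<^sup>+l. \<Psi> l x \<partial>lborel) \<le> (\<integral>\<^sup>+l. ennreal (t\<^sup>2) * (ennreal (l powr (1 - p)) * indicator {0..s / t} l) \<partial>lborel)"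
      proof (rule nn_integral_mono)
        fix l
        have "\<Psi> l x = ennreal (t\<^sup>2) * ennreal (l powr (1 - p))" if "0 < l" "t \<le> s / l"
          using that by (simp add: \<Psi>_def t_def ennreal_mult mult.commute)
        moreover have "l \<le> s / t" if "0 < l" "t \<le> s / l"
          using that t by (simp add: field_simps)
        ultimately show "\<Psi> l x \<le> ennreal (t\<^sup>2) * (ennreal (l powr (1 - p)) * indicator {0..s / t} l)"
          by (cases "0 < l \<and> t \<le> s / l") (auto simp: \<Psi>_def t_def)
      qed
      also have "\<dots> = ennreal (t\<^sup>2) * ennreal ((s / t) powr (2 - p) / (2 - p))"
        using nn_integral_powr_from_0[of "1 - p" "s / t"] p s t by (subst nn_integral_cmult) auto
      also have "\<dots> = ennreal (s powr (2 - p) / (2 - p)) * ennreal (t powr p)"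
      proof -
        have "t\<^sup>2 * (s / t) powr (2 - p) = s powr (2 - p) * t powr p"
          using s t by (simp add: powr_divide powr_diff field_simps)
        then have "t\<^sup>2 * ((s / t) powr (2 - p) / (2 - p)) = s powr (2 - p) / (2 - p) * t powr p" by simp
        then show ?thesis using p by (simp only: ennreal_mult[symmetric] zero_le_power2 powr_ge_zero divide_nonneg_nonneg diff_ge_0_iff_ge less_imp_le)
      qed
      finally show ?thesis by (simp add: t_def)
    qed
  qed
  also have "\<dots> = ennreal (s powr (2 - p) / (2 - p)) * ennreal Gp"
    by (subst nn_integral_cmult) (auto simp: Gp)
  finally have Psi: "(\<integral>\<^sup>+l. (\<integral>\<^sup>+x. \<Psi> l x \<partial>lborel) \<partial>lborel) \<le> ennreal (s powr (2 - p) / (2 - p) * Gp)"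
    using p Gp by (simp flip: ennreal_mult)
  have "ennreal (norm I) \<le> (\<integral>\<^sup>+l. ennreal (norm (LBINT x. H l x * T g x)) \<partial>lborel)"
    unfolding I_eq by (rule integral_norm_bound_ennreal[OF iI])
  also have "\<dots> \<le> (\<integral>\<^sup>+l. ennreal a1 * (\<integral>\<^sup>+x. \<Phi> l x \<partial>lborel) + ennreal (w / 2) * (\<integral>\<^sup>+y. \<Psi> l y \<partial>lborel) \<partial>lborel)"
    by (intro nn_integral_mono bound)
  also have "\<dots> = ennreal a1 * (\<integral>\<^sup>+l. (\<integral>\<^sup>+x. \<Phi> l x \<partial>lborel) \<partial>lborel) + ennreal (w / 2) * (\<integral>\<^sup>+l. (\<integral>\<^sup>+y. \<Psi> l y \<partial>lborel) \<partial>lborel)"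
    using mPhi mPsi by (simp add: nn_integral_add nn_integral_cmult lborel.borel_measurable_nn_integral)
  also have "\<dots> \<le> ennreal a1 * ennreal (Hp / p) + ennreal (w / 2) * ennreal (s powr (2 - p) / (2 - p) * Gp)"
    unfolding Phi by (intro add_mono mult_left_mono Psi) auto
  also have "\<dots> = ennreal (a1 * (Hp / p) + w / 2 * (s powr (2 - p) / (2 - p) * Gp))"
    using a1 p Hp(2) Gp(2) w by (intro ennreal_lin[symmetric]) auto
  finally have fin: "norm I \<le> a1 * (Hp / p) + w / 2 * (s powr (2 - p) / (2 - p) * Gp)"
    using a1 p Hp Gp w by (subst (asm) ennreal_le_iff) auto
  define V where "V = A powr (2 / p - 1) * Gp powr (1 / p) * Hp powr (1 / p)"
  have GHp: "Gp * Hp > 0" using Gp Hp by simp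
  have V: "V = A powr (2 / p - 1) * (Gp * Hp) powr (1 / p)" using Gp Hp by (simp add: V_def powr_mult)
  have V0: "V > 0" unfolding V using A Gp(2) Hp(2) by (intro mult_pos_pos) auto
  define a b P where "a = 2 / p - 1" and "b = 1 / p" and "P = Gp * Hp"
  have P: "P > 0" using GHp by (simp add: P_def)
  have Vab: "V = A powr a * P powr b" by (simp add: V a_def b_def P_def)
  have s_powr: "s powr c = A powr (2 / p * c) * P powr (1 / p * c)" for c
    using A P by (simp add: s_def powr_mult powr_powr flip: P_def)
  have sA: "A * s powr (1 - p) * Gp * Hp = V"
  proof -
    have e: "2 / p * (1 - p) = a - 1" "1 / p * (1 - p) = b - 1"
      using p by (auto simp: a_def b_def field_simps)
    have "s powr (1 - p) = (A powr a / A) * (P powr b / P)"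
      unfolding s_powr unfolding e powr_diff using A P by simp
    then have "A * s powr (1 - p) * P = V" using A P by (simp add: Vab)
    then show ?thesis by (simp add: P_def mult.assoc)
  qed
  have sG: "s powr (2 - p) * (Gp * Hp) = V\<^sup>2"
  proof -
    have e: "2 / p * (2 - p) = a + a" "1 / p * (2 - p) = b + b - 1"
      using p by (auto simp: a_def b_def field_simps)
    have "s powr (2 - p) = (A powr a * A powr a) * (P powr b * P powr b / P)"
      unfolding s_powr unfolding e powr_diff powr_add using A P by simp
    then have "s powr (2 - p) * P = V\<^sup>2" using A P by (simp add: Vab power2_eq_square)
    then show ?thesis by (simp add: P_def)
  qed
  define \<sigma> where "\<sigma> = s powr (2 - p)"
  have \<sigma>: "\<sigma> > 0" using s by (simp add: \<sigma>_def)
  have w2: "w\<^sup>2 = Hp / (Gp * \<sigma>)" using Gp Hp \<sigma> by (simp add: w_def flip: \<sigma>_def)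
  have "(w * (\<sigma> * Gp))\<^sup>2 = \<sigma> * (Gp * Hp)"
    unfolding power_mult_distrib w2 using Gp(2) \<sigma> by (simp add: power2_eq_square field_simps)
  then have "(w * (\<sigma> * Gp))\<^sup>2 = V\<^sup>2" using sG by (simp add: \<sigma>_def)
  then have e1: "w * (\<sigma> * Gp) = V"
    using w Gp V0 \<sigma> by (intro power2_eq_imp_eq[of _ V]) auto
  have "w * V = w\<^sup>2 * (\<sigma> * Gp)" by (simp add: power2_eq_square flip: e1)
  also have "\<dots> = Hp" unfolding w2 using Gp(2) \<sigma> by simp
  finally have e2: "Hp / w = V" using w by (metis nonzero_mult_div_cancel_left less_irrefl)
  \<comment> \<open>Every term is a multiple of \<open>V\<close>: \<open>1 / p\<close> comes from
    the large part of \<open>g\<close>, \<open>1 / (2 p)\<close> and \<open>1 / (2 (2 - p))\<close>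
    from the two halves of the small-part estimate.\<close>
  have "a1 * (Hp / p) + w / 2 * (\<sigma> / (2 - p) * Gp)
      = (A * s powr (1 - p) * Gp * Hp) / p + (Hp / w) / (2 * p) + (w * (\<sigma> * Gp)) / (2 * (2 - p))"
    unfolding a1_def distrib_right by (simp add: mult_ac)
  also have "\<dots> = V / p + V / (2 * p) + V / (2 * (2 - p))" by (simp only: sA e1 e2)
  also have "\<dots> = (3 / (2 * p) + 1 / (2 * (2 - p))) * V"
    using p by (simp add: field_simps)
  finally show ?thesis using fin by (simp add: I_def T_def V_def mult.assoc \<sigma>_def)
qed

section \<open>Schwartz functions and a damped Duhamel formula\<close>

text \<open>A complex derivative, so that the chain rule gives the time derivative along the
  vertical line on which the propagator runs. The factor in front of the kernel is the one that the
  Laplacian produces: the heat equation at complex time.\<close>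

lemma heat_kernel_has_field_derivative:
  fixes x :: "'a::euclidean_space"
  assumes z: "Re z > 0"
  shows "((\<lambda>z. heat_kernel z x) has_field_derivative
     (of_real ((norm x)\<^sup>2) / (4 * z\<^sup>2) - of_nat DIM('a) / (2 * z)) * heat_kernel z x) (at z)"
proof -
  have nz: "z \<noteq> 0" and nr: "z \<notin> \<real>\<^sub>\<le>\<^sub>0" using csqrt_Re_pos(2)[OF z] z by auto
  define g where "g = (\<lambda>z. 1 / (2 * of_real (sqrt pi) * csqrt z))"
  have g: "(g has_field_derivative - g z / (2 * z)) (at z)"
    unfolding g_def using nz nr
    by (auto intro!: derivative_eq_intros simp: field_simps)
      (metis power2_csqrt power2_eq_square)
  have gp: "((\<lambda>z. g z ^ DIM('a)) has_field_derivative - of_nat DIM('a) / (2 * z) * g z ^ DIM('a)) (at z)"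
  proof -
    have "g z ^ (DIM('a) - Suc 0) * g z = g z ^ DIM('a)"
      using power_minus_mult[of "DIM('a)" "g z"] by simp
    then have "of_nat DIM('a) * (- g z / (2 * z) * g z ^ (DIM('a) - Suc 0)) = - of_nat DIM('a) / (2 * z) * g z ^ DIM('a)"
      by (metis (no_types, opaque_lifting) minus_divide_left mult.commute mult.left_commute mult_minus_left times_divide_eq_left)
    from DERIV_cong[OF DERIV_power[OF g] this] show ?thesis .
  qed
  have e: "((\<lambda>z. exp (- (of_real ((norm x)\<^sup>2) / (4 * z)))) has_field_derivative
      of_real ((norm x)\<^sup>2) / (4 * z\<^sup>2) * exp (- (of_real ((norm x)\<^sup>2) / (4 * z)))) (at z)"
    using nz by (auto intro!: derivative_eq_intros simp: field_simps power2_eq_square)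
  have eq: "heat_kernel z x = exp (- (of_real ((norm x)\<^sup>2) / (4 * z))) * g z ^ DIM('a)" for z
    by (simp add: heat_kernel_def g_def power_divide)
  show ?thesis
    unfolding eq by (rule DERIV_cong[OF DERIV_mult[OF e gp]]) (simp add: algebra_simps)
qed

lemma heat_kernel_has_dir_derivative:
  fixes x y b :: "'a::euclidean_space"
  assumes z: "z \<noteq> 0" and b: "b \<in> Basis"
  shows "((\<lambda>r. heat_kernel z (x - (y + r *\<^sub>R b))) has_vector_derivative
    of_real ((x - (y + r *\<^sub>R b)) \<bullet> b) / (2 * z) * heat_kernel z (x - (y + r *\<^sub>R b))) (at r)"
proof -
  define A where "A = (norm (x - y))\<^sup>2"
  define B where "B = (x - y) \<bullet> b"
  have n: "(norm (x - (y + r *\<^sub>R b)))\<^sup>2 = A - 2 * r * B + r\<^sup>2" for r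
  proof -
    have "x - (y + r *\<^sub>R b) = (x - y) - r *\<^sub>R b" by simp
    moreover have "b \<bullet> b = 1" using b by simp
    ultimately show ?thesis
      by (simp only: power2_norm_eq_inner A_def B_def inner_diff_left inner_diff_right inner_scaleR_left inner_scaleR_right)
        (simp add: algebra_simps power2_eq_square inner_commute)
  qed
  have i: "(x - (y + r *\<^sub>R b)) \<bullet> b = B - r" for r
    using b by (simp add: B_def inner_diff_left inner_add_left)
  define f where "f = (\<lambda>w. exp (- ((of_real A - 2 * w * of_real B + w\<^sup>2) / (4 * z))) / (2 * of_real (sqrt pi) * csqrt z) ^ DIM('a))"
  have f: "heat_kernel z (x - (y + r *\<^sub>R b)) = f (of_real r)" for r
    unfolding heat_kernel_def n f_def by simp
  have "(f has_field_derivative (of_real B - of_real r) / (2 * z) * f (of_real r)) (at (of_real r))"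
    unfolding f_def using z
    by (auto intro!: derivative_eq_intros simp: field_simps power2_eq_square)
  from has_vector_derivative_real_field[OF this] show ?thesis
    unfolding f i by simp
qed

section \<open>Integrable weights and the decay of Schwartz functions\<close>

definition decay_weight :: "'a::euclidean_space \<Rightarrow> real" where
  "decay_weight x = (\<Prod>b\<in>Basis. 1 / (1 + (x \<bullet> b)\<^sup>2))"

lemma decay_weight_pos: "decay_weight x > 0"
  unfolding decay_weight_def by (intro prod_pos) (auto simp: add_pos_nonneg)

text \<open>The product form of the weight reduces integrability to the line, where a power of
  \<open>1 + norm x\<close> would call for polar coordinates.\<close>

lemma integrable_decay_weight: "integrable lborel (decay_weight :: 'a::euclidean_space \<Rightarrow> real)"
proof -
  have "integrable lborel (\<lambda>x::'a. \<Prod>b\<in>Basis. (\<lambda>s. complex_of_real (1 / (1 + s\<^sup>2))) (x \<bullet> b))"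
    by (rule integral_lborel_prod_Basis(1))
      (simp only: complex_of_real_integrable_eq integrable_inverse_1_plus_square)
  then have "integrable lborel (\<lambda>x::'a. complex_of_real (decay_weight x))"
    by (simp add: decay_weight_def)
  then show ?thesis by (simp only: complex_of_real_integrable_eq)
qed

lemma decay_weight_ge:
  fixes x :: "'a::euclidean_space"
  shows "1 / (1 + norm x) ^ (2 * DIM('a)) \<le> decay_weight x"
proof -
  have "1 / (1 + norm x) ^ (2 * DIM('a)) = (\<Prod>b\<in>(Basis::'a set). 1 / (1 + norm x)\<^sup>2)"
    by (simp add: power_mult power_divide)
  also have "\<dots> \<le> decay_weight x"
    unfolding decay_weight_def
  proof (intro prod_mono conjI divide_left_mono)
    fix b :: 'a assume b: "b \<in> Basis"
    have "(x \<bullet> b)\<^sup>2 \<le> (norm x)\<^sup>2" using Basis_le_norm[OF b, of x] by (simp add: abs_le_square_iff[symmetric])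
    moreover have "(1 + norm x)\<^sup>2 = 1 + 2 * norm x + (norm x)\<^sup>2" by (simp add: power2_eq_square algebra_simps)
    ultimately show "1 + (x \<bullet> b)\<^sup>2 \<le> (1 + norm x)\<^sup>2" using norm_ge_zero[of x] by linarith
  qed (auto intro!: mult_pos_pos add_pos_nonneg simp: add_nonneg_eq_0_iff)
  finally show ?thesis .
qed

lemma schwartz_differentiable:
  assumes "schwartz v" "set bs \<subseteq> Basis"
  shows "iter_pderiv bs v differentiable (at z)" "continuous_on UNIV (iter_pderiv bs v)"
proof -
  show *: "iter_pderiv bs v differentiable (at z)" for z
    using assms by (auto simp: schwartz_def)
  show "continuous_on UNIV (iter_pderiv bs v)"
    using * by (auto simp: continuous_on_eq_continuous_at intro!: differentiable_imp_continuous_within)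
qed

text \<open>\<open>vector_derivative\<close> is a choice operator, so existence must come from
  elsewhere: total differentiability at the point supplies it, and it also moves the base point from
  parameter 0 to parameter \<open>r\<close>.\<close>

lemma pderiv_dir_has_vector_derivative:
  fixes f :: "'a::euclidean_space \<Rightarrow> complex"
  assumes "f differentiable (at (z + r *\<^sub>R b))"
  shows "((\<lambda>r. f (z + r *\<^sub>R b)) has_vector_derivative pderiv_dir b f (z + r *\<^sub>R b)) (at r)"
proof -
  obtain D where D: "(f has_derivative D) (at (z + r *\<^sub>R b))"
    using assms by (auto simp: differentiable_def)
  interpret D: bounded_linear D using D by (rule has_derivative_bounded_linear)
  have *: "((\<lambda>s. f (w + s *\<^sub>R b)) has_vector_derivative D b) (at s)" if "w + s *\<^sub>R b = z + r *\<^sub>R b" for w s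
  proof -
    have "((\<lambda>s. w + s *\<^sub>R b) has_derivative (\<lambda>h. h *\<^sub>R b)) (at s)"
      by (auto intro!: derivative_eq_intros)
    from has_derivative_compose[OF this, of f D] D that
    show ?thesis by (simp add: has_vector_derivative_def D.scaleR)
  qed
  have "pderiv_dir b f (z + r *\<^sub>R b) = D b"
    unfolding pderiv_dir_def by (rule vector_derivative_at) (rule *, simp)
  then show ?thesis using *[of z r] by simp
qed

text \<open>The factor \<open>(1 + norm x)^2\<close> is a reserve: two space derivatives of the heat
  kernel multiply it by a polynomial of degree 2, which this factor absorbs in the Duhamel
  formula.\<close>

lemma schwartz_decay:
  fixes v :: "'a::euclidean_space \<times> real \<Rightarrow> complex"
  assumes v: "schwartz v" and bs: "set bs \<subseteq> Basis"
  shows "\<exists>M\<ge>0. \<forall>x t. (1 + norm x)\<^sup>2 * norm (iter_pderiv bs v (x, t)) \<le> M * (decay_weight x * (1 / (1 + t\<^sup>2)))"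
proof -
  \<comment> \<open>Two powers for the reserve, \<open>2 * DIM('a)\<close> for the weight in space
    and two for the weight in time.\<close>
  define N where "N = 2 + 2 * DIM('a) + 2"
  obtain M0 where M0: "\<And>z. norm z ^ 0 * norm (iter_pderiv bs v z) \<le> M0"
    using v bs unfolding schwartz_def by meson
  obtain M1 where M1: "\<And>z. norm z ^ N * norm (iter_pderiv bs v z) \<le> M1"
    using v bs unfolding schwartz_def by meson
  define M where "M = 2 ^ N * (M0 + M1)"
  have bound: "(1 + norm z) ^ N * norm (iter_pderiv bs v z) \<le> M" for z
  proof -
    have "(1 + norm z) ^ N \<le> (2 * max 1 (norm z)) ^ N" by (intro power_mono) auto
    also have "\<dots> \<le> 2 ^ N * (1 + norm z ^ N)"
      by (auto simp: power_mult_distrib max_def)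
    finally have "(1 + norm z) ^ N * norm (iter_pderiv bs v z) \<le> 2 ^ N * (1 + norm z ^ N) * norm (iter_pderiv bs v z)"
      by (intro mult_right_mono) auto
    also have "\<dots> = 2 ^ N * (norm z ^ 0 * norm (iter_pderiv bs v z) + norm z ^ N * norm (iter_pderiv bs v z))"
      by (simp add: algebra_simps)
    also have "\<dots> \<le> M" unfolding M_def by (intro mult_left_mono add_mono M0 M1) auto
    finally show ?thesis .
  qed
  have M: "M \<ge> 0" using order_trans[OF _ bound[of 0]] by simp
  have "(1 + norm x)\<^sup>2 * norm (iter_pderiv bs v (x, t)) \<le> M * (decay_weight x * (1 / (1 + t\<^sup>2)))" for x t
  proof -
    define u where "u = norm (iter_pderiv bs v (x, t))"
    define Z where "Z = 1 + norm (x, t)"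
    have Z: "Z \<ge> 1" by (simp add: Z_def)
    have x: "norm x \<le> norm (x, t)" and t: "\<bar>t\<bar> \<le> norm (x, t)"
      using norm_fst_le[of x t] norm_snd_le[of t x] by auto
    have "1 + t\<^sup>2 \<le> Z\<^sup>2"
    proof -
      have "t\<^sup>2 \<le> (norm (x, t))\<^sup>2" using t by (simp add: abs_le_square_iff[symmetric])
      moreover have "Z\<^sup>2 = 1 + 2 * norm (x, t) + (norm (x, t))\<^sup>2"
        by (simp only: Z_def) (simp add: power2_eq_square algebra_simps)
      ultimately show ?thesis using norm_ge_zero[of "(x, t)"] by linarith
    qed
    then have 3: "1 / Z\<^sup>2 \<le> 1 / (1 + t\<^sup>2)"
      by (intro divide_left_mono mult_pos_pos) (use Z in \<open>auto simp: add_pos_nonneg\<close>)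
    have "1 / Z ^ (2 * DIM('a)) \<le> 1 / (1 + norm x) ^ (2 * DIM('a))"
      using x Z by (intro divide_left_mono power_mono mult_pos_pos zero_less_power) (auto simp: Z_def add_pos_nonneg)
    also have "\<dots> \<le> decay_weight x" by (rule decay_weight_ge)
    finally have 2: "1 / Z ^ (2 * DIM('a)) \<le> decay_weight x" .
    have "(1 + norm x)\<^sup>2 * u \<le> Z\<^sup>2 * u"
      using x by (intro mult_right_mono power_mono) (auto simp: Z_def u_def)
    also have "\<dots> = (Z ^ N * u) * (1 / Z ^ (2 * DIM('a)) * (1 / Z\<^sup>2))"
    proof -
      have "Z ^ N = Z\<^sup>2 * (Z ^ (2 * DIM('a)) * Z\<^sup>2)" by (simp only: N_def power_add mult.assoc)
      then show ?thesis using Z by simp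
    qed
    also have "\<dots> \<le> M * (decay_weight x * (1 / (1 + t\<^sup>2)))"
      using bound[of "(x, t)"] M Z by (intro mult_mono 2 3) (auto simp: u_def Z_def decay_weight_pos less_imp_le)
    finally show ?thesis by (simp add: u_def)
  qed
  with M show ?thesis by blast
qed

lemma integral_FTC_atMost:
  fixes F f :: "real \<Rightarrow> complex"
  assumes deriv: "\<And>s. (F has_vector_derivative f s) (at s)"
    and cont: "continuous_on UNIV f"
    and int: "integrable lborel (\<lambda>s. indicator {..t} s *\<^sub>R f s)"
    and lim: "(F \<longlongrightarrow> 0) at_bot"
  shows "(LBINT s. indicator {..t} s *\<^sub>R f s) = F t"
proof -
  have e: "einterval (-\<infinity>) (ereal t) = {..<t}" by (auto simp: einterval_def)
  have ae: "AE s in lborel. indicator {..<t} s *\<^sub>R f s = indicator {..t} s *\<^sub>R f s"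
    using AE_lborel_singleton[of t] by eventually_elim (auto simp: indicator_def)
  have [measurable]: "f \<in> borel_measurable borel" by (intro borel_measurable_continuous_onI cont)
  have int': "integrable lborel (\<lambda>s. indicator {..<t} s *\<^sub>R f s)"
    by (subst integrable_cong_AE[OF _ _ ae]) (use int in auto)
  have "(LBINT s. indicator {..t} s *\<^sub>R f s) = (LBINT s. indicator {..<t} s *\<^sub>R f s)"
    by (rule integral_cong_AE) (use ae in auto)
  also have "\<dots> = (LBINT s=-\<infinity>..ereal t. f s)"
    by (simp add: interval_lebesgue_integral_def set_lebesgue_integral_def e)
  also have "\<dots> = F t - 0"
  proof (rule interval_integral_FTC_integrable)
    show "isCont f x" for x using cont by (simp add: continuous_on_eq_continuous_at)
    show "set_integrable lborel (einterval (-\<infinity>) (ereal t)) f"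
      using int' by (simp add: set_integrable_def e)
    show "((F \<circ> real_of_ereal) \<longlongrightarrow> 0) (at_right (-\<infinity>))"
      using lim by (simp add: ereal_tendsto_simps)
    have "isCont F t" using deriv[of t] has_vector_derivative_continuous by blast
    then show "((F \<circ> real_of_ereal) \<longlongrightarrow> F t) (at_left (ereal t))"
      by (simp add: ereal_tendsto_simps isCont_def filterlim_at_split)
  qed (use deriv in auto)
  finally show ?thesis by simp
qed

lemma schwartz_decay_finite:
  fixes v :: "'a::euclidean_space \<times> real \<Rightarrow> complex"
  assumes v: "schwartz v" and L: "finite L" "\<And>bs. bs \<in> L \<Longrightarrow> set bs \<subseteq> Basis"
  shows "\<exists>M\<ge>0. \<forall>bs\<in>L. \<forall>x t. (1 + norm x)\<^sup>2 * norm (iter_pderiv bs v (x, t)) \<le> M * (decay_weight x * (1 / (1 + t\<^sup>2)))"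
proof -
  obtain m where m: "\<And>bs. bs \<in> L \<Longrightarrow> m bs \<ge> 0"
    "\<And>bs x t. bs \<in> L \<Longrightarrow> (1 + norm x)\<^sup>2 * norm (iter_pderiv bs v (x, t)) \<le> m bs * (decay_weight x * (1 / (1 + t\<^sup>2)))"
    using schwartz_decay[OF v L(2)] by metis
  have "(1 + norm x)\<^sup>2 * norm (iter_pderiv bs v (x, t)) \<le> sum m L * (decay_weight x * (1 / (1 + t\<^sup>2)))"
    if "bs \<in> L" for bs x t
  proof -
    have "m bs \<le> sum m L" using that m(1) L(1) by (intro member_le_sum) auto
    then have "m bs * (decay_weight x * (1 / (1 + t\<^sup>2))) \<le> sum m L * (decay_weight x * (1 / (1 + t\<^sup>2)))"
      by (intro mult_right_mono) (auto simp: decay_weight_pos less_imp_le)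
    with m(2)[OF that, of x t] show ?thesis by linarith
  qed
  then show ?thesis using m(1) by (intro exI[of _ "sum m L"]) (auto intro: sum_nonneg)
qed

text \<open>The majorant is asked for only at times \<open>s \<le> t\<close>, because the damping
  factor \<open>exp (- \<delta> * (t - s))\<close> grows without bound for later
  \<open>s\<close>.\<close>

lemma half_space_integrable:
  fixes F :: "'a::euclidean_space \<times> real \<Rightarrow> complex"
  assumes c: "continuous_on UNIV F"
    and b: "\<And>y s. s \<le> t \<Longrightarrow> norm (F (y, s)) \<le> B * (decay_weight y * (1 / (1 + s\<^sup>2)))"
  shows "s \<le> t \<Longrightarrow> integrable lborel (\<lambda>y. F (y, s))"
    and "integrable (lborel \<Otimes>\<^sub>M lborel) (\<lambda>(y, s). indicator {..t} s *\<^sub>R F (y, s))"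
    and "integrable lborel (\<lambda>s. indicator {..t} s *\<^sub>R F (y, s))"
proof -
  have mF: "F \<in> borel_measurable borel" by (intro borel_measurable_continuous_onI c)
  have [measurable]: "F \<in> borel_measurable (borel \<Otimes>\<^sub>M borel)" using mF by (simp add: borel_prod)
  show "integrable lborel (\<lambda>y. F (y, s))" if "s \<le> t"
  proof (rule Bochner_Integration.integrable_bound)
    show "integrable lborel (\<lambda>y::'a. B * (1 / (1 + s\<^sup>2)) * decay_weight y)"
      by (intro integrable_mult_right integrable_decay_weight)
    show "AE y in lborel. norm (F (y, s)) \<le> norm (B * (1 / (1 + s\<^sup>2)) * decay_weight y)"
      unfolding real_norm_def
      by (intro always_eventually allI order_trans[OF b[OF that] order_trans[OF _ abs_ge_self]]) simp
  qed measurable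
  have m: "(\<lambda>(y, s). indicator {..t} s *\<^sub>R F (y, s)) \<in> borel_measurable (borel \<Otimes>\<^sub>M borel)" by measurable
  show "integrable (lborel \<Otimes>\<^sub>M lborel) (\<lambda>(y, s). indicator {..t} s *\<^sub>R F (y, s))"
  proof (rule integrable_lborel_pair_bound[where g="\<lambda>y. \<bar>B\<bar> * decay_weight y" and h="\<lambda>s. 1 / (1 + s\<^sup>2)"])
    show "integrable lborel (\<lambda>y::'a. \<bar>B\<bar> * decay_weight y)"
      by (intro integrable_mult_right integrable_decay_weight)
    show "norm (case (y, s) of (y, s) \<Rightarrow> indicator {..t} s *\<^sub>R F (y, s)) \<le> \<bar>B\<bar> * decay_weight y * (1 / (1 + s\<^sup>2))" for y s
    proof (cases "s \<le> t")
      case True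
      have "B * (decay_weight y * (1 / (1 + s\<^sup>2))) \<le> \<bar>B\<bar> * (decay_weight y * (1 / (1 + s\<^sup>2)))"
        by (intro mult_right_mono) (auto simp: decay_weight_pos less_imp_le)
      then show ?thesis using True order_trans[OF b[OF True]] by (simp add: mult.assoc)
    qed (simp add: decay_weight_pos less_imp_le)
  qed (use m integrable_inverse_1_plus_square in \<open>simp_all add: borel_prod\<close>)
  show "integrable lborel (\<lambda>s. indicator {..t} s *\<^sub>R F (y, s))"
  proof (rule Bochner_Integration.integrable_bound)
    show "integrable lborel (\<lambda>s::real. B * decay_weight y * (1 / (1 + s\<^sup>2)))"
      by (intro integrable_mult_right integrable_inverse_1_plus_square)
    have "norm (indicator {..t} s *\<^sub>R F (y, s)) \<le> norm (B * decay_weight y * (1 / (1 + s\<^sup>2)))" for s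
    proof (cases "s \<le> t")
      case True
      then show ?thesis using order_trans[OF b[OF True, of y] abs_ge_self] by (simp add: mult.assoc)
    qed simp
    then show "AE s in lborel. norm (indicator {..t} s *\<^sub>R F (y, s)) \<le> norm (B * decay_weight y * (1 / (1 + s\<^sup>2)))"
      by simp
  qed measurable
qed

text \<open>The kernel of the operator R. Since \<open>i v_t = \<Delta> v\<close> has the propagator
  \<open>exp (- i \<tau> \<Delta>)\<close>, elapsed time \<tau> corresponds to the complex heat time
  \<open>- i \<tau>\<close>, here moved by \<epsilon> into the half plane of positive real
  part.\<close>

definition damped_kernel :: "real \<Rightarrow> real \<Rightarrow> ('a::euclidean_space \<times> real) \<times> ('a \<times> real) \<Rightarrow> complex" where
  "damped_kernel \<epsilon> \<delta> = (\<lambda>((x, t), (y, s)). if s \<le> t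
     then of_real (exp (- \<delta> * (t - s))) * heat_kernel (of_real \<epsilon> - \<i> * of_real (t - s)) (x - y) else 0)"

lemma norm_damped_heat_kernel_le:
  fixes x :: "'a::euclidean_space"
  assumes "\<epsilon> > 0" "\<delta> > 0" "\<tau> \<ge> 0"
  shows "norm (of_real (exp (- \<delta> * \<tau>)) * heat_kernel (of_real \<epsilon> - \<i> * of_real \<tau>) x) \<le> 1 / (2 * sqrt pi * sqrt \<epsilon>) ^ DIM('a)"
proof -
  let ?z = "of_real \<epsilon> - \<i> * of_real \<tau>"
  have "\<epsilon> \<le> norm ?z" using complex_Re_le_cmod[of ?z] by simp
  then have "1 / (2 * sqrt pi * sqrt (norm ?z)) ^ DIM('a) \<le> 1 / (2 * sqrt pi * sqrt \<epsilon>) ^ DIM('a)"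
    using assms by (intro divide_left_mono power_mono mult_left_mono mult_pos_pos zero_less_power) auto
  moreover have "norm (heat_kernel ?z x) \<le> 1 / (2 * sqrt pi * sqrt (norm ?z)) ^ DIM('a)"
    using assms by (intro norm_heat_kernel_le) auto
  ultimately have "norm (heat_kernel ?z x) \<le> 1 / (2 * sqrt pi * sqrt \<epsilon>) ^ DIM('a)" by linarith
  moreover have "exp (- \<delta> * \<tau>) * norm (heat_kernel ?z x) \<le> 1 * norm (heat_kernel ?z x)"
    using assms by (intro mult_right_mono) auto
  ultimately show ?thesis by (simp add: norm_mult)
qed

text \<open>Since \<open>\<partial>\<^sub>z\<close> of the heat kernel is its Laplacian, the integrand on the right is
  \<open>\<partial>\<^sub>s W + i \<Sum>\<^sub>b \<partial>\<^sub>b Z\<^sub>b\<close> with \<open>W = kk v\<close> and \<open>Z\<^sub>b = kk \<partial>\<^sub>b v - (\<partial>\<^sub>b kk) v\<close>, where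
  \<open>kk\<close> is the damped kernel. Below, \<open>W'\<close> and \<open>Z' b\<close> are these derivatives.\<close>
theorem Duhamel_damped:
  fixes v :: "(real^'n::finite) \<times> real \<Rightarrow> complex"
  assumes v: "schwartz v" and \<epsilon>: "\<epsilon> > 0" and \<delta>: "\<delta> > 0"
  shows "(LBINT y. heat_kernel (of_real \<epsilon>) (x - y) * v (y, t)) =
    (LBINT w. damped_kernel \<epsilon> \<delta> ((x, t), w) * (of_real \<delta> * v w - \<i> * schrod_op v w))"
proof -
  define \<zeta> where "\<zeta> = (\<lambda>s. complex_of_real \<epsilon> - \<i> * of_real (t - s))"
  have Re\<zeta>[simp]: "Re (\<zeta> s) = \<epsilon>" for s by (simp add: \<zeta>_def)
  have \<zeta>0: "\<zeta> s \<noteq> 0" for s using \<epsilon> Re\<zeta>[of s] by (metis zero_complex.simps(1) less_irrefl)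
  have \<zeta>\<epsilon>: "\<epsilon> \<le> norm (\<zeta> s)" for s using complex_Re_le_cmod[of "\<zeta> s"] by simp
  define kk where "kk = (\<lambda>y s. complex_of_real (exp (- \<delta> * (t - s))) * heat_kernel (\<zeta> s) (x - y))"
  define vt where "vt = pderiv_dir (0, 1) v"
  define vb where "vb = (\<lambda>b::real^'n. pderiv_dir (b, 0) v)"
  define vbb where "vbb = (\<lambda>b::real^'n. pderiv_dir (b, 0) (vb b))"
  \<comment> \<open>One and two derivatives in direction \<open>b\<close> multiply the kernel by
    \<open>cb\<close> and \<open>cbb\<close>; the subtracted \<open>1 / (2 * \<zeta> s)\<close> in
    \<open>cbb\<close> comes from differentiating \<open>cb\<close> itself.\<close>
  define cb where "cb = (\<lambda>(b::real^'n) y s. of_real ((x - y) \<bullet> b) / (2 * \<zeta> s))"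
  define cbb where "cbb = (\<lambda>(b::real^'n) y s. (cb b y s)\<^sup>2 - 1 / (2 * \<zeta> s))"
  define L where "L = {[], [(0::real^'n, 1::real)]} \<union> (\<lambda>b. [(b, 0)]) ` Basis \<union> (\<lambda>b. [(b, 0), (b, 0)]) ` Basis"
  have L: "finite L" "\<And>bs. bs \<in> L \<Longrightarrow> set bs \<subseteq> Basis" unfolding L_def by (auto simp: Basis_prod_def)
  have it: "iter_pderiv [] v = v" "iter_pderiv [(0, 1)] v = vt" "iter_pderiv [(b, 0)] v = vb b"
     "iter_pderiv [(b, 0), (b, 0)] v = vbb b" for b
    by (simp_all add: vt_def vb_def vbb_def)
  have Lm: "[] \<in> L" "[(0, 1)] \<in> L" "\<And>b. b \<in> Basis \<Longrightarrow> [(b, 0)] \<in> L" "\<And>b. b \<in> Basis \<Longrightarrow> [(b, 0), (b, 0)] \<in> L"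
    by (auto simp: L_def)
  obtain M where M: "M \<ge> 0" "\<And>bs x t. bs \<in> L \<Longrightarrow> (1 + norm x)\<^sup>2 * norm (iter_pderiv bs v (x, t)) \<le> M * (decay_weight x * (1 / (1 + t\<^sup>2)))"
    using schwartz_decay_finite[OF v L] by blast
  note cont = schwartz_differentiable(2)[OF v L(2)]
  note diff = schwartz_differentiable(1)[OF v L(2)]
  have cv: "continuous_on UNIV v" "continuous_on UNIV vt"
    "\<And>b. b \<in> Basis \<Longrightarrow> continuous_on UNIV (vb b)" "\<And>b. b \<in> Basis \<Longrightarrow> continuous_on UNIV (vbb b)"
    using cont[OF Lm(1)] cont[OF Lm(2)] cont[OF Lm(3)] cont[OF Lm(4)] unfolding it by auto
  have ckk: "continuous_on UNIV (\<lambda>p. kk (fst p) (snd p))"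
    unfolding kk_def \<zeta>_def using \<epsilon>
    by (intro continuous_intros continuous_on_heat_kernel) auto
  have c\<zeta>: "continuous_on UNIV (\<lambda>p::(real^'n) \<times> real. 2 * \<zeta> (snd p))"
    unfolding \<zeta>_def by (intro continuous_intros)
  have ccb: "continuous_on UNIV (\<lambda>p. cb b (fst p) (snd p))" for b
    unfolding cb_def by (intro continuous_on_divide c\<zeta>) (auto simp: \<zeta>0 intro!: continuous_intros)
  have ccbb: "continuous_on UNIV (\<lambda>p. cbb b (fst p) (snd p))" for b
    unfolding cbb_def by (intro continuous_on_diff continuous_on_power ccb continuous_on_divide c\<zeta>) (auto simp: \<zeta>0)
  define c0 where "c0 = 1 / (2 * sqrt pi * sqrt \<epsilon>) ^ DIM(real^'n)"
  have c0: "c0 \<ge> 0" using \<epsilon> by (simp add: c0_def)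
  have nkk: "norm (kk y s) \<le> c0" if "s \<le> t" for y s
    unfolding kk_def \<zeta>_def c0_def using norm_damped_heat_kernel_le[OF \<epsilon> \<delta>, of "t - s" "x - y"] that by simp
  \<comment> \<open>Dominates each of the factors 1, \<open>cb\<close> and \<open>cbb\<close> up to
    \<open>(1 + norm y)^2\<close>, the reserve in the decay estimate. It depends on \<open>x\<close>
    and \<epsilon>, which are fixed here.\<close>
  define E where "E = (1 + norm x)\<^sup>2 * (1 + 1 / (2 * \<epsilon>) + 1 / (2 * \<epsilon>)\<^sup>2)"
  have E1: "1 \<le> 1 + 1 / (2 * \<epsilon>) + 1 / (2 * \<epsilon>)\<^sup>2" using \<epsilon> by simp
  have one_le: "1 \<le> (1 + norm u)\<^sup>2" for u :: "real^'n" by simp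
  have E0: "E \<ge> 0" unfolding E_def using E1 by (intro mult_nonneg_nonneg) auto
  have q_le: "\<bar>(x - y) \<bullet> b\<bar> \<le> (1 + norm x) * (1 + norm y)" if "b \<in> Basis" for y b
  proof -
    have "\<bar>(x - y) \<bullet> b\<bar> \<le> norm (x - y)" by (rule Basis_le_norm[OF that])
    also have "\<dots> \<le> norm x + norm y" by (rule norm_triangle_ineq4)
    also have "\<dots> \<le> (1 + norm x) * (1 + norm y)" by (simp add: algebra_simps)
    finally show ?thesis .
  qed
  have ncb1: "norm (cb b y s) \<le> (1 + norm x) * (1 + norm y) * (1 / (2 * \<epsilon>))" if "b \<in> Basis" for b y s
  proof -
    have "norm (cb b y s) = \<bar>(x - y) \<bullet> b\<bar> * (1 / (2 * norm (\<zeta> s)))"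
      by (simp add: cb_def norm_divide norm_mult)
    also have "\<dots> \<le> (1 + norm x) * (1 + norm y) * (1 / (2 * \<epsilon>))"
      using q_le[OF that, of y] \<zeta>\<epsilon>[of s] \<epsilon> \<zeta>0[of s]
      by (intro mult_mono divide_left_mono mult_pos_pos) auto
    finally show ?thesis .
  qed
  have ncb: "norm (cb b y s) \<le> E * (1 + norm y)\<^sup>2" if "b \<in> Basis" for b y s
  proof -
    have "(1 + norm x) * (1 + norm y) * (1 / (2 * \<epsilon>)) \<le> (1 + norm x)\<^sup>2 * (1 + norm y)\<^sup>2 * (1 + 1 / (2 * \<epsilon>) + 1 / (2 * \<epsilon>)\<^sup>2)"
      using \<epsilon> self_le_power[of "1 + norm x" 2] self_le_power[of "1 + norm y" 2] by (intro mult_mono) auto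
    then show ?thesis using ncb1[OF that, of y s] by (simp add: E_def mult_ac)
  qed
  have ncbb: "norm (cbb b y s) \<le> E * (1 + norm y)\<^sup>2" if "b \<in> Basis" for b y s
  proof -
    have "norm (cbb b y s) \<le> norm (cb b y s)^2 + norm (1 / (2 * \<zeta> s))"
      unfolding cbb_def norm_power[symmetric] by (rule norm_triangle_ineq4)
    also have "\<dots> \<le> ((1 + norm x) * (1 + norm y) * (1 / (2 * \<epsilon>)))^2 + 1 / (2 * \<epsilon>)"
      using ncb1[OF that, of y s] \<zeta>\<epsilon>[of s] \<epsilon> \<zeta>0[of s]
      by (intro add_mono power_mono) (auto simp: norm_divide norm_mult intro!: divide_left_mono)
    also have "\<dots> \<le> (1 + norm x)\<^sup>2 * (1 + norm y)\<^sup>2 * (1 / (2 * \<epsilon>)\<^sup>2) + (1 + norm x)\<^sup>2 * (1 + norm y)\<^sup>2 * (1 + 1 / (2 * \<epsilon>))"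
    proof (rule add_mono)
      have "1 * 1 * (1 / (2 * \<epsilon>)) \<le> (1 + norm x)\<^sup>2 * (1 + norm y)\<^sup>2 * (1 + 1 / (2 * \<epsilon>))"
        using \<epsilon> one_le[of x] one_le[of y] by (intro mult_mono) auto
      then show "1 / (2 * \<epsilon>) \<le> (1 + norm x)\<^sup>2 * (1 + norm y)\<^sup>2 * (1 + 1 / (2 * \<epsilon>))" by simp
    qed (simp add: power_mult_distrib power_divide)
    also have "\<dots> = E * (1 + norm y)\<^sup>2" by (simp add: E_def algebra_simps)
    finally show ?thesis .
  qed
  have n1: "norm (1::complex) \<le> E * (1 + norm y)\<^sup>2" for y :: "real^'n"
  proof -
    have "1 * 1 * 1 \<le> (1 + norm x)\<^sup>2 * (1 + norm y)\<^sup>2 * (1 + 1 / (2 * \<epsilon>) + 1 / (2 * \<epsilon>)\<^sup>2)"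
      using E1 one_le[of x] one_le[of y] by (intro mult_mono) auto
    then show ?thesis by (simp add: E_def mult_ac)
  qed
  define B where "B = E * c0 * M"
  have gen: "norm (c * (kk y s * iter_pderiv bs v (y, s))) \<le> B * (decay_weight y * (1 / (1 + s\<^sup>2)))"
    if "s \<le> t" "bs \<in> L" "norm c \<le> E * (1 + norm y)\<^sup>2" for c y s bs
  proof -
    have "norm (c * (kk y s * iter_pderiv bs v (y, s))) \<le> (E * (1 + norm y)\<^sup>2) * (c0 * norm (iter_pderiv bs v (y, s)))"
      unfolding norm_mult using that nkk[OF that(1), of y] E0 by (intro mult_mono mult_right_mono) auto
    also have "\<dots> = E * c0 * ((1 + norm y)\<^sup>2 * norm (iter_pderiv bs v (y, s)))" by simp
    also have "\<dots> \<le> E * c0 * (M * (decay_weight y * (1 / (1 + s\<^sup>2))))"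
      using E0 c0 by (intro mult_left_mono M that) auto
    finally show ?thesis by (simp add: B_def)
  qed
  have g0: "norm (kk y s * v (y, s)) \<le> B * (decay_weight y * (1 / (1 + s\<^sup>2)))"
    and gt: "norm (kk y s * vt (y, s)) \<le> B * (decay_weight y * (1 / (1 + s\<^sup>2)))" if "s \<le> t" for y s
    using gen[OF that Lm(1) n1[of y]] gen[OF that Lm(2) n1[of y]] unfolding it by simp_all
  have gb: "norm (kk y s * vb b (y, s)) \<le> B * (decay_weight y * (1 / (1 + s\<^sup>2)))"
    and gbb: "norm (kk y s * vbb b (y, s)) \<le> B * (decay_weight y * (1 / (1 + s\<^sup>2)))"
    and gcb: "norm (cb b y s * (kk y s * v (y, s))) \<le> B * (decay_weight y * (1 / (1 + s\<^sup>2)))"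
    and gcbb: "norm (cbb b y s * (kk y s * v (y, s))) \<le> B * (decay_weight y * (1 / (1 + s\<^sup>2)))"
    if "s \<le> t" "b \<in> Basis" for y s b
    using gen[OF that(1) Lm(3)[OF that(2)] n1[of y]] gen[OF that(1) Lm(4)[OF that(2)] n1[of y]]
      gen[OF that(1) Lm(1) ncb[OF that(2), of y s]] gen[OF that(1) Lm(1) ncbb[OF that(2), of y s]] unfolding it by simp_all
  define Z where "Z = (\<lambda>b p. kk (fst p) (snd p) * vb b p - cb b (fst p) (snd p) * (kk (fst p) (snd p) * v p))"
  define Z' where "Z' = (\<lambda>b p. kk (fst p) (snd p) * vbb b p - cbb b (fst p) (snd p) * (kk (fst p) (snd p) * v p))"
  have cZ: "continuous_on UNIV (Z b)" "continuous_on UNIV (Z' b)" if "b \<in> Basis" for b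
    unfolding Z_def Z'_def using that by (intro continuous_intros ckk ccb ccbb cv, simp)+
  have bZ: "norm (Z b (y, s)) \<le> (2 * B) * (decay_weight y * (1 / (1 + s\<^sup>2)))"
    "norm (Z' b (y, s)) \<le> (2 * B) * (decay_weight y * (1 / (1 + s\<^sup>2)))" if "s \<le> t" "b \<in> Basis" for b y s
    using norm_triangle_ineq4[of "kk y s * vb b (y, s)" "cb b y s * (kk y s * v (y, s))"]
      norm_triangle_ineq4[of "kk y s * vbb b (y, s)" "cbb b y s * (kk y s * v (y, s))"]
      gb[OF that, of y] gbb[OF that, of y] gcb[OF that, of y] gcbb[OF that, of y]
    unfolding Z_def Z'_def fst_conv snd_conv by linarith+
  have dkk: "((\<lambda>r. kk (y + r *\<^sub>R b) s) has_vector_derivative cb b (y + r *\<^sub>R b) s * kk (y + r *\<^sub>R b) s) (at r)"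
    if "b \<in> Basis" for b y s r
    unfolding kk_def cb_def
    using has_vector_derivative_mult_right[OF heat_kernel_has_dir_derivative[OF \<zeta>0 that], of "of_real (exp (- \<delta> * (t - s)))"]
    by (simp add: mult_ac)
  have dcb: "((\<lambda>r. cb b (y + r *\<^sub>R b) s) has_vector_derivative - 1 / (2 * \<zeta> s)) (at r)"
    if "b \<in> Basis" for b y s r
  proof -
    have "cb b (y + r *\<^sub>R b) s = cb b y s + r *\<^sub>R (- 1 / (2 * \<zeta> s))" for r
    proof -
      have "(x - (y + r *\<^sub>R b)) \<bullet> b = (x - y) \<bullet> b - r"
        using that by (simp add: inner_diff_left inner_add_left)
      then show ?thesis unfolding cb_def by (simp add: scaleR_conv_of_real diff_divide_distrib)
    qed
    then show ?thesis
      by (auto intro!: derivative_eq_intros simp: has_vector_derivative_def)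
  qed
  have dv: "((\<lambda>r. v (y + r *\<^sub>R b, s)) has_vector_derivative vb b (y + r *\<^sub>R b, s)) (at r)"
    "((\<lambda>r. vb b (y + r *\<^sub>R b, s)) has_vector_derivative vbb b (y + r *\<^sub>R b, s)) (at r)"
    if "b \<in> Basis" for b y s r
    using pderiv_dir_has_vector_derivative[where z="(y, s)" and r=r and b="(b, 0)", OF diff[OF Lm(1)]]
      pderiv_dir_has_vector_derivative[where z="(y, s)" and r=r and b="(b, 0)", OF diff[OF Lm(3)[OF that]]]
    unfolding it by (simp_all add: vb_def vbb_def)
  have Z0: "(LBINT y. Z' b (y, s)) = 0" if st: "s \<le> t" and b: "b \<in> Basis" for b s
  proof (rule integral_dirderiv_eq_0[where b=b and F="\<lambda>y. Z b (y, s)"])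
    show "integrable lborel (\<lambda>y. Z b (y, s))" "integrable lborel (\<lambda>y. Z' b (y, s))"
      using half_space_integrable(1)[OF cZ(1)[OF b] bZ(1)[OF _ b] st] half_space_integrable(1)[OF cZ(2)[OF b] bZ(2)[OF _ b] st] by auto
    show "continuous_on UNIV (\<lambda>y. Z' b (y, s))"
      by (intro continuous_on_compose2[OF cZ(2)[OF b]] continuous_intros) auto
    fix y r
    let ?y = "y + r *\<^sub>R b"
    have "((\<lambda>r. Z b (y + r *\<^sub>R b, s)) has_vector_derivative
       (kk ?y s * vbb b (?y, s) + (cb b ?y s * kk ?y s) * vb b (?y, s)) -
       (cb b ?y s * (kk ?y s * vb b (?y, s) + (cb b ?y s * kk ?y s) * v (?y, s)) + (- 1 / (2 * \<zeta> s)) * (kk ?y s * v (?y, s)))) (at r)"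
      unfolding Z_def fst_conv snd_conv
      by (intro has_vector_derivative_diff has_vector_derivative_mult dkk dcb dv b)
    also have "(kk ?y s * vbb b (?y, s) + (cb b ?y s * kk ?y s) * vb b (?y, s)) -
       (cb b ?y s * (kk ?y s * vb b (?y, s) + (cb b ?y s * kk ?y s) * v (?y, s)) + (- 1 / (2 * \<zeta> s)) * (kk ?y s * v (?y, s)))
       = Z' b (?y, s)"
      by (simp add: Z'_def cbb_def algebra_simps power2_eq_square)
    finally show "((\<lambda>r. Z b (y + r *\<^sub>R b, s)) has_vector_derivative Z' b (?y, s)) (at r)" .
  qed
  define W' where "W' = (\<lambda>p. of_real \<delta> * (kk (fst p) (snd p) * v p) + \<i> * (\<Sum>b\<in>Basis. cbb b (fst p) (snd p) * (kk (fst p) (snd p) * v p))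
      + kk (fst p) (snd p) * vt p)"
  have cW': "continuous_on UNIV W'"
    unfolding W'_def by (intro continuous_intros ckk ccbb cv)
  have bW': "norm (W' (y, s)) \<le> (\<delta> * B + real DIM(real^'n) * B + B) * (decay_weight y * (1 / (1 + s\<^sup>2)))" if "s \<le> t" for y s
  proof -
    define wt where "wt = decay_weight y * (1 / (1 + s\<^sup>2))"
    have 1: "norm (of_real \<delta> * (kk y s * v (y, s))) \<le> \<delta> * (B * wt)"
      using mult_left_mono[OF g0[OF that, of y], of \<delta>] \<delta> by (simp add: norm_mult wt_def)
    have "norm (\<Sum>b\<in>Basis. cbb b y s * (kk y s * v (y, s))) \<le> real (card (Basis :: (real^'n) set)) * (B * wt)"
      unfolding wt_def by (rule sum_norm_bound) (rule gcbb[OF that])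
    then have 2: "norm (\<i> * (\<Sum>b\<in>Basis. cbb b y s * (kk y s * v (y, s)))) \<le> real DIM(real^'n) * (B * wt)"
      by (simp only: norm_mult norm_ii mult_1)
    have 3: "norm (kk y s * vt (y, s)) \<le> B * wt" unfolding wt_def by (rule gt[OF that])
    have "norm (W' (y, s)) \<le> \<delta> * (B * wt) + real DIM(real^'n) * (B * wt) + B * wt"
      unfolding W'_def fst_conv snd_conv by (intro norm_triangle_mono 1 2 3)
    also have "\<dots> = (\<delta> * B + real DIM(real^'n) * B + B) * wt" by (simp only: distrib_right mult.assoc)
    finally show ?thesis by (simp only: wt_def)
  qed
  have norm_sq: "(norm u)\<^sup>2 = (\<Sum>b\<in>Basis. (u \<bullet> b)\<^sup>2)" for u :: "real^'n"
    by (subst power2_norm_eq_inner, subst euclidean_inner) (simp add: power2_eq_square)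
  have dkkt: "((\<lambda>s. kk y s) has_vector_derivative (of_real \<delta> + \<i> * (\<Sum>b\<in>Basis. cbb b y s)) * kk y s) (at s)" for y s
  proof -
    define H where "H = (\<lambda>w. exp (- of_real \<delta> * (of_real t - w)) * heat_kernel (of_real \<epsilon> - \<i> * (of_real t - w)) (x - y))"
    have sumcbb: "(\<Sum>b\<in>Basis. cbb b y s) = of_real ((norm (x - y))\<^sup>2) / (4 * (\<zeta> s)\<^sup>2) - of_nat DIM(real^'n) / (2 * \<zeta> s)"
      unfolding norm_sq cbb_def cb_def
      by (simp add: sum_subtractf sum_divide_distrib power_divide power_mult_distrib)
    have in\<zeta>: "((\<lambda>w. of_real \<epsilon> - \<i> * (of_real t - w)) has_field_derivative \<i>) (at (of_real s))"
      by (auto intro!: derivative_eq_intros)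
    have \<zeta>s: "of_real \<epsilon> - \<i> * (of_real t - of_real s) = \<zeta> s" by (simp add: \<zeta>_def)
    have "((\<lambda>z. heat_kernel z (x - y)) has_field_derivative (\<Sum>b\<in>Basis. cbb b y s) * heat_kernel (\<zeta> s) (x - y)) (at (of_real \<epsilon> - \<i> * (of_real t - of_real s)))"
      unfolding sumcbb \<zeta>s by (rule heat_kernel_has_field_derivative) (simp add: \<epsilon>)
    from DERIV_chain2[OF this in\<zeta>]
    have d1: "((\<lambda>w. heat_kernel (of_real \<epsilon> - \<i> * (of_real t - w)) (x - y)) has_field_derivative
        (\<Sum>b\<in>Basis. cbb b y s) * heat_kernel (\<zeta> s) (x - y) * \<i>) (at (of_real s))" .
    have d2: "((\<lambda>w. exp (- of_real \<delta> * (of_real t - w))) has_field_derivative of_real \<delta> * exp (- of_real \<delta> * (of_real t - of_real s))) (at (of_real s))"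
      by (auto intro!: derivative_eq_intros)
    have ex: "exp (- of_real \<delta> * (of_real t - of_real s)) = complex_of_real (exp (- \<delta> * (t - s)))"
      by (simp add: exp_of_real[symmetric])
    have "(H has_field_derivative (of_real \<delta> + \<i> * (\<Sum>b\<in>Basis. cbb b y s)) * kk y s) (at (of_real s))"
      unfolding H_def
      by (rule DERIV_cong[OF DERIV_mult[OF d2 d1]]) (unfold kk_def ex \<zeta>s, simp only: algebra_simps)
    moreover have "H (of_real s) = kk y s" for s
      by (simp add: H_def kk_def \<zeta>_def exp_of_real[symmetric])
    ultimately show ?thesis using has_vector_derivative_real_field[of H] by simp
  qed
  have dvt: "((\<lambda>s. v (y, s)) has_vector_derivative vt (y, s)) (at s)" for y s
    using pderiv_dir_has_vector_derivative[where z="(y, 0)" and r=s and b="(0, 1)", OF diff[OF Lm(1)]]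
    unfolding it by (simp add: vt_def)
  have dW: "((\<lambda>s. kk y s * v (y, s)) has_vector_derivative W' (y, s)) (at s)" for y s
  proof -
    have "((\<lambda>s. kk y s * v (y, s)) has_vector_derivative kk y s * vt (y, s) + (of_real \<delta> + \<i> * (\<Sum>b\<in>Basis. cbb b y s)) * kk y s * v (y, s)) (at s)"
      by (intro has_vector_derivative_mult dkkt dvt)
    also have "kk y s * vt (y, s) + (of_real \<delta> + \<i> * (\<Sum>b\<in>Basis. cbb b y s)) * kk y s * v (y, s) = W' (y, s)"
      by (simp add: W'_def algebra_simps sum_distrib_left sum_distrib_right)
    finally show ?thesis .
  qed
  define h where "h = (\<lambda>w. of_real \<delta> * v w - \<i> * schrod_op v w)"
  have h_eq: "h w = of_real \<delta> * v w + vt w + \<i> * (\<Sum>b\<in>Basis. vbb b w)" for w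
    by (simp add: h_def schrod_op_def vt_def vbb_def vb_def right_diff_distrib mult.assoc[symmetric])
  have kh: "kk y s * h (y, s) = W' (y, s) + \<i> * (\<Sum>b\<in>Basis. Z' b (y, s))" for y s
    by (simp add: h_eq W'_def Z'_def sum_subtractf algebra_simps sum_distrib_left)
  define I1 where "I1 = (\<lambda>(y, s). indicator {..t} s *\<^sub>R (kk y s * h (y, s)))"
  define I2 where "I2 = (\<lambda>(y, s). indicator {..t} s *\<^sub>R W' (y, s))"
  have iW: "integrable (lborel \<Otimes>\<^sub>M lborel) I2"
    unfolding I2_def by (rule half_space_integrable(2)[OF cW' bW'])
  have iZ: "integrable (lborel \<Otimes>\<^sub>M lborel) (\<lambda>(y, s). indicator {..t} s *\<^sub>R Z' b (y, s))" if "b \<in> Basis" for b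
    by (rule half_space_integrable(2)[OF cZ(2)[OF that] bZ(2)[OF _ that]])
  have "I1 = (\<lambda>p. I2 p + \<i> * (\<Sum>b\<in>Basis. (case p of (y, s) \<Rightarrow> indicator {..t} s *\<^sub>R Z' b (y, s))))"
    by (auto simp: fun_eq_iff I1_def I2_def kh scaleR_add_right scaleR_sum_right indicator_def)
  moreover have "integrable (lborel \<Otimes>\<^sub>M lborel) (\<lambda>p. I2 p + \<i> * (\<Sum>b\<in>Basis. (case p of (y, s) \<Rightarrow> indicator {..t} s *\<^sub>R Z' b (y, s))))"
    by (intro Bochner_Integration.integrable_add integrable_mult_right Bochner_Integration.integrable_sum iW iZ)
  ultimately have iI1: "integrable (lborel \<Otimes>\<^sub>M lborel) I1" by simp
  have slice: "(LBINT y. I1 (y, s)) = (LBINT y. I2 (y, s))" for s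
  proof (cases "s \<le> t")
    case True
    have iz: "integrable lborel (\<lambda>y. Z' b (y, s))" if "b \<in> Basis" for b
      by (rule half_space_integrable(1)[OF cZ(2)[OF that] bZ(2)[OF _ that] True])
    have iw: "integrable lborel (\<lambda>y. W' (y, s))"
      by (rule half_space_integrable(1)[OF cW' bW' True])
    have "(LBINT y. I1 (y, s)) = (LBINT y. W' (y, s) + \<i> * (\<Sum>b\<in>Basis. Z' b (y, s)))"
      using True by (simp add: I1_def kh)
    also have "\<dots> = (LBINT y. W' (y, s)) + \<i> * (\<Sum>b\<in>Basis. (LBINT y. Z' b (y, s)))"
      using iz iw by (simp add: Bochner_Integration.integral_add Bochner_Integration.integral_sum)
    also have "\<dots> = (LBINT y. I2 (y, s))" using True Z0[OF True] by (simp add: I2_def)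
    finally show ?thesis .
  qed (simp add: I1_def I2_def)
  have time: "(LBINT s. I2 (y, s)) = kk y t * v (y, t)" for y
    unfolding I2_def prod.case
  proof (rule integral_FTC_atMost)
    show "((\<lambda>s. kk y s * v (y, s)) has_vector_derivative W' (y, s)) (at s)" for s by (rule dW)
    show "continuous_on UNIV (\<lambda>s. W' (y, s))"
      by (intro continuous_on_compose2[OF cW'] continuous_intros) auto
    show "integrable lborel (\<lambda>s. indicator {..t} s *\<^sub>R W' (y, s))"
      by (rule half_space_integrable(3)[OF cW' bW'])
    show "((\<lambda>s. kk y s * v (y, s)) \<longlongrightarrow> 0) at_bot"
    proof (rule Lim_null_comparison)
      show "\<forall>\<^sub>F s in at_bot. norm (kk y s * v (y, s)) \<le> B * decay_weight y * (1 / (1 + s\<^sup>2))"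
        using eventually_le_at_bot[of t] by eventually_elim (use g0 in \<open>simp add: mult.assoc\<close>)
      have "((\<lambda>s::real. 1 / (1 + s\<^sup>2)) \<longlongrightarrow> 0) at_bot" by real_asymp
      from tendsto_mult_right_zero[OF this] show "((\<lambda>s::real. B * decay_weight y * (1 / (1 + s\<^sup>2))) \<longlongrightarrow> 0) at_bot" .
    qed
  qed
  have "(LBINT w. damped_kernel \<epsilon> \<delta> ((x, t), w) * h w) = (\<integral>w. I1 w \<partial>(lborel \<Otimes>\<^sub>M lborel))"
    unfolding lborel_prod
    by (intro Bochner_Integration.integral_cong) (auto simp: damped_kernel_def I1_def kk_def \<zeta>_def indicator_def)
  also have "\<dots> = (LBINT s. (LBINT y. I1 (y, s)))"
    using lborel_pair.integral_snd[of "\<lambda>y s. I1 (y, s)"] iI1 by (simp add: case_prod_eta)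
  also have "\<dots> = (LBINT s. (LBINT y. I2 (y, s)))" by (simp only: slice)
  also have "\<dots> = (LBINT y. (LBINT s. I2 (y, s)))"
    using lborel_pair.Fubini_integral[of "\<lambda>y s. I2 (y, s)"] iW by (simp add: case_prod_eta)
  \<comment> \<open>At \<open>s = t\<close> the damping is 1 and the complex time is \<epsilon>, so
    the boundary term is a mollification of \<open>v\<close> at time \<open>t\<close>.\<close>
  also have "\<dots> = (LBINT y. heat_kernel (of_real \<epsilon>) (x - y) * v (y, t))"
    by (simp add: time kk_def \<zeta>_def)
  finally show ?thesis by (simp add: h_def)
qed

text \<open>The integral of a non-integrable function is 0 by convention, so iterated integrals can
  be estimated without checking the inner ones for integrability.\<close>

lemma norm_integral_le_nn_integral:
  fixes f :: "'a \<Rightarrow> 'b::{banach, second_countable_topology}"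
  shows "ennreal (norm (integral\<^sup>L M f)) \<le> (\<integral>\<^sup>+x. ennreal (norm (f x)) \<partial>M)"
proof (cases "integrable M f")
  case True
  then show ?thesis by (rule integral_norm_bound_ennreal)
qed (simp add: not_integrable_integral_eq)

lemma AE_eq_0_of_nn_integral_powr:
  fixes g :: "'a::euclidean_space \<Rightarrow> complex"
  assumes [measurable]: "g \<in> borel_measurable borel" and "(\<integral>\<^sup>+x. ennreal (norm (g x) powr p) \<partial>lborel) = 0"
  shows "AE x in lborel. g x = 0"
proof -
  have "AE x in lborel. ennreal (norm (g x) powr p) = 0"
    using assms by (subst (asm) nn_integral_0_iff_AE) auto
  then show ?thesis by eventually_elim auto
qed

section \<open>The dual estimate\<close>

text \<open>Interpolates between the kernel bound \<open>(4 \<pi> |z|)^(-n/2)\<close>, with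
  \<open>n = DIM('a)\<close>, and the L^2 contraction. For this \<open>p\<close> the resulting
  exponent \<open>(n/2)(2/p - 1)\<close> is \<open>n/(n+2) = 2 - 2/p\<close>, as
  Hardy-Littlewood-Sobolev in time requires. Only the imaginary part of \<open>z\<close> appears in
  the bound, which makes it uniform in \<epsilon>.\<close>

theorem heat_kernel_dispersive:
  fixes g h :: "'a::euclidean_space \<Rightarrow> complex"
  assumes z: "Re z > 0" "Im z \<noteq> 0"
    and p: "p = 2 * (real DIM('a) + 2) / (real DIM('a) + 4)"
    and g: "integrable lborel g" "\<And>x. norm (g x) \<le> B"
    and h: "integrable lborel h" "\<And>x. norm (h x) \<le> B'"
    and Gp: "(\<integral>\<^sup>+x. ennreal (norm (g x) powr p) \<partial>lborel) = ennreal Gp" "Gp \<ge> 0"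
    and Hp: "(\<integral>\<^sup>+x. ennreal (norm (h x) powr p) \<partial>lborel) = ennreal Hp" "Hp \<ge> 0"
  shows "norm (LBINT x. h x * (LBINT y. heat_kernel z (x - y) * g y))
     \<le> (3 / (2 * p) + 1 / (2 * (2 - p))) * \<bar>Im z\<bar> powr - (2 - 2 / p) * Gp powr (1 / p) * Hp powr (1 / p)"
proof -
  define n where "n = real DIM('a)"
  have n: "n \<ge> 1" using DIM_positive[where 'a='a] unfolding n_def by linarith
  have p_eq: "p = 2 * (n + 2) / (n + 4)" using p by (simp add: n_def)
  have p12: "1 < p" "p < 2" using n by (auto simp: p_eq field_simps)
  have \<alpha>: "2 / p - 1 = 2 / (n + 2)" "2 - 2 / p = n / (n + 2)"
    using n by (auto simp: p_eq field_simps)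
  define Cp where "Cp = 3 / (2 * p) + 1 / (2 * (2 - p))"
  have Cp: "Cp \<ge> 0" using p12 by (simp add: Cp_def)
  have [measurable]: "g \<in> borel_measurable borel" "h \<in> borel_measurable borel" using g h by auto
  show ?thesis
  proof (cases "Gp = 0 \<or> Hp = 0")
    case True
    then have "(LBINT x. h x * (LBINT y. heat_kernel z (x - y) * g y)) = 0"
    proof
      assume "Gp = 0"
      then have "AE y in lborel. g y = 0" using Gp by (intro AE_eq_0_of_nn_integral_powr[of _ p]) auto
      then have "(LBINT y. heat_kernel z (x - y) * g y) = 0" for x
        by (intro integral_eq_zero_AE) auto
      then show ?thesis by simp
    next
      assume "Hp = 0"
      then have "AE x in lborel. h x = 0" using Hp by (intro AE_eq_0_of_nn_integral_powr[of _ p]) auto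
      then show ?thesis by (intro integral_eq_zero_AE) auto
    qed
    moreover have "(3 / (2 * p) + 1 / (2 * (2 - p))) * \<bar>Im z\<bar> powr - (2 - 2 / p) * Gp powr (1 / p) * Hp powr (1 / p) = 0"
      using True by auto
    ultimately show ?thesis by (simp only: norm_zero order_refl)
  next
    case False
    then have pos: "Gp > 0" "Hp > 0" using Gp Hp by auto
    have nz: "norm z > 0" using z by auto
    define A where "A = 1 / (2 * sqrt pi * sqrt (norm z)) ^ DIM('a)"
    have A: "A > 0" using nz by (simp add: A_def)
    define k where "k = (\<lambda>p::'a \<times> 'a. heat_kernel z (fst p - snd p))"
    have 1: "norm (LBINT x. h x * (LBINT y. k (x, y) * g y))
      \<le> (3 / (2 * p) + 1 / (2 * (2 - p))) * A powr (2 / p - 1) * Gp powr (1 / p) * Hp powr (1 / p)"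
    proof (rule bilinear_interpolation[OF p12 A _ _ _ g h Gp(1) pos(1) Hp(1) pos(2)])
      show "k \<in> borel_measurable borel"
        unfolding k_def by (intro borel_measurable_continuous_onI continuous_on_heat_kernel continuous_intros z)
      show "norm (k (x, y)) \<le> A" for x y
        unfolding k_def A_def using z by (intro norm_heat_kernel_le) auto
      show "norm (LBINT x. h x * (LBINT y. k (x, y) * g y))
         \<le> ((LBINT x. (norm (g x))\<^sup>2) + (LBINT x. (norm (h x))\<^sup>2)) / 2"
        if "integrable lborel g" "\<And>x. norm (g x) \<le> B" "integrable lborel h" "\<And>x. norm (h x) \<le> B'" for g h B B'
        unfolding k_def using norm_heat_kernel_bilinear_L2[OF z(1) that] by simp
    qed
    have 2: "A powr (2 / p - 1) \<le> \<bar>Im z\<bar> powr - (2 - 2 / p)"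
    proof -
      define s where "s = 2 * sqrt pi * sqrt (norm z)"
      have s: "s > 0" using nz by (simp add: s_def)
      have "A = s powr (- n)" using s by (simp add: A_def s_def n_def powr_minus_divide powr_realpow)
      then have "A powr (2 / p - 1) = (s\<^sup>2) powr - (n / (n + 2))"
        using s by (simp add: \<alpha> powr_powr powr_numeral[symmetric] del: powr_numeral) (simp add: mult.commute)
      also have "s\<^sup>2 = 4 * pi * norm z" using nz by (simp add: s_def power_mult_distrib)
      also have "(4 * pi * norm z) powr - (n / (n + 2)) \<le> \<bar>Im z\<bar> powr - (n / (n + 2))"
      proof (rule powr_mono2')
        have "1 * \<bar>Im z\<bar> \<le> 4 * pi * norm z"
          using pi_ge_two abs_Im_le_cmod[of z] by (intro mult_mono) auto
        then show "\<bar>Im z\<bar> \<le> 4 * pi * norm z" by simp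
      qed (use n z in auto)
      finally show ?thesis by (simp add: \<alpha>)
    qed
    have "norm (LBINT x. h x * (LBINT y. k (x, y) * g y))
      \<le> (3 / (2 * p) + 1 / (2 * (2 - p))) * \<bar>Im z\<bar> powr - (2 - 2 / p) * Gp powr (1 / p) * Hp powr (1 / p)"
      using p12 by (intro order_trans[OF 1] mult_right_mono mult_left_mono 2) auto
    then show ?thesis by (simp add: k_def)
  qed
qed

section \<open>Integrability and Gram kernel of the damped propagator\<close>

lemma exp_integral_half_line:
  fixes c m :: real
  assumes c: "c > 0"
  shows "integrable lborel (\<lambda>s. indicator {..m} s * exp (- c * (m - s)))"
    and "(LBINT s. indicator {..m} s * exp (- c * (m - s))) = 1 / c"
proof -
  define f where "f = (\<lambda>t::real. indicator {0..} t * exp (- c * t))"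
  have "(\<integral>\<^sup>+t. ennreal (exp (- c * t)) * indicator {0..} t \<partial>lborel) = ennreal (0 - (- exp (- c * 0) / c))"
  proof (rule nn_integral_FTC_atLeast)
    show "((\<lambda>t. - exp (- c * t) / c) has_real_derivative exp (- c * t)) (at t)" for t
      using c by (auto intro!: derivative_eq_intros)
    show "((\<lambda>t. - exp (- c * t) / c) \<longlongrightarrow> 0) at_top" using c by real_asymp
  qed auto
  then have "(\<integral>\<^sup>+t. ennreal (f t) \<partial>lborel) = ennreal (1 / c)"
    by (simp add: f_def ennreal_mult' ennreal_indicator mult.commute)
  then have "has_bochner_integral lborel f (1 / c)"
    using c by (intro has_bochner_integral_nn_integral) (auto simp: f_def)
  then have f: "integrable lborel f" "integral\<^sup>L lborel f = 1 / c" by (auto simp: has_bochner_integral_iff)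
  have eq: "(\<lambda>s. indicator {..m} s * exp (- c * (m - s))) = (\<lambda>s. f (m - s))"
    by (auto simp: f_def fun_eq_iff indicator_def)
  show "integrable lborel (\<lambda>s. indicator {..m} s * exp (- c * (m - s)))"
    unfolding eq by (rule integrable_lborel_reflect[OF f(1)])
  show "(LBINT s. indicator {..m} s * exp (- c * (m - s))) = 1 / c"
    unfolding eq using integral_lborel_reflect[of f m] f by simp
qed

lemma borel_measurable_damped_kernel:
  assumes "\<epsilon> > 0"
  shows "damped_kernel \<epsilon> \<delta> \<in> borel_measurable (borel :: (('a::euclidean_space \<times> real) \<times> ('a \<times> real)) measure)"
proof -
  define k where "k = (\<lambda>p::('a \<times> real) \<times> ('a \<times> real). complex_of_real (exp (- \<delta> * (snd (fst p) - snd (snd p))))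
     * heat_kernel (of_real \<epsilon> - \<i> * of_real (snd (fst p) - snd (snd p))) (fst (fst p) - fst (snd p)))"
  have [measurable]: "k \<in> borel_measurable borel"
    unfolding k_def using assms
    by (intro borel_measurable_continuous_onI continuous_intros continuous_on_heat_kernel) auto
  have [measurable]: "(\<lambda>p::('a \<times> real) \<times> ('a \<times> real). snd (fst p)) \<in> borel_measurable borel"
    "(\<lambda>p::('a \<times> real) \<times> ('a \<times> real). snd (snd p)) \<in> borel_measurable borel"
    by (intro borel_measurable_continuous_onI continuous_intros)+
  have "damped_kernel \<epsilon> \<delta> = (\<lambda>p. if snd (snd p) \<le> snd (fst p) then k p else 0)"
    by (auto simp: fun_eq_iff damped_kernel_def k_def)
  then show ?thesis by simp
qed

lemma norm_damped_kernel_le: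
  fixes z w :: "'a::euclidean_space \<times> real"
  assumes "\<epsilon> > 0" "\<delta> > 0"
  shows "norm (damped_kernel \<epsilon> \<delta> (z, w)) \<le> 1 / (2 * sqrt pi * sqrt \<epsilon>) ^ DIM('a)"
proof (cases "snd w \<le> snd z")
  case True
  then show ?thesis
    using norm_damped_heat_kernel_le[OF assms, of "snd z - snd w" "fst z - fst w"]
    by (simp add: damped_kernel_def case_prod_unfold)
qed (use assms in \<open>simp add: damped_kernel_def case_prod_unfold\<close>)

text \<open>The spatial L^1 norm grows only polynomially in the elapsed time, measured in units of
  \<epsilon>. Half of the damping absorbs this growth and the other half is integrated. The constant
  degenerates as \<epsilon> tends to 0, so it is used only to justify Fubini's theorem.\<close>

lemma damped_kernel_L1:
  assumes \<epsilon>: "\<epsilon> > 0" and \<delta>: "\<delta> > 0"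
  shows "\<exists>c. \<forall>z::'a::euclidean_space \<times> real. integrable lborel (\<lambda>w. damped_kernel \<epsilon> \<delta> (z, w))
    \<and> (LBINT w. norm (damped_kernel \<epsilon> \<delta> (z, w))) \<le> c"
proof -
  obtain M where M: "M > 0" "\<And>u. u \<ge> 0 \<Longrightarrow> (1 + u) ^ DIM('a) * exp (- (\<delta> * \<epsilon> / 2) * u) \<le> M"
    using power_times_exp_bounded[of "\<delta> * \<epsilon> / 2" "DIM('a)"] \<epsilon> \<delta> by auto
  have "integrable lborel (\<lambda>w. damped_kernel \<epsilon> \<delta> (z, w)) \<and> (LBINT w. norm (damped_kernel \<epsilon> \<delta> (z, w))) \<le> M * (1 / (\<delta> / 2))"
    for z :: "'a \<times> real"
  proof -
    obtain x t where z: "z = (x, t)" by (cases z)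
    define \<zeta> where "\<zeta> = (\<lambda>s. complex_of_real \<epsilon> - \<i> * of_real (t - s))"
    have Re\<zeta>: "Re (\<zeta> s) = \<epsilon>" for s by (simp add: \<zeta>_def)
    define f where "f = (\<lambda>(s, y). damped_kernel \<epsilon> \<delta> ((x, t), (y, s)))"
    have "(\<lambda>p::real \<times> 'a. damped_kernel \<epsilon> \<delta> ((x, t), (snd p, fst p))) \<in> borel_measurable borel"
      by (rule measurable_compose[OF _ borel_measurable_damped_kernel[OF \<epsilon>]])
        (intro borel_measurable_continuous_onI continuous_intros)
    then have mf: "f \<in> borel_measurable (lborel \<Otimes>\<^sub>M lborel)"
      by (simp add: f_def case_prod_unfold lborel_prod)
    have hk_m: "heat_kernel z \<in> borel_measurable (borel :: 'a measure)" if "Re z > 0" for z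
      using borel_measurable_integrable[OF heat_kernel_integral(1)[OF that, where 'a='a]] by simp
    have hki: "integrable lborel (\<lambda>y. heat_kernel (\<zeta> s) (x - y))" for s
      by (rule integrable_lborel_reflect[OF heat_kernel_integral(1)]) (simp add: Re\<zeta> \<epsilon>)
    have hkn: "(LBINT y. norm (heat_kernel (\<zeta> s) (x - y))) = sqrt (norm (\<zeta> s) / \<epsilon>) ^ DIM('a)" for s
      using integral_lborel_reflect[of "\<lambda>y. norm (heat_kernel (\<zeta> s) y)" x] hk_m[of "\<zeta> s"] \<epsilon>
        integral_norm_heat_kernel[of "\<zeta> s", where 'a='a] by (simp add: Re\<zeta>)
    have nf: "(LBINT y. norm (f (s, y))) = indicator {..t} s * (exp (- \<delta> * (t - s)) * sqrt (norm (\<zeta> s) / \<epsilon>) ^ DIM('a))" for s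
      using hkn[of s] by (cases "s \<le> t") (auto simp: f_def damped_kernel_def norm_mult \<zeta>_def)
    have nf_le: "(LBINT y. norm (f (s, y))) \<le> M * (indicator {..t} s * exp (- (\<delta> / 2) * (t - s)))" for s
    proof (cases "s \<le> t")
      case True
      define u where "u = (t - s) / \<epsilon>"
      have u: "u \<ge> 0" "t - s = \<epsilon> * u" using True \<epsilon> by (auto simp: u_def)
      have "norm (\<zeta> s) \<le> \<epsilon> + (t - s)"
        unfolding \<zeta>_def using True \<epsilon> by (intro order_trans[OF norm_triangle_ineq4]) (simp add: norm_mult flip: of_real_diff)
      then have "norm (\<zeta> s) / \<epsilon> \<le> 1 + u" using \<epsilon> by (simp add: u_def field_simps)
      \<comment> \<open>Crude, but it removes the square root and leaves the integer power
        \<open>(1 + u) ^ DIM('a)\<close>.\<close>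
      also have "\<dots> \<le> (1 + u)\<^sup>2" using u by (intro self_le_power) auto
      finally have "sqrt (norm (\<zeta> s) / \<epsilon>) \<le> 1 + u" using u by (intro real_le_lsqrt) auto
      then have "sqrt (norm (\<zeta> s) / \<epsilon>) ^ DIM('a) \<le> (1 + u) ^ DIM('a)"
        using \<epsilon> by (intro power_mono) auto
      then have "exp (- \<delta> * (t - s)) * sqrt (norm (\<zeta> s) / \<epsilon>) ^ DIM('a) \<le> exp (- \<delta> * (t - s)) * (1 + u) ^ DIM('a)"
        by (intro mult_left_mono) auto
      also have "\<dots> = exp (- (\<delta> / 2) * (t - s)) * ((1 + u) ^ DIM('a) * exp (- (\<delta> * \<epsilon> / 2) * u))"
        by (simp add: u(2) mult_exp_exp[symmetric] mult_ac) (simp flip: exp_add)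
      also have "\<dots> \<le> exp (- (\<delta> / 2) * (t - s)) * M"
        using M(2)[OF u(1)] by (intro mult_left_mono) auto
      finally show ?thesis using True unfolding nf by (simp add: mult.commute)
    qed (simp add: nf)
    note ei = exp_integral_half_line[of "\<delta> / 2" t]
    have ib: "integrable lborel (\<lambda>s. M * (indicator {..t} s * exp (- (\<delta> / 2) * (t - s))))"
      using ei(1) \<delta> by (intro integrable_mult_right) simp
    have inf: "integrable lborel (\<lambda>s. LBINT y. norm (f (s, y)))"
    proof (rule Bochner_Integration.integrable_bound[OF ib])
      show "(\<lambda>s. LBINT y. norm (f (s, y))) \<in> borel_measurable lborel"
        using mf by measurable
      show "AE s in lborel. norm (LBINT y. norm (f (s, y))) \<le> norm (M * (indicator {..t} s * exp (- (\<delta> / 2) * (t - s))))"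
        using nf_le by (intro always_eventually allI) (simp add: order_trans[OF _ abs_ge_self])
    qed
    have if1: "integrable lborel (\<lambda>y. f (s, y))" for s
      using hki[of s] by (cases "s \<le> t") (auto simp: f_def damped_kernel_def \<zeta>_def)
    have iff: "integrable (lborel \<Otimes>\<^sub>M lborel) f"
      using mf inf if1 by (intro lborel_pair.Fubini_integrable) auto
    have sw: "(\<lambda>(y, s). f (s, y)) = (\<lambda>w. damped_kernel \<epsilon> \<delta> (z, w))"
      by (auto simp: f_def z)
    have i: "integrable lborel (\<lambda>w. damped_kernel \<epsilon> \<delta> (z, w))"
      using lborel_pair.integrable_product_swap[OF iff] unfolding sw by (simp add: lborel_prod)
    have "(LBINT w. norm (damped_kernel \<epsilon> \<delta> (z, w))) = (\<integral>(y, s). norm (f (s, y)) \<partial>(lborel \<Otimes>\<^sub>M lborel))"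
      unfolding lborel_prod by (simp add: f_def z case_prod_unfold)
    also have "\<dots> = (\<integral>p. norm (f p) \<partial>(lborel \<Otimes>\<^sub>M lborel))"
      using lborel_pair.integral_product_swap[of "\<lambda>p. norm (f p)"] mf by (simp add: case_prod_unfold)
    also have "\<dots> = (LBINT s. (LBINT y. norm (f (s, y))))"
      using lborel_pair.integral_fst'[of "\<lambda>p. norm (f p)"] iff by simp
    also have "\<dots> \<le> (LBINT s. M * (indicator {..t} s * exp (- (\<delta> / 2) * (t - s))))"
      by (intro integral_mono inf ib nf_le)
    also have "\<dots> = M * (1 / (\<delta> / 2))"
      using ei(2) \<delta> by (simp only: integral_mult_right_zero)
    finally show ?thesis using i by simp
  qed
  then show ?thesis by blast
qed

text \<open>At each \<open>s\<close> the space integral is given by the semigroup law, and the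
  resulting complex time \<open>2 \<epsilon> - i (t - t')\<close> does not contain \<open>s\<close>.
  The time integral therefore sees only the damping and yields
  \<open>exp (- \<delta> * \<bar>t - t'\<bar>) / (2 * \<delta>)\<close>.\<close>

lemma damped_kernel_TT_star:
  fixes x x' :: "'a::euclidean_space"
  assumes \<epsilon>: "\<epsilon> > 0" and \<delta>: "\<delta> > 0"
  shows "(LBINT w. damped_kernel \<epsilon> \<delta> ((x, t), w) * cnj (damped_kernel \<epsilon> \<delta> ((x', t'), w)))
    = of_real (exp (- \<delta> * \<bar>t - t'\<bar>) / (2 * \<delta>)) * heat_kernel (of_real (2 * \<epsilon>) - \<i> * of_real (t - t')) (x - x')"
proof -
  define m where "m = min t t'"
  define K where "K = heat_kernel (of_real (2 * \<epsilon>) - \<i> * of_real (t - t')) (x - x')"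
  define f where "f = (\<lambda>(y, s). damped_kernel \<epsilon> \<delta> ((x, t), (y, s)) * cnj (damped_kernel \<epsilon> \<delta> ((x', t'), (y, s))))"
  have iP: "integrable lborel (\<lambda>w. damped_kernel \<epsilon> \<delta> (z, w))" for z :: "'a \<times> real"
    using damped_kernel_L1[OF \<epsilon> \<delta>, where 'a='a] by blast
  have iprod: "integrable lborel f"
  proof (rule Bochner_Integration.integrable_bound)
    show "integrable lborel (\<lambda>w. (1 / (2 * sqrt pi * sqrt \<epsilon>) ^ DIM('a)) *\<^sub>R damped_kernel \<epsilon> \<delta> ((x, t), w))"
      by (intro integrable_scaleR_right iP)
    have "(\<lambda>w. damped_kernel \<epsilon> \<delta> ((x, t), w) * cnj (damped_kernel \<epsilon> \<delta> ((x', t'), w))) \<in> borel_measurable lborel"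
      using iP by measurable
    then show "f \<in> borel_measurable lborel" by (simp add: f_def case_prod_unfold)
    have "norm (f w) \<le> norm ((1 / (2 * sqrt pi * sqrt \<epsilon>) ^ DIM('a)) *\<^sub>R damped_kernel \<epsilon> \<delta> ((x, t), w))" for w
    proof -
      have "norm (damped_kernel \<epsilon> \<delta> ((x', t'), w)) * norm (damped_kernel \<epsilon> \<delta> ((x, t), w))
         \<le> (1 / (2 * sqrt pi * sqrt \<epsilon>) ^ DIM('a)) * norm (damped_kernel \<epsilon> \<delta> ((x, t), w))"
        by (intro mult_right_mono norm_damped_kernel_le \<epsilon> \<delta>) auto
      then show ?thesis using \<epsilon> by (simp add: f_def case_prod_unfold norm_mult mult.commute norm_divide norm_power)
    qed
    then show "AE w in lborel. norm (f w) \<le> norm ((1 / (2 * sqrt pi * sqrt \<epsilon>) ^ DIM('a)) *\<^sub>R damped_kernel \<epsilon> \<delta> ((x, t), w))"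
      by simp
  qed
  have inner: "(LBINT y. f (y, s)) = of_real (exp (- \<delta> * \<bar>t - t'\<bar>) * (indicator {..m} s * exp (- (2 * \<delta>) * (m - s)))) * K" for s
  proof (cases "s \<le> m")
    case False
    then show ?thesis by (auto simp: f_def damped_kernel_def m_def)
  next
    case True
    then have st: "s \<le> t" "s \<le> t'" by (auto simp: m_def)
    define z where "z = complex_of_real \<epsilon> - \<i> * of_real (t - s)"
    define z' where "z' = complex_of_real \<epsilon> - \<i> * of_real (t' - s)"
    have Re: "Re z > 0" "Re z' > 0" "Re (cnj z') > 0" using \<epsilon> by (auto simp: z_def z'_def)
    have "f (y, s) = of_real (exp (- \<delta> * (t - s)) * exp (- \<delta> * (t' - s))) * (heat_kernel z (x - y) * heat_kernel (cnj z') (x' - y))" for y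
      using st by (simp add: f_def damped_kernel_def z_def[symmetric] z'_def[symmetric] cnj_heat_kernel[OF Re(2)] del: of_real_diff)
    then have "(LBINT y. f (y, s)) = of_real (exp (- \<delta> * (t - s)) * exp (- \<delta> * (t' - s))) * heat_kernel (z + cnj z') (x - x')"
      by (simp only: integral_mult_right_zero heat_kernel_convolution[OF Re(1) Re(3)])
    also have "z + cnj z' = of_real (2 * \<epsilon>) - \<i> * of_real (t - t')"
      by (simp add: z_def z'_def algebra_simps)
    also have "exp (- \<delta> * (t - s)) * exp (- \<delta> * (t' - s)) = exp (- \<delta> * \<bar>t - t'\<bar>) * exp (- (2 * \<delta>) * (m - s))"
      by (auto simp: m_def min_def abs_if algebra_simps simp flip: exp_add)
    finally show ?thesis using True by (simp add: K_def)
  qed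
  have "(LBINT w. f w) = (LBINT s. (LBINT y. f (y, s)))"
    using lborel_pair.integral_snd[of "\<lambda>y s. f (y, s)"] iprod by (simp add: case_prod_eta lborel_prod)
  also have "\<dots> = (LBINT s. of_real (exp (- \<delta> * \<bar>t - t'\<bar>) * (indicator {..m} s * exp (- (2 * \<delta>) * (m - s))))) * K"
    unfolding inner by (rule integral_mult_left_zero)
  also have "(LBINT s. complex_of_real (exp (- \<delta> * \<bar>t - t'\<bar>) * (indicator {..m} s * exp (- (2 * \<delta>) * (m - s)))))
      = of_real (exp (- \<delta> * \<bar>t - t'\<bar>) / (2 * \<delta>))"
    using exp_integral_half_line(2)[of "2 * \<delta>" m] \<delta>
    by (simp only: integral_complex_of_real integral_mult_right_zero) simp
  finally show ?thesis by (simp add: f_def K_def case_prod_unfold)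
qed

text \<open>Brings both time variables outside, so that the dispersive estimate can be applied at
  fixed times. The product majorant makes every intermediate exchange legitimate.\<close>

lemma integral_space_time_reorder:
  fixes F :: "('a::euclidean_space \<times> real) \<times> ('a \<times> real) \<Rightarrow> complex"
  assumes mF: "F \<in> borel_measurable borel"
    and a: "integrable lborel a" "\<And>x. 0 \<le> a x" and b: "integrable lborel b" "\<And>t. 0 \<le> b t" and B: "B \<ge> 0"
    and bound: "\<And>x t x' t'. norm (F ((x, t), (x', t'))) \<le> B * (a x * b t) * (a x' * b t')"
  shows "(LBINT p. F p) = (LBINT t. (LBINT t'. (LBINT x. (LBINT x'. F ((x, t), (x', t'))))))"
proof -
  have [measurable]: "a \<in> borel_measurable borel" "b \<in> borel_measurable borel" using a b by auto
  have mF': "(\<lambda>q. F (f q)) \<in> borel_measurable borel" if "continuous_on UNIV f" for f :: "'z::second_countable_topology \<Rightarrow> _"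
    by (rule measurable_compose[OF borel_measurable_continuous_onI[OF that] mF])
  have iW: "integrable lborel (\<lambda>(x, t). a x * b t)"
  proof -
    have "(\<lambda>(x, t). a x * b t) \<in> borel_measurable (borel \<Otimes>\<^sub>M borel)" by measurable
    then have "integrable (lborel \<Otimes>\<^sub>M lborel) (\<lambda>(x, t). a x * b t)"
      using a b by (intro integrable_lborel_pair_bound[where g=a and h=b]) (auto simp: borel_prod abs_mult)
    then show ?thesis by (simp add: lborel_prod)
  qed
  have iF: "integrable (lborel \<Otimes>\<^sub>M lborel) F"
  proof (rule integrable_lborel_pair_bound[OF mF])
    show "integrable lborel (\<lambda>z. B * (case z of (x, t) \<Rightarrow> a x * b t))" using iW by (rule integrable_mult_right)
    show "norm (F (z, z')) \<le> (B * (case z of (x, t) \<Rightarrow> a x * b t)) * (case z' of (x, t) \<Rightarrow> a x * b t)" for z z'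
      using bound by (cases z, cases z') auto
  qed (rule iW)
  define \<phi> where "\<phi> = (\<lambda>z. LBINT z'. F (z, z'))"
  have i\<phi>: "integrable lborel \<phi>" unfolding \<phi>_def by (rule lborel_pair.integrable_fst'[OF iF])
  have slice: "\<phi> (x, t) = (LBINT t'. (LBINT x'. F ((x, t), (x', t'))))" for x t
  proof -
    have "integrable (lborel \<Otimes>\<^sub>M lborel) (\<lambda>z'. F ((x, t), z'))"
    proof (rule integrable_lborel_pair_bound[where g="\<lambda>x'. B * (a x * b t) * a x'" and h=b])
      show "(\<lambda>z'. F ((x, t), z')) \<in> borel_measurable borel" by (intro mF' continuous_intros)
      show "norm (F ((x, t), (x', t'))) \<le> B * (a x * b t) * a x' * b t'" for x' t'
        using bound[of x t x' t'] by (simp add: mult.assoc)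
    qed (use a b in auto)
    moreover have "(\<lambda>z'. F ((x, t), z')) = (\<lambda>(x', t'). F ((x, t), (x', t')))" by auto
    ultimately show ?thesis
      unfolding \<phi>_def using lborel_pair.integral_snd[of "\<lambda>x' t'. F ((x, t), (x', t'))"]
      by (simp only: lborel_prod)
  qed
  define \<psi> where "\<psi> = (\<lambda>t (x, t'). LBINT x'. F ((x, t), (x', t')))"
  have i\<psi>: "integrable (lborel \<Otimes>\<^sub>M lborel) (\<psi> t)" for t
  proof (rule integrable_lborel_pair_bound[where g="\<lambda>x. B * (a x * b t) * integral\<^sup>L lborel a" and h=b])
    have "(\<lambda>q. F ((fst (fst q), t), (snd q, snd (fst q)))) \<in> borel_measurable borel"
      by (intro mF' continuous_intros)
    then have "(\<lambda>(p, x'). F ((fst p, t), (x', snd p))) \<in> borel_measurable (lborel \<Otimes>\<^sub>M lborel)"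
      by (simp add: lborel_prod case_prod_unfold)
    then have "(\<lambda>p. LBINT x'. F ((fst p, t), (x', snd p))) \<in> borel_measurable lborel"
      by (rule lborel.borel_measurable_lebesgue_integral)
    then show "\<psi> t \<in> borel_measurable borel" by (simp add: \<psi>_def case_prod_unfold)
    show "integrable lborel (\<lambda>x. B * (a x * b t) * integral\<^sup>L lborel a)" using a by auto
    show "norm (\<psi> t (x, t')) \<le> B * (a x * b t) * integral\<^sup>L lborel a * b t'" for x t'
    proof -
      have ib: "integrable lborel (\<lambda>x'. B * (a x * b t) * (a x' * b t'))" using a by auto
      have ix: "integrable lborel (\<lambda>x'. F ((x, t), (x', t')))"
      proof (rule Bochner_Integration.integrable_bound[OF ib])
        show "(\<lambda>x'. F ((x, t), (x', t'))) \<in> borel_measurable lborel"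
          using mF'[of "\<lambda>x'. ((x, t), (x', t'))"] by (simp add: continuous_intros)
        show "AE x' in lborel. norm (F ((x, t), (x', t'))) \<le> norm (B * (a x * b t) * (a x' * b t'))"
          unfolding real_norm_def by (intro always_eventually allI order_trans[OF bound abs_ge_self])
      qed
      have "norm (\<psi> t (x, t')) \<le> (LBINT x'. norm (F ((x, t), (x', t'))))"
        unfolding \<psi>_def prod.case by (rule integral_norm_bound)
      also have "\<dots> \<le> (LBINT x'. B * (a x * b t) * (a x' * b t'))"
        using ib ix by (intro integral_mono bound) auto
      also have "\<dots> = B * (a x * b t) * integral\<^sup>L lborel a * b t'" by simp
      finally show ?thesis .
    qed
  qed (rule b)
  have "(LBINT p. F p) = (LBINT z. \<phi> z)"
    using lborel_pair.integral_fst'[OF iF] by (simp add: \<phi>_def lborel_prod)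
  also have "\<dots> = (LBINT t. (LBINT x. \<phi> (x, t)))"
    using lborel_pair.integral_snd[of "\<lambda>x t. \<phi> (x, t)"] i\<phi> by (simp add: case_prod_eta lborel_prod)
  also have "\<dots> = (LBINT t. (LBINT x. (LBINT t'. \<psi> t (x, t'))))"
    by (simp add: slice \<psi>_def)
  also have "\<dots> = (LBINT t. (LBINT t'. (LBINT x. \<psi> t (x, t'))))"
    using lborel_pair.Fubini_integral[of "\<lambda>x t'. \<psi> _ (x, t')"] i\<psi> by (simp add: case_prod_eta)
  finally show ?thesis by (simp add: \<psi>_def)
qed

text \<open>The test function \<open>|v|^(q-2) cnj v\<close> need not be smooth, hence need not be
  Schwartz. This larger class contains it together with \<open>v\<close> and
  \<open>schrod_op v\<close>, and its members are still bounded and integrable, also on each time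
  slice.\<close>

definition rapid :: "('a::euclidean_space \<times> real \<Rightarrow> complex) \<Rightarrow> bool" where
  "rapid f \<longleftrightarrow> continuous_on UNIV f \<and> (\<exists>M\<ge>0. \<forall>x t. norm (f (x, t)) \<le> M * (decay_weight x * (1 / (1 + t\<^sup>2))))"

lemma decay_weight_le_1: "decay_weight x \<le> 1"
  unfolding decay_weight_def by (rule prod_le_1) (auto simp: add_pos_nonneg)

lemma rapid_measurable: "rapid f \<Longrightarrow> f \<in> borel_measurable borel"
  by (auto simp: rapid_def intro: borel_measurable_continuous_onI)

lemma rapid_bounded:
  assumes "rapid f"
  shows "\<exists>B\<ge>0. \<forall>z. norm (f z) \<le> B"
proof -
  obtain M where M: "M \<ge> 0" "\<And>x t. norm (f (x, t)) \<le> M * (decay_weight x * (1 / (1 + t\<^sup>2)))"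
    using assms unfolding rapid_def by blast
  have "norm (f (x, t)) \<le> M" for x t
  proof -
    have "1 / (1 + t\<^sup>2) \<le> 1" by (simp add: divide_le_eq add_pos_nonneg)
    then have "decay_weight x * (1 / (1 + t\<^sup>2)) \<le> 1 * 1"
      by (intro mult_mono decay_weight_le_1) (auto simp: decay_weight_pos less_imp_le)
    then show ?thesis using M(2)[of x t] mult_left_mono[OF _ M(1), of _ 1] by fastforce
  qed
  then have "norm (f z) \<le> M" for z by (cases z) auto
  with M(1) show ?thesis by blast
qed

lemma rapid_integrable:
  assumes "rapid f"
  shows "integrable lborel f" "integrable lborel (\<lambda>x. f (x, t))"
proof -
  obtain M where M: "M \<ge> 0" "\<And>x t. norm (f (x, t)) \<le> M * (decay_weight x * (1 / (1 + t\<^sup>2)))"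
    using assms unfolding rapid_def by blast
  have "integrable (lborel \<Otimes>\<^sub>M lborel) f"
  proof (rule integrable_lborel_pair_bound[OF rapid_measurable[OF assms]])
    show "integrable lborel (\<lambda>x::'a. M * decay_weight x)" by (intro integrable_mult_right integrable_decay_weight)
    show "norm (f (x, t)) \<le> M * decay_weight x * (1 / (1 + t\<^sup>2))" for x t
      using M(2)[of x t] by (simp only: mult.assoc)
  qed (rule integrable_inverse_1_plus_square)
  then show "integrable lborel f" by (simp add: lborel_prod)
  show "integrable lborel (\<lambda>x. f (x, t))"
  proof (rule Bochner_Integration.integrable_bound)
    show "integrable lborel (\<lambda>x::'a. M * (1 / (1 + t\<^sup>2)) * decay_weight x)"
      by (intro integrable_mult_right integrable_decay_weight)
    have "continuous_on UNIV (\<lambda>x. f (x, t))"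
    proof (rule continuous_on_compose2[of UNIV f UNIV "\<lambda>x. (x, t)"])
      show "continuous_on UNIV f" using assms by (simp add: rapid_def)
    qed (auto intro: continuous_intros)
    then show "(\<lambda>x. f (x, t)) \<in> borel_measurable lborel" by (simp add: borel_measurable_continuous_onI)
    show "AE x in lborel. norm (f (x, t)) \<le> norm (M * (1 / (1 + t\<^sup>2)) * decay_weight x)"
      unfolding real_norm_def
      by (intro always_eventually allI order_trans[OF M(2) order_trans[OF _ abs_ge_self]]) simp
  qed
qed

lemma integrable_bounded_powr:
  fixes g :: "'a::euclidean_space \<Rightarrow> complex"
  assumes g: "integrable lborel g" and b: "\<And>x. norm (g x) \<le> B" and p: "1 \<le> p"
  shows "integrable lborel (\<lambda>x. norm (g x) powr p)"
proof (rule Bochner_Integration.integrable_bound)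
  have [measurable]: "g \<in> borel_measurable borel" using g by auto
  show "integrable lborel (\<lambda>x. B powr (p - 1) * norm (g x))" using g by auto
  show "(\<lambda>x. norm (g x) powr p) \<in> borel_measurable lborel" by measurable
  have "norm (g x) powr p \<le> B powr (p - 1) * norm (g x)" for x
  proof (cases "g x = 0")
    case False
    have "norm (g x) powr p = norm (g x) powr (p - 1) * norm (g x) powr 1"
      using False by (simp add: powr_diff)
    also have "\<dots> \<le> B powr (p - 1) * norm (g x)"
      using b[of x] p False by (simp add: powr_mono2 mult_right_mono)
    finally show ?thesis .
  qed simp
  then show "AE x in lborel. norm (norm (g x) powr p) \<le> norm (B powr (p - 1) * norm (g x))"
    by (intro always_eventually allI) (simp add: order_trans[OF _ abs_ge_self])
qed

text \<open>The bilinear interpolation constant times half of the Hardy-Littlewood-Sobolev constant;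
  the missing 2 cancels against the \<open>1 / (2 * \<delta>)\<close> of the Gram kernel.\<close>

definition dual_const :: "real \<Rightarrow> real" where
  "dual_const p = (3 / (2 * p) + 1 / (2 * (2 - p))) * (2 / (2 / p - 1) + 3)"

text \<open>\<open>S\<close> is the transpose of R applied to \<open>g\<close>, without conjugation,
  which suits a bilinear pairing. Its squared norm is a quadratic form in the Gram kernel: the
  dispersive estimate bounds the form at fixed times by spatial L^p norms, and
  Hardy-Littlewood-Sobolev handles what remains in time. The bound contains no \<epsilon>.\<close>

theorem damped_dual_estimate:
  fixes g :: "'a::euclidean_space \<times> real \<Rightarrow> complex"
  assumes \<epsilon>: "\<epsilon> > 0" and \<delta>: "\<delta> > 0" and g: "rapid g"
    and p: "p = 2 * (real DIM('a) + 2) / (real DIM('a) + 4)"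
    and N: "N = (LBINT z. norm (g z) powr p)" "N > 0"
  defines "S \<equiv> \<lambda>w. LBINT z. damped_kernel \<epsilon> \<delta> (z, w) * g z"
  shows "integrable lborel (\<lambda>w. (norm (S w))\<^sup>2)"
    and "(LBINT w. (norm (S w))\<^sup>2) \<le> dual_const p / \<delta> * N powr (2 / p)"
proof -
  define n where "n = real DIM('a)"
  have n: "n \<ge> 1" using DIM_positive[where 'a='a] unfolding n_def by linarith
  have p_eq: "p = 2 * (n + 2) / (n + 4)" using p by (simp add: n_def)
  have p12: "1 < p" "p < 2" using n by (auto simp: p_eq field_simps)
  obtain B where B: "B \<ge> 0" "\<And>z. norm (g z) \<le> B" using rapid_bounded[OF g] by blast
  obtain M where M: "M \<ge> 0" "\<And>x t. norm (g (x, t)) \<le> M * (decay_weight x * (1 / (1 + t\<^sup>2)))"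
    using g unfolding rapid_def by blast
  have cg: "continuous_on UNIV g" using g by (simp add: rapid_def)
  note mg = rapid_measurable[OF g]
  obtain c1 where c1: "\<And>z::'a \<times> real. integrable lborel (\<lambda>w. damped_kernel \<epsilon> \<delta> (z, w))"
     "\<And>z::'a \<times> real. (LBINT w. norm (damped_kernel \<epsilon> \<delta> (z, w))) \<le> c1"
    using damped_kernel_L1[OF \<epsilon> \<delta>, where 'a='a] by blast
  define P where "P = (\<lambda>q::('a \<times> real) \<times> ('a \<times> real). damped_kernel \<epsilon> \<delta> (snd q, fst q))"
  have mP: "P \<in> borel_measurable borel"
    unfolding P_def
    by (rule measurable_compose[OF _ borel_measurable_damped_kernel[OF \<epsilon>]])
      (intro borel_measurable_continuous_onI continuous_intros)
  have bP: "norm (P (w, z)) \<le> 1 / (2 * sqrt pi * sqrt \<epsilon>) ^ DIM('a)" for w z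
    unfolding P_def fst_conv snd_conv by (rule norm_damped_kernel_le[OF \<epsilon> \<delta>])
  have iP: "integrable lborel (\<lambda>w. P (w, z))" "(LBINT w. norm (P (w, z))) \<le> c1" for z
    using c1 by (simp_all add: P_def)
  note sq = square_integral_kernel[OF mP bP iP rapid_integrable(1)[OF g]]
  have S_eq: "S = (\<lambda>w. LBINT z. P (w, z) * g z)" by (simp add: S_def P_def)
  show "integrable lborel (\<lambda>w. (norm (S w))\<^sup>2)" unfolding S_eq by (rule sq)
  define Q where "Q = (\<lambda>q::('a \<times> real) \<times> ('a \<times> real). of_real (exp (- \<delta> * \<bar>snd (fst q) - snd (snd q)\<bar>) / (2 * \<delta>)) *
      heat_kernel (of_real (2 * \<epsilon>) - \<i> * of_real (snd (fst q) - snd (snd q))) (fst (fst q) - fst (snd q)))"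
  define F where "F = (\<lambda>q. g (fst q) * cnj (g (snd q)) * Q q)"
  have inner: "(LBINT w. P (w, fst q) * cnj (P (w, snd q))) = Q q" for q
    using damped_kernel_TT_star[OF \<epsilon> \<delta>, of "fst (fst q)" "snd (fst q)" "fst (snd q)" "snd (snd q)"]
    by (simp add: P_def Q_def)
  have sqF: "of_real (LBINT w. (norm (S w))\<^sup>2) = (LBINT q. F q)"
    using sq(3) unfolding S_eq F_def inner .
  have cF: "continuous_on UNIV F"
    unfolding F_def Q_def using \<epsilon> \<delta>
    by (intro continuous_intros continuous_on_heat_kernel continuous_on_compose2[OF cg]) auto
  define A where "A = 1 / (2 * sqrt pi * sqrt (2 * \<epsilon>)) ^ DIM('a)"
  have A: "A \<ge> 0" using \<epsilon> by (simp add: A_def)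
  have nQ: "norm (Q q) \<le> 1 / (2 * \<delta>) * A" for q
  proof -
    let ?z = "complex_of_real (2 * \<epsilon>) - \<i> * of_real (snd (fst q) - snd (snd q))"
    have "norm (heat_kernel ?z (fst (fst q) - fst (snd q))) \<le> A"
    proof -
      have "2 * \<epsilon> \<le> norm ?z" using complex_Re_le_cmod[of ?z] by simp
      then have "1 / (2 * sqrt pi * sqrt (norm ?z)) ^ DIM('a) \<le> A"
        unfolding A_def using \<epsilon> by (intro divide_left_mono power_mono mult_left_mono mult_pos_pos zero_less_power) auto
      moreover have "norm (heat_kernel ?z (fst (fst q) - fst (snd q))) \<le> 1 / (2 * sqrt pi * sqrt (norm ?z)) ^ DIM('a)"
        using \<epsilon> by (intro norm_heat_kernel_le) auto
      ultimately show ?thesis by linarith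
    qed
    moreover have "exp (- \<delta> * \<bar>snd (fst q) - snd (snd q)\<bar>) / (2 * \<delta>) \<le> 1 / (2 * \<delta>)"
      using \<delta> by (intro divide_right_mono) auto
    ultimately show ?thesis
      unfolding Q_def norm_mult norm_of_real using \<delta> by (intro mult_mono) auto
  qed
  have bF: "norm (F ((x, t), (x', t'))) \<le> (1 / (2 * \<delta>) * A * M * M) * (decay_weight x * (1 / (1 + t\<^sup>2))) * (decay_weight x' * (1 / (1 + t'\<^sup>2)))" for x t x' t'
  proof -
    have "norm (F ((x, t), (x', t'))) = norm (g (x, t)) * norm (g (x', t')) * norm (Q ((x, t), (x', t')))"
      by (simp add: F_def norm_mult)
    also have "\<dots> \<le> (M * (decay_weight x * (1 / (1 + t\<^sup>2)))) * (M * (decay_weight x' * (1 / (1 + t'\<^sup>2)))) * (1 / (2 * \<delta>) * A)"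
      using M(1) by (intro mult_mono M(2) nQ) (auto intro!: mult_nonneg_nonneg simp: decay_weight_pos less_imp_le)
    finally show ?thesis by (simp only: mult_ac)
  qed
  have reorder: "(LBINT q. F q) = (LBINT t. (LBINT t'. (LBINT x. (LBINT x'. F ((x, t), (x', t'))))))"
    using M(1) A \<delta>
    by (intro integral_space_time_reorder[OF borel_measurable_continuous_onI[OF cF] integrable_decay_weight _ integrable_inverse_1_plus_square _ _ bF])
      (auto simp: decay_weight_pos less_imp_le)
  define Gp where "Gp = (\<lambda>t. LBINT x. norm (g (x, t)) powr p)"
  have ig: "integrable lborel (\<lambda>x. g (x, t))" for t by (rule rapid_integrable(2)[OF g])
  have Gp: "(\<integral>\<^sup>+x. ennreal (norm (g (x, t)) powr p) \<partial>lborel) = ennreal (Gp t)" "Gp t \<ge> 0" for t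
    using integrable_bounded_powr[OF ig B(2), of p t] p12 by (simp_all add: Gp_def nn_integral_eq_integral)
  have mgp: "(\<lambda>q. norm (g q) powr p) \<in> borel_measurable (lborel \<Otimes>\<^sub>M lborel)"
    using mg by (simp add: lborel_prod)
  have [measurable]: "Gp \<in> borel_measurable borel"
  proof -
    have "(\<lambda>(t, x). norm (g (x, t)) powr p) \<in> borel_measurable (lborel \<Otimes>\<^sub>M lborel)"
      using measurable_compose[OF measurable_pair_swap' mgp] by (simp add: case_prod_unfold)
    then have "(\<lambda>t. LBINT x. norm (g (x, t)) powr p) \<in> borel_measurable lborel"
      by (rule lborel.borel_measurable_lebesgue_integral)
    then show ?thesis by (simp add: Gp_def)
  qed
  have GpN: "(\<integral>\<^sup>+t. ennreal (Gp t) \<partial>lborel) = ennreal N"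
  proof -
    have "(\<integral>\<^sup>+t. ennreal (Gp t) \<partial>lborel) = (\<integral>\<^sup>+t. (\<integral>\<^sup>+x. ennreal (norm (g (x, t)) powr p) \<partial>lborel) \<partial>lborel)"
      by (simp add: Gp)
    also have "\<dots> = (\<integral>\<^sup>+q. ennreal (norm (g q) powr p) \<partial>(lborel \<Otimes>\<^sub>M lborel))"
      using lborel_pair.nn_integral_snd[of "\<lambda>q. ennreal (norm (g q) powr p)"] mgp by simp
    also have "\<dots> = ennreal N"
      unfolding N lborel_prod using integrable_bounded_powr[OF rapid_integrable(1)[OF g] B(2), of p] p12
      by (intro nn_integral_eq_integral) auto
    finally show ?thesis .
  qed
  define G where "G = (\<lambda>t. Gp t powr (1 / p))"
  have [measurable]: "G \<in> borel_measurable borel" unfolding G_def by measurable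
  have GN: "(\<integral>\<^sup>+t. ennreal (G t powr p) \<partial>lborel) \<le> ennreal N"
    using GpN Gp(2) p12 by (simp add: G_def powr_powr)
  define Cp where "Cp = 3 / (2 * p) + 1 / (2 * (2 - p))"
  have Cp: "Cp \<ge> 0" using p12 by (simp add: Cp_def)
  define c where "c = 1 / (2 * \<delta>) * Cp"
  have c: "c \<ge> 0" using Cp \<delta> by (simp add: c_def)
  have slice: "norm (LBINT x. (LBINT x'. F ((x, t), (x', t')))) \<le> c * (G t * G t' * \<bar>t - t'\<bar> powr - (2 - 2 / p))"
    if "t \<noteq> t'" for t t'
  proof -
    define z where "z = complex_of_real (2 * \<epsilon>) - \<i> * of_real (t - t')"
    define e where "e = exp (- \<delta> * \<bar>t - t'\<bar>) / (2 * \<delta>)"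
    have z: "Re z > 0" "Im z \<noteq> 0" "\<bar>Im z\<bar> = \<bar>t - t'\<bar>" using \<epsilon> that by (auto simp: z_def)
    have "F ((x, t), (x', t')) = (of_real e * g (x, t)) * (heat_kernel z (x - x') * cnj (g (x', t')))" for x x'
      by (simp only: F_def Q_def fst_conv snd_conv z_def e_def mult_ac)
    then have "(LBINT x. (LBINT x'. F ((x, t), (x', t'))))
       = (LBINT x. of_real e * (g (x, t) * (LBINT x'. heat_kernel z (x - x') * cnj (g (x', t')))))"
      by (simp only: integral_mult_right_zero mult.assoc)
    also have "\<dots> = of_real e * (LBINT x. g (x, t) * (LBINT x'. heat_kernel z (x - x') * cnj (g (x', t'))))"
      by (rule integral_mult_right_zero)
    finally have "norm (LBINT x. (LBINT x'. F ((x, t), (x', t'))))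
       = \<bar>e\<bar> * norm (LBINT x. g (x, t) * (LBINT x'. heat_kernel z (x - x') * cnj (g (x', t'))))"
      by (simp only: norm_mult norm_of_real)
    also have "\<dots> \<le> 1 / (2 * \<delta>) * (Cp * \<bar>t - t'\<bar> powr - (2 - 2 / p) * Gp t' powr (1 / p) * Gp t powr (1 / p))"
    proof (rule mult_mono)
      show "\<bar>e\<bar> \<le> 1 / (2 * \<delta>)" using \<delta> by (simp add: e_def divide_right_mono)
      show "norm (LBINT x. g (x, t) * (LBINT x'. heat_kernel z (x - x') * cnj (g (x', t'))))
        \<le> Cp * \<bar>t - t'\<bar> powr - (2 - 2 / p) * Gp t' powr (1 / p) * Gp t powr (1 / p)"
        unfolding Cp_def z(3)[symmetric]
      proof (rule heat_kernel_dispersive[OF z(1,2) p])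
        show "integrable lborel (\<lambda>x. cnj (g (x, t')))" using ig by (rule integrable_cnj)
        show "norm (cnj (g (x, t'))) \<le> B" for x using B by simp
        show "(\<integral>\<^sup>+x. ennreal (norm (cnj (g (x, t'))) powr p) \<partial>lborel) = ennreal (Gp t')" using Gp by simp
      qed (use ig B Gp in auto)
    qed (use \<delta> in auto)
    also have "\<dots> = c * (G t * G t' * \<bar>t - t'\<bar> powr - (2 - 2 / p))"
      by (simp only: c_def G_def mult_ac)
    finally show ?thesis .
  qed
  have "ennreal (LBINT w. (norm (S w))\<^sup>2) = ennreal (norm (LBINT q. F q))"
    unfolding sqF[symmetric] by simp
  also have "\<dots> \<le> (\<integral>\<^sup>+t. ennreal (norm (LBINT t'. (LBINT x. (LBINT x'. F ((x, t), (x', t')))))) \<partial>lborel)"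
    unfolding reorder by (rule norm_integral_le_nn_integral)
  also have "\<dots> \<le> (\<integral>\<^sup>+t. (\<integral>\<^sup>+t'. ennreal (norm (LBINT x. (LBINT x'. F ((x, t), (x', t'))))) \<partial>lborel) \<partial>lborel)"
    by (intro nn_integral_mono norm_integral_le_nn_integral)
  also have "\<dots> \<le> (\<integral>\<^sup>+t. (\<integral>\<^sup>+t'. ennreal c * ennreal (G t * G t' * \<bar>t - t'\<bar> powr - (2 - 2 / p)) \<partial>lborel) \<partial>lborel)"
  \<comment> \<open>The diagonal \<open>t' = t\<close>, where the complex time is real and the
    dispersive estimate does not apply, is a null set in \<open>t'\<close>.\<close>
  proof (rule nn_integral_mono, rule nn_integral_mono_AE)
    fix t
    have "ennreal (norm (LBINT x. (LBINT x'. F ((x, t), (x', t')))))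
       \<le> ennreal c * ennreal (G t * G t' * \<bar>t - t'\<bar> powr - (2 - 2 / p))" if "t' \<noteq> t" for t'
    proof -
      have "ennreal c * ennreal (G t * G t' * \<bar>t - t'\<bar> powr - (2 - 2 / p)) = ennreal (c * (G t * G t' * \<bar>t - t'\<bar> powr - (2 - 2 / p)))"
        using c by (intro ennreal_mult[symmetric]) (auto simp: G_def)
      then show ?thesis using ennreal_leI[OF slice[of t t']] that by simp
    qed
    then show "AE t' in lborel. ennreal (norm (LBINT x. (LBINT x'. F ((x, t), (x', t')))))
       \<le> ennreal c * ennreal (G t * G t' * \<bar>t - t'\<bar> powr - (2 - 2 / p))"
      using AE_lborel_singleton[of t] by (auto elim: eventually_mono)
  qed
  also have "\<dots> = ennreal c * (\<integral>\<^sup>+t. (\<integral>\<^sup>+t'. ennreal (G t * G t' * \<bar>t - t'\<bar> powr - (2 - 2 / p)) \<partial>lborel) \<partial>lborel)"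
    by (subst nn_integral_cmult, measurable)+
  also have "\<dots> \<le> ennreal c * ennreal (2 * (2 / (2 / p - 1) + 3) * N powr (2 / p))"
    using N(2) by (intro mult_left_mono Hardy_Littlewood_Sobolev[OF p12 _ _ GN]) (auto simp: G_def)
  also have "\<dots> = ennreal (c * (2 * (2 / (2 / p - 1) + 3) * N powr (2 / p)))"
    using c p12 by (intro ennreal_mult[symmetric]) auto
  also have "c * (2 * (2 / (2 / p - 1) + 3) * N powr (2 / p)) = dual_const p / \<delta> * N powr (2 / p)"
  proof -
    have "(1 / (2 * \<delta>) * C) * (2 * D * E) = C * D / \<delta> * E" for C D E
      using \<delta> by (simp add: field_simps)
    then show ?thesis unfolding c_def Cp_def dual_const_def .
  qed
  finally show "(LBINT w. (norm (S w))\<^sup>2) \<le> dual_const p / \<delta> * N powr (2 / p)"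
    using \<delta> p12 by (subst (asm) ennreal_le_iff) (auto simp: dual_const_def)
qed

section \<open>The endpoint estimate and interpolation\<close>

lemma rapid_iter_pderiv:
  fixes v :: "'a::euclidean_space \<times> real \<Rightarrow> complex"
  assumes "schwartz v" "set bs \<subseteq> Basis"
  shows "rapid (iter_pderiv bs v)"
proof -
  obtain M where M: "M \<ge> 0" "\<And>x t. (1 + norm x)\<^sup>2 * norm (iter_pderiv bs v (x, t)) \<le> M * (decay_weight x * (1 / (1 + t\<^sup>2)))"
    using schwartz_decay[OF assms] by blast
  have "norm (iter_pderiv bs v (x, t)) \<le> M * (decay_weight x * (1 / (1 + t\<^sup>2)))" for x t
  proof -
    have "1 * norm (iter_pderiv bs v (x, t)) \<le> (1 + norm x)\<^sup>2 * norm (iter_pderiv bs v (x, t))"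
      by (intro mult_right_mono) auto
    then show ?thesis using M(2)[of x t] by linarith
  qed
  then show ?thesis
    unfolding rapid_def using schwartz_differentiable(2)[OF assms] M(1) by blast
qed

lemma rapid_add:
  assumes "rapid f" "rapid g"
  shows "rapid (\<lambda>z. f z + g z)"
proof -
  obtain M where M: "M \<ge> 0" "\<And>x t. norm (f (x, t)) \<le> M * (decay_weight x * (1 / (1 + t\<^sup>2)))"
    using assms(1) unfolding rapid_def by blast
  obtain N where N: "N \<ge> 0" "\<And>x t. norm (g (x, t)) \<le> N * (decay_weight x * (1 / (1 + t\<^sup>2)))"
    using assms(2) unfolding rapid_def by blast
  have "norm (f (x, t) + g (x, t)) \<le> (M + N) * (decay_weight x * (1 / (1 + t\<^sup>2)))" for x t
    unfolding distrib_right by (rule norm_triangle_mono[OF M(2) N(2)])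
  moreover have "continuous_on UNIV (\<lambda>z. f z + g z)"
    using assms by (auto simp: rapid_def intro: continuous_intros)
  ultimately show ?thesis
    unfolding rapid_def using M(1) N(1) by (intro conjI exI[of _ "M + N"]) auto
qed

lemma rapid_bounded_mult:
  assumes f: "rapid f" and g: "continuous_on UNIV g" "\<And>z. norm (g z) \<le> C"
  shows "rapid (\<lambda>z. g z * f z)"
proof -
  obtain M where M: "M \<ge> 0" "\<And>x t. norm (f (x, t)) \<le> M * (decay_weight x * (1 / (1 + t\<^sup>2)))"
    using f unfolding rapid_def by blast
  have C: "C \<ge> 0" using g(2)[of undefined] norm_ge_zero order_trans by blast
  have "norm (g (x, t) * f (x, t)) \<le> C * M * (decay_weight x * (1 / (1 + t\<^sup>2)))" for x t
    unfolding norm_mult mult.assoc[of C] by (rule mult_mono[OF g(2) M(2) C norm_ge_zero])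
  moreover have "continuous_on UNIV (\<lambda>z. g z * f z)"
    using f g(1) by (auto simp: rapid_def intro: continuous_intros)
  ultimately show ?thesis
    unfolding rapid_def using M(1) C by (intro conjI exI[of _ "C * M"]) auto
qed

lemma rapid_cmult: "rapid f \<Longrightarrow> rapid (\<lambda>z. c * f z)"
  by (rule rapid_bounded_mult[where C="norm c"]) auto

lemma rapid_sum:
  assumes "\<And>i. i \<in> A \<Longrightarrow> rapid (f i)"
  shows "rapid (\<lambda>z. \<Sum>i\<in>A. f i z)"
proof -
  have 0: "rapid (\<lambda>z. 0)" by (auto simp: rapid_def)
  show ?thesis
    using assms by (induction A rule: infinite_finite_induct) (auto intro: 0 rapid_add)
qed

lemma rapid_schrod_op:
  fixes v :: "(real^'n::finite) \<times> real \<Rightarrow> complex"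
  assumes v: "schwartz v"
  shows "rapid (schrod_op v)"
proof -
  have t: "rapid (pderiv_dir (0, 1) v)"
    using rapid_iter_pderiv[OF v, of "[(0, 1)]"] by (simp add: Basis_prod_def)
  have x: "rapid (pderiv_dir (b, 0) (pderiv_dir (b, 0) v))" if "b \<in> Basis" for b :: "real^'n"
    using rapid_iter_pderiv[OF v, of "[(b, 0), (b, 0)]"] that by (simp add: Basis_prod_def)
  have "rapid (\<lambda>z. \<i> * pderiv_dir (0, 1) v z + (- 1) * (\<Sum>b\<in>Basis. pderiv_dir (b, 0) (pderiv_dir (b, 0) v) z))"
    by (intro rapid_add rapid_cmult rapid_sum t x)
  then show ?thesis by (simp add: schrod_op_def[abs_def])
qed

section \<open>The heat kernel as an approximate identity\<close>

lemma integral_lborel_scale: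
  fixes f :: "'a::euclidean_space \<Rightarrow> complex"
  assumes c: "c > 0" and [measurable]: "f \<in> borel_measurable borel"
  shows "integral\<^sup>L lborel f = of_real (c ^ DIM('a)) * (LBINT y. f (c *\<^sub>R y))"
proof -
  have "integral\<^sup>L lborel f = integral\<^sup>L (density (distr lborel borel (\<lambda>x. 0 + c *\<^sub>R x)) (\<lambda>_. \<bar>c\<bar> ^ DIM('a))) f"
    using c by (subst lborel_affine[of c 0]) auto
  also have "\<dots> = (\<integral>x. (\<bar>c\<bar> ^ DIM('a)) *\<^sub>R f x \<partial>(distr lborel borel (\<lambda>x. 0 + c *\<^sub>R x)))"
    by (subst integral_density) auto
  also have "\<dots> = (LBINT x. (\<bar>c\<bar> ^ DIM('a)) *\<^sub>R f (c *\<^sub>R x))"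
    by (subst integral_distr) auto
  finally show ?thesis using c by (simp add: scaleR_conv_of_real)
qed

text \<open>Parabolic scaling moves \<epsilon> out of the kernel into the argument of
  \<open>v\<close>, so that dominated convergence can use one majorant for all \<epsilon>.\<close>

lemma heat_kernel_average:
  fixes v :: "'a::euclidean_space \<Rightarrow> complex"
  assumes \<epsilon>: "\<epsilon> > 0" and v: "continuous_on UNIV v"
  shows "(LBINT y. heat_kernel (of_real \<epsilon>) (x - y) * v y) = (LBINT y. heat_kernel 1 y * v (x - sqrt \<epsilon> *\<^sub>R y))"
proof -
  define f where "f = (\<lambda>u. heat_kernel (of_real \<epsilon>) u * v (x - u))"
  have cf: "continuous_on UNIV f"
    unfolding f_def using \<epsilon> by (intro continuous_intros continuous_on_heat_kernel continuous_on_compose2[OF v]) auto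
  have mf: "f \<in> borel_measurable borel" by (rule borel_measurable_continuous_onI[OF cf])
  have s: "sqrt \<epsilon> > 0" using \<epsilon> by simp
  have "(LBINT y. heat_kernel (of_real \<epsilon>) (x - y) * v y) = (LBINT y. f (x - y))"
    by (simp add: f_def)
  also have "\<dots> = integral\<^sup>L lborel f" by (rule integral_lborel_reflect[OF mf])
  also have "\<dots> = of_real (sqrt \<epsilon> ^ DIM('a)) * (LBINT y. f (sqrt \<epsilon> *\<^sub>R y))"
    by (rule integral_lborel_scale[OF s mf])
  also have "\<dots> = (LBINT y. of_real (sqrt \<epsilon> ^ DIM('a)) * f (sqrt \<epsilon> *\<^sub>R y))"
    by (rule integral_mult_right_zero[symmetric])
  also have "\<dots> = (LBINT y. heat_kernel 1 y * v (x - sqrt \<epsilon> *\<^sub>R y))"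
  proof (intro Bochner_Integration.integral_cong refl)
    fix y :: 'a
    have 1: "csqrt (of_real \<epsilon>) = of_real (sqrt \<epsilon>)" using \<epsilon> by (simp add: csqrt_of_real)
    have 2: "(norm (sqrt \<epsilon> *\<^sub>R y))\<^sup>2 = \<epsilon> * (norm y)\<^sup>2" using \<epsilon> by (simp add: power_mult_distrib)
    have "of_real (sqrt \<epsilon> ^ DIM('a)) * heat_kernel (of_real \<epsilon>) (sqrt \<epsilon> *\<^sub>R y) = heat_kernel 1 y"
      unfolding heat_kernel_def 1 2 using \<epsilon> by (simp add: power_mult_distrib)
    then show "of_real (sqrt \<epsilon> ^ DIM('a)) * f (sqrt \<epsilon> *\<^sub>R y) = heat_kernel 1 y * v (x - sqrt \<epsilon> *\<^sub>R y)"
      by (simp only: f_def mult.assoc[symmetric])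
  qed
  finally show ?thesis .
qed

text \<open>Dominated convergence twice: under the fixed kernel at time 1, by continuity and
  boundedness of \<open>v\<close>, and then in the pairing, because averages of \<open>v\<close>
  keep its bound \<open>B\<close> and \<open>g\<close> is integrable.\<close>

lemma heat_kernel_pairing_limit:
  fixes v g :: "'a::euclidean_space \<times> real \<Rightarrow> complex"
  assumes v: "rapid v" and g: "rapid g"
  shows "(\<lambda>k. LBINT z. g z * (LBINT y. heat_kernel (of_real (inverse (real (Suc k)))) (fst z - y) * v (y, snd z)))
    \<longlonglongrightarrow> (LBINT z. g z * v z)"
proof -
  define e where "e = (\<lambda>k. inverse (real (Suc k)))"
  have e: "e k > 0" for k by (simp add: e_def)
  have elim: "(\<lambda>k. sqrt (e k)) \<longlonglongrightarrow> 0"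
    using tendsto_real_sqrt[OF LIMSEQ_inverse_real_of_nat] by (simp add: e_def)
  define U where "U = (\<lambda>k z. LBINT y. heat_kernel (of_real (e k)) (fst z - y) * v (y, snd z))"
  have cv: "continuous_on UNIV v" using v by (simp add: rapid_def)
  have cvt: "continuous_on UNIV (\<lambda>y. v (y, t))" for t
    by (rule continuous_on_compose2[OF cv, where f="\<lambda>y. (y, t)"]) (auto intro: continuous_intros)
  obtain B where B: "B \<ge> 0" "\<And>z. norm (v z) \<le> B" using rapid_bounded[OF v] by blast
  have U: "U k z = (LBINT y. heat_kernel 1 y * v (fst z - sqrt (e k) *\<^sub>R y, snd z))" for k z
    unfolding U_def by (rule heat_kernel_average[OF e cvt])
  have K1: "integrable lborel (\<lambda>y::'a. norm (heat_kernel 1 y) * B)"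
    using heat_kernel_integral(1)[of 1, where 'a='a] by auto
  have mK: "heat_kernel 1 \<in> borel_measurable (borel :: 'a measure)"
    using borel_measurable_integrable[OF heat_kernel_integral(1)[of 1, where 'a='a]] by simp
  have mi: "(\<lambda>y::'a. heat_kernel 1 y * v (x - c *\<^sub>R y, t)) \<in> borel_measurable lborel" for x c t
  proof -
    have "continuous_on UNIV (\<lambda>y. v (x - c *\<^sub>R y, t))"
      by (rule continuous_on_compose2[OF cv, where f="\<lambda>y. (x - c *\<^sub>R y, t)"]) (auto intro!: continuous_intros)
    from borel_measurable_continuous_onI[OF this] show ?thesis using mK by measurable
  qed
  have ptw: "(\<lambda>k. U k z) \<longlonglongrightarrow> v z" for z
  proof -
    have "(\<lambda>k. U k z) \<longlonglongrightarrow> (LBINT y. heat_kernel 1 (y::'a) * v z)"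
      unfolding U
    proof (rule integral_dominated_convergence[where w="\<lambda>y::'a. norm (heat_kernel 1 y) * B"])
      show "AE y in lborel. (\<lambda>k. heat_kernel 1 y * v (fst z - sqrt (e k) *\<^sub>R y, snd z)) \<longlonglongrightarrow> heat_kernel 1 y * v z"
      proof (intro always_eventually allI tendsto_mult tendsto_const)
        fix y
        have "(\<lambda>k. (fst z - sqrt (e k) *\<^sub>R y, snd z)) \<longlonglongrightarrow> (fst z - 0 *\<^sub>R y, snd z)"
          by (intro tendsto_intros elim)
        moreover have "isCont v (fst z - 0 *\<^sub>R y, snd z)"
          by (metis cv continuous_on_eq_continuous_at open_UNIV UNIV_I)
        ultimately show "(\<lambda>k. v (fst z - sqrt (e k) *\<^sub>R y, snd z)) \<longlonglongrightarrow> v z"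
          using isCont_tendsto_compose by fastforce
      qed
      show "AE y in lborel. norm (heat_kernel 1 y * v (fst z - sqrt (e k) *\<^sub>R y, snd z)) \<le> norm (heat_kernel 1 y) * B" for k
        by (auto simp: norm_mult intro!: mult_left_mono B)
      show "(\<lambda>y::'a. heat_kernel 1 y * v z) \<in> borel_measurable lborel" using mK by measurable
    qed (rule mi K1)+
    also have "(LBINT y. heat_kernel 1 (y::'a) * v z) = v z"
      using heat_kernel_integral(2)[of 1, where 'a='a] by simp
    finally show ?thesis .
  qed
  have nU: "norm (U k z) \<le> B" for k z
  proof -
    have "norm (U k z) \<le> (LBINT y. norm (heat_kernel 1 y * v (fst z - sqrt (e k) *\<^sub>R y, snd z)))"
      unfolding U by (rule integral_norm_bound)
    also have "\<dots> \<le> (LBINT y. norm (heat_kernel 1 (y::'a)) * B)"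
    proof (rule integral_mono[OF _ K1])
      show le: "norm (heat_kernel 1 y * v (fst z - sqrt (e k) *\<^sub>R y, snd z)) \<le> norm (heat_kernel 1 y) * B" for y
        by (auto simp: norm_mult intro!: mult_left_mono B)
      show "integrable lborel (\<lambda>y. norm (heat_kernel 1 y * v (fst z - sqrt (e k) *\<^sub>R y, snd z)))"
        using mi B(1) le by (intro integrable_norm Bochner_Integration.integrable_bound[OF K1]) auto
    qed
    also have "\<dots> = B" using integral_norm_heat_kernel[of 1, where 'a='a] by simp
    finally show ?thesis .
  qed
  have mU: "U k \<in> borel_measurable lborel" for k
  proof -
    have "continuous_on UNIV (\<lambda>q::('a \<times> real) \<times> 'a. heat_kernel (of_real (e k)) (fst (fst q) - snd q) * v (snd q, snd (fst q)))"
      using e by (intro continuous_intros continuous_on_heat_kernel continuous_on_compose2[OF cv]) auto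
    then have "(\<lambda>(z, y). heat_kernel (of_real (e k)) (fst z - y) * v (y, snd z)) \<in> borel_measurable (lborel \<Otimes>\<^sub>M (lborel :: 'a measure))"
      by (simp add: lborel_prod case_prod_unfold borel_measurable_continuous_onI)
    then show ?thesis unfolding U_def by (rule lborel.borel_measurable_lebesgue_integral)
  qed
  have mg[measurable]: "g \<in> borel_measurable borel" and mv[measurable]: "v \<in> borel_measurable borel"
    using rapid_measurable g v by auto
  have "(\<lambda>k. LBINT z. g z * U k z) \<longlonglongrightarrow> (LBINT z. g z * v z)"
  proof (rule integral_dominated_convergence)
    show "integrable lborel (\<lambda>z. norm (g z) * B)" using rapid_integrable(1)[OF g] by auto
    show "AE z in lborel. (\<lambda>k. g z * U k z) \<longlonglongrightarrow> g z * v z"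
      by (intro always_eventually allI tendsto_mult tendsto_const ptw)
    show "AE z in lborel. norm (g z * U k z) \<le> norm (g z) * B" for k
      by (auto simp: norm_mult intro!: mult_left_mono nU)
    show "(\<lambda>z. g z * U k z) \<in> borel_measurable lborel" for k using mU[of k] by measurable
  qed measurable
  then show ?thesis by (simp add: U_def e_def)
qed

text \<open>The Duhamel formula and Fubini move R onto \<open>g\<close>, where the dual estimate
  applies. A mean inequality with free weight \<eta> takes the place of Cauchy-Schwarz. As the right
  side contains no \<epsilon>, the limit can be taken afterwards.\<close>

lemma damped_pairing_bound:
  fixes v g :: "(real^'n::finite) \<times> real \<Rightarrow> complex"
  assumes v: "schwartz v" and g: "rapid g" and \<epsilon>: "\<epsilon> > 0" and \<delta>: "\<delta> > 0" and \<eta>: "\<eta> > 0"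
    and p: "p = 2 * (real CARD('n) + 2) / (real CARD('n) + 4)"
    and N: "N = (LBINT z. norm (g z) powr p)" "N > 0"
  shows "norm (LBINT z. g z * (LBINT y. heat_kernel (of_real \<epsilon>) (fst z - y) * v (y, snd z)))
     \<le> \<eta> * (\<delta>\<^sup>2 * (LBINT z. (norm (v z))\<^sup>2) + (LBINT z. (norm (schrod_op v z))\<^sup>2))
       + dual_const p / (2 * \<eta> * \<delta>) * N powr (2 / p)"
proof -
  define f where "f = schrod_op v"
  define h where "h = (\<lambda>w. of_real \<delta> * v w - \<i> * f w)"
  have rv: "rapid v" using rapid_iter_pderiv[OF v, of "[]"] by simp
  have rf: "rapid f" unfolding f_def by (rule rapid_schrod_op[OF v])
  have rh: "rapid h"
    using rapid_add[OF rapid_cmult[OF rv, of "of_real \<delta>"] rapid_cmult[OF rf, of "- \<i>"]] by (simp add: h_def)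
  define S where "S = (\<lambda>w. LBINT z. damped_kernel \<epsilon> \<delta> (z, w) * g z)"
  have p': "p = 2 * (real DIM(real^'n) + 2) / (real DIM(real^'n) + 4)" using p by simp
  have S: "integrable lborel (\<lambda>w. (norm (S w))\<^sup>2)" "(LBINT w. (norm (S w))\<^sup>2) \<le> dual_const p / \<delta> * N powr (2 / p)"
    unfolding S_def using damped_dual_estimate[OF \<epsilon> \<delta> g p' N] by auto
  have sq: "integrable lborel (\<lambda>z. (norm (u z))\<^sup>2)" if "rapid u" for u :: "(real^'n) \<times> real \<Rightarrow> complex"
    using rapid_bounded[OF that] integrable_bounded_square[OF rapid_integrable(1)[OF that]] by blast
  define c where "c = 1 / (2 * sqrt pi * sqrt \<epsilon>) ^ DIM(real^'n)"
  have bP: "norm (damped_kernel \<epsilon> \<delta> (z, w)) \<le> c" for z w :: "(real^'n) \<times> real"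
    unfolding c_def by (rule norm_damped_kernel_le[OF \<epsilon> \<delta>])
  define F where "F = (\<lambda>q. g (fst q) * (damped_kernel \<epsilon> \<delta> q * h (snd q)))"
  have iF: "integrable (lborel \<Otimes>\<^sub>M lborel) F"
  proof (rule integrable_lborel_pair_bound[where g="\<lambda>z. c * norm (g z)" and h="\<lambda>w. norm (h w)"])
    have "(\<lambda>q::((real^'n) \<times> real) \<times> ((real^'n) \<times> real). g (fst q)) \<in> borel_measurable borel"
      by (rule measurable_compose[OF _ rapid_measurable[OF g]]) (intro borel_measurable_continuous_onI continuous_intros)
    moreover have "(\<lambda>q::((real^'n) \<times> real) \<times> ((real^'n) \<times> real). h (snd q)) \<in> borel_measurable borel"
      by (rule measurable_compose[OF _ rapid_measurable[OF rh]]) (intro borel_measurable_continuous_onI continuous_intros)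
    ultimately show "F \<in> borel_measurable borel"
      unfolding F_def using borel_measurable_damped_kernel[OF \<epsilon>] by (intro borel_measurable_times)
    show "norm (F (z, w)) \<le> c * norm (g z) * norm (h w)" for z w
    proof -
      have "norm (damped_kernel \<epsilon> \<delta> (z, w)) * (norm (g z) * norm (h w)) \<le> c * (norm (g z) * norm (h w))"
        by (intro mult_right_mono bP) auto
      then show ?thesis by (simp add: F_def norm_mult mult_ac)
    qed
  qed (use rapid_integrable(1)[OF g] rapid_integrable(1)[OF rh] in auto)
  have "(LBINT z. g z * (LBINT y. heat_kernel (of_real \<epsilon>) (fst z - y) * v (y, snd z)))
      = (LBINT z. g z * (LBINT w. damped_kernel \<epsilon> \<delta> (z, w) * h w))"
    using Duhamel_damped[OF v \<epsilon> \<delta>] by (simp add: h_def f_def)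
  also have "\<dots> = (LBINT z. (LBINT w. F (z, w)))"
    by (simp only: F_def fst_conv snd_conv integral_mult_right_zero)
  also have "\<dots> = (LBINT w. (LBINT z. F (z, w)))"
    using lborel_pair.Fubini_integral[of "\<lambda>z w. F (z, w)"] iF by (simp add: case_prod_eta)
  also have "\<dots> = (LBINT w. h w * S w)"
  proof (intro Bochner_Integration.integral_cong refl)
    fix w
    have "F (z, w) = h w * (damped_kernel \<epsilon> \<delta> (z, w) * g z)" for z by (simp add: F_def mult_ac)
    then show "(LBINT z. F (z, w)) = h w * S w" by (simp only: integral_mult_right_zero S_def)
  qed
  finally have eq: "(LBINT z. g z * (LBINT y. heat_kernel (of_real \<epsilon>) (fst z - y) * v (y, snd z)))
      = (LBINT w. h w * S w)" .
  have am: "a * b \<le> \<eta> / 2 * a\<^sup>2 + 1 / (2 * \<eta>) * b\<^sup>2" for a b :: real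
  proof -
    have "0 \<le> (\<eta> * a - b)\<^sup>2 / (2 * \<eta>)" using \<eta> by simp
    also have "\<dots> = \<eta> / 2 * a\<^sup>2 + 1 / (2 * \<eta>) * b\<^sup>2 - a * b"
      using \<eta> by (simp add: power2_eq_square field_simps)
    finally show ?thesis by simp
  qed
  \<comment> \<open>The 2 from \<open>(a + b)^2 \<le> 2 (a^2 + b^2)\<close> cancels the
    \<open>\<eta> / 2\<close> of the mean inequality.\<close>
  have h2: "(norm (h w))\<^sup>2 \<le> 2 * (\<delta>\<^sup>2 * (norm (v w))\<^sup>2 + (norm (f w))\<^sup>2)" for w
  proof -
    have "norm (h w) \<le> \<delta> * norm (v w) + norm (f w)"
      unfolding h_def using norm_triangle_ineq4[of "of_real \<delta> * v w" "\<i> * f w"] \<delta> by (simp add: norm_mult)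
    then have "(norm (h w))\<^sup>2 \<le> (\<delta> * norm (v w) + norm (f w))\<^sup>2" by (intro power_mono) auto
    also have "\<dots> \<le> 2 * (\<delta>\<^sup>2 * (norm (v w))\<^sup>2 + (norm (f w))\<^sup>2)"
      using zero_le_power2[of "\<delta> * norm (v w) - norm (f w)"]
      by (simp add: power2_diff power2_sum power_mult_distrib)
    finally show ?thesis .
  qed
  have "norm (LBINT w. h w * S w) \<le> (LBINT w. norm (h w * S w))" by (rule integral_norm_bound)
  also have "\<dots> \<le> (LBINT w. \<eta> * (\<delta>\<^sup>2 * (norm (v w))\<^sup>2 + (norm (f w))\<^sup>2) + 1 / (2 * \<eta>) * (norm (S w))\<^sup>2)"
  proof (rule integral_mono_AE')
    show "integrable lborel (\<lambda>w. \<eta> * (\<delta>\<^sup>2 * (norm (v w))\<^sup>2 + (norm (f w))\<^sup>2) + 1 / (2 * \<eta>) * (norm (S w))\<^sup>2)"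
      using sq[OF rv] sq[OF rf] S(1) by (intro Bochner_Integration.integrable_add integrable_mult_right)
    have "norm (h w * S w) \<le> \<eta> * (\<delta>\<^sup>2 * (norm (v w))\<^sup>2 + (norm (f w))\<^sup>2) + 1 / (2 * \<eta>) * (norm (S w))\<^sup>2" for w
    proof -
      define X where "X = \<delta>\<^sup>2 * (norm (v w))\<^sup>2 + (norm (f w))\<^sup>2"
      have "norm (h w * S w) \<le> \<eta> / 2 * (norm (h w))\<^sup>2 + 1 / (2 * \<eta>) * (norm (S w))\<^sup>2"
        unfolding norm_mult by (rule am)
      moreover have "\<eta> / 2 * (norm (h w))\<^sup>2 \<le> \<eta> / 2 * (2 * X)"
        using \<eta> unfolding X_def by (intro mult_left_mono h2) auto
      moreover have "\<eta> / 2 * (2 * X) = \<eta> * X" by simp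
      ultimately show ?thesis unfolding X_def by linarith
    qed
    then show "AE w in lborel. norm (h w * S w) \<le> \<eta> * (\<delta>\<^sup>2 * (norm (v w))\<^sup>2 + (norm (f w))\<^sup>2) + 1 / (2 * \<eta>) * (norm (S w))\<^sup>2"
      by simp
  qed (use \<eta> in auto)
  also have "\<dots> = \<eta> * (\<delta>\<^sup>2 * (LBINT z. (norm (v z))\<^sup>2) + (LBINT z. (norm (f z))\<^sup>2)) + 1 / (2 * \<eta>) * (LBINT w. (norm (S w))\<^sup>2)"
    using sq[OF rv] sq[OF rf] S(1) by simp
  also have "\<dots> \<le> \<eta> * (\<delta>\<^sup>2 * (LBINT z. (norm (v z))\<^sup>2) + (LBINT z. (norm (f z))\<^sup>2)) + 1 / (2 * \<eta>) * (dual_const p / \<delta> * N powr (2 / p))"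
    using \<eta> by (intro add_left_mono mult_left_mono S) auto
  also have "1 / (2 * \<eta>) * (dual_const p / \<delta> * N powr (2 / p)) = dual_const p / (2 * \<eta> * \<delta>) * N powr (2 / p)" by simp
  finally show ?thesis unfolding eq f_def .
qed

text \<open>This is the case \<kappa> = 1/2, since the exponent conjugate to \<open>p\<close> is
  \<open>2(n+2)/n\<close> with \<open>n = CARD('n)\<close>. \<open>V\<close> and \<open>W\<close>
  are squared norms, so the power 1/4 of their product is the square root of the product of the
  norms.\<close>

theorem schrodinger_endpoint_estimate:
  fixes v :: "(real^'n::finite) \<times> real \<Rightarrow> complex"
  assumes v: "schwartz v"
    and p: "p = 2 * (real CARD('n) + 2) / (real CARD('n) + 4)" and q: "q = p / (p - 1)"
    and V: "V = (LBINT z. (norm (v z))\<^sup>2)" "V > 0"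
    and W: "W = (LBINT z. (norm (schrod_op v z))\<^sup>2)"
    and X: "X = (LBINT z. norm (v z) powr q)"
  shows "X powr (1 / q) \<le> sqrt (4 * dual_const p) * (W * V) powr (1 / 4)"
proof -
  define n where "n = real CARD('n)"
  have n: "n \<ge> 1" unfolding n_def by (simp add: Suc_leI)
  have p_eq: "p = 2 * (n + 2) / (n + 4)" using p by (simp add: n_def)
  have p12: "1 < p" "p < 2" using n by (auto simp: p_eq field_simps)
  have q2: "q > 2" using p12 by (simp add: q field_simps)
  have qp: "(q - 1) * p = q" "2 - 2 / p = 2 / q" using p12 by (auto simp: q field_simps)
  define D where "D = dual_const p"
  have D: "D > 0" unfolding D_def dual_const_def using p12 by (intro mult_pos_pos add_pos_pos divide_pos_pos) auto
  have rv: "rapid v" using rapid_iter_pderiv[OF v, of "[]"] by simp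
  have X0: "X \<ge> 0" and W0: "W \<ge> 0" by (simp_all add: X W)
  show ?thesis
  proof (cases "X = 0")
    case True
    then show ?thesis using D by (simp add: D_def)
  next
    case False
    then have Xpos: "X > 0" using X0 by simp
    obtain B where B: "B \<ge> 0" "\<And>z. norm (v z) \<le> B" using rapid_bounded[OF rv] by blast
    have cv: "continuous_on UNIV v" using rv by (simp add: rapid_def)
    \<comment> \<open>The extremal function of the duality between \<open>p\<close> and
      \<open>q\<close>: both \<open>g * v\<close> and \<open>|g|^p\<close> equal
      \<open>|v|^q\<close>, so the pairing and the integral \<open>N\<close> of the dual estimate
      are both \<open>X\<close>.\<close>
    define g where "g = (\<lambda>z. of_real (norm (v z) powr (q - 2)) * cnj (v z))"
    have rc: "rapid (\<lambda>z. cnj (v z))"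
      using rv unfolding rapid_def by (auto intro: continuous_intros)
    have "continuous_on UNIV (\<lambda>z. norm (v z) powr (q - 2))"
      using q2 by (intro continuous_on_powr' continuous_intros cv) auto
    then have cp: "continuous_on UNIV (\<lambda>z. complex_of_real (norm (v z) powr (q - 2)))"
      by (rule continuous_on_of_real)
    have "norm (complex_of_real (norm (v z) powr (q - 2))) \<le> B powr (q - 2)" for z
      using B q2 by (simp add: powr_mono2)
    from rapid_bounded_mult[OF rc cp this] have rg: "rapid g" unfolding g_def .
    have ng: "norm (g z) powr p = norm (v z) powr q" for z
    proof (cases "v z = 0")
      case False
      have "norm (g z) = norm (v z) powr (q - 2) * norm (v z)"
        by (simp add: g_def norm_mult)
      also have "\<dots> = norm (v z) powr ((q - 2) + 1)"
        unfolding powr_add using False by simp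
      finally have "norm (g z) = norm (v z) powr (q - 1)" by simp
      then show ?thesis by (simp add: powr_powr qp)
    qed (simp add: g_def)
    have gv: "g z * v z = of_real (norm (v z) powr q)" for z
    proof (cases "v z = 0")
      case False
      have "cnj (v z) * v z = of_real ((norm (v z))\<^sup>2)"
        by (simp only: complex_norm_square mult.commute)
      then have "g z * v z = of_real (norm (v z) powr (q - 2) * (norm (v z))\<^sup>2)"
        by (simp add: g_def mult.assoc)
      also have "norm (v z) powr (q - 2) * (norm (v z))\<^sup>2 = norm (v z) powr q"
        using False by (simp add: powr_diff)
      finally show ?thesis .
    qed (simp add: g_def)
    have N: "X = (LBINT z. norm (g z) powr p)" by (simp add: ng X)
    have key: "X \<le> \<eta> * (\<delta>\<^sup>2 * V + W) + D / (2 * \<eta> * \<delta>) * X powr (2 / p)" if "\<eta> > 0" "\<delta> > 0" for \<eta> \<delta>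
    proof -
      have "(\<lambda>k. norm (LBINT z. g z * (LBINT y. heat_kernel (of_real (inverse (real (Suc k)))) (fst z - y) * v (y, snd z))))
          \<longlonglongrightarrow> norm (LBINT z. g z * v z)"
        by (intro tendsto_norm heat_kernel_pairing_limit[OF rv rg])
      moreover have "norm (LBINT z. g z * v z) = X"
        unfolding gv integral_complex_of_real X[symmetric] using X0 by simp
      moreover have "norm (LBINT z. g z * (LBINT y. heat_kernel (of_real (inverse (real (Suc k)))) (fst z - y) * v (y, snd z)))
          \<le> \<eta> * (\<delta>\<^sup>2 * V + W) + D / (2 * \<eta> * \<delta>) * X powr (2 / p)" for k
        unfolding V(1) W D_def
        by (rule damped_pairing_bound[OF v rg _ that(2) that(1) p N Xpos]) simp
      ultimately show ?thesis by (auto intro: LIMSEQ_le_const2)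
    qed
    \<comment> \<open>The optimal parameters divide by \<open>W\<close> or vanish with it, and
      \<open>W > 0\<close> is not known here. A larger \<open>W'\<close> is used instead and then
      lowered to \<open>W\<close>.\<close>
    have bound: "(X powr (2 / q))\<^sup>2 / (16 * D\<^sup>2 * V) \<le> W'" if "W < W'" for W'
    proof -
      have W': "W' > 0" using that W0 by simp
      \<comment> \<open>This \<delta> makes \<open>\<delta>^2 * V\<close> equal to
        \<open>W'\<close>, and \<eta> then makes the first term of \<open>key\<close> at most
        \<open>X / 2\<close>, which is absorbed on the left.\<close>
      define \<delta> where "\<delta> = sqrt (W' / V)"
      define \<eta> where "\<eta> = X / (4 * W')"
      define Y where "Y = X powr (2 / p)"
      have \<delta>: "\<delta> > 0" "\<delta>\<^sup>2 * V = W'" using W' V(2) by (auto simp: \<delta>_def)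
      have \<eta>: "\<eta> > 0" using Xpos W' by (simp add: \<eta>_def)
      have "X \<le> \<eta> * (W' + W) + D / (2 * \<eta> * \<delta>) * Y" using key[OF \<eta> \<delta>(1)] by (simp add: \<delta> Y_def)
      also have "\<eta> * (W' + W) \<le> \<eta> * (2 * W')" using \<eta> that by (intro mult_left_mono) auto
      also have "\<eta> * (2 * W') = X / 2" using W' by (simp add: \<eta>_def)
      finally have "X \<le> X / 2 + D / (2 * \<eta> * \<delta>) * Y" by simp
      then have "X / 2 \<le> D / (2 * \<eta> * \<delta>) * Y" by linarith
      also have "D / (2 * \<eta> * \<delta>) * Y = 2 * D * W' * Y / (X * \<delta>)"
        using Xpos W' \<delta> by (simp add: \<eta>_def field_simps)
      finally have "X\<^sup>2 * \<delta> \<le> 4 * D * W' * Y" using Xpos \<delta> by (simp add: field_simps power2_eq_square)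
      moreover have "X\<^sup>2 = X powr (2 / q) * Y"
        using Xpos by (simp add: Y_def qp(2)[symmetric] flip: powr_add)
      ultimately have "X powr (2 / q) * \<delta> * Y \<le> 4 * D * W' * Y" by (simp add: mult_ac)
      moreover have "Y > 0" using Xpos by (simp add: Y_def)
      ultimately have "X powr (2 / q) * \<delta> \<le> 4 * D * W'" by (metis mult_le_cancel_right_pos)
      then have "(X powr (2 / q) * \<delta>)\<^sup>2 \<le> (4 * D * W')\<^sup>2" using \<delta> by (intro power_mono) auto
      then have "(X powr (2 / q))\<^sup>2 * (W' / V) \<le> 16 * D\<^sup>2 * W'\<^sup>2"
        using W' V(2) by (simp add: power_mult_distrib \<delta>_def)
      then have "((X powr (2 / q))\<^sup>2 / V) * W' \<le> (16 * D\<^sup>2 * W') * W'"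
        by (simp add: power2_eq_square mult_ac)
      then have "(X powr (2 / q))\<^sup>2 / V \<le> 16 * D\<^sup>2 * W'" using W' by (metis mult_le_cancel_right_pos)
      then show ?thesis using V(2) D by (simp add: field_simps)
    qed
    have "(X powr (2 / q))\<^sup>2 / (16 * D\<^sup>2 * V) \<le> W" by (rule dense_ge[OF bound])
    then have "(X powr (2 / q))\<^sup>2 \<le> (4 * D)\<^sup>2 * (W * V)" using V(2) D by (simp add: field_simps power2_eq_square)
    then have "((X powr (2 / q))\<^sup>2) powr (1 / 4) \<le> ((4 * D)\<^sup>2 * (W * V)) powr (1 / 4)" by (intro powr_mono2) auto
    also have "((X powr (2 / q))\<^sup>2) powr (1 / 4) = X powr (1 / q)"
      using Xpos q2 by (simp add: powr_powr powr_numeral[symmetric] del: powr_numeral)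
    also have "((4 * D)\<^sup>2 * (W * V)) powr (1 / 4) = sqrt (4 * D) * (W * V) powr (1 / 4)"
    proof -
      have sq: "(E\<^sup>2) powr (1 / 4) = sqrt E" if "E > 0" for E :: real
        using that by (simp add: powr_powr powr_half_sqrt powr_numeral[symmetric] del: powr_numeral)
      have "((4 * D)\<^sup>2 * (W * V)) powr (1 / 4) = ((4 * D)\<^sup>2) powr (1 / 4) * (W * V) powr (1 / 4)"
        by (rule powr_mult)
      then show ?thesis using sq[of "4 * D"] D by (simp only: mult_pos_pos zero_less_numeral)
    qed
    finally show ?thesis by (simp add: D_def)
  qed
qed

text \<open>Young's inequality applied pointwise to the two integrands, each divided by its
  integral, and then integrated; hence the positivity of both integrals.\<close>

lemma Lp_interpolation:
  fixes v :: "'a::euclidean_space \<Rightarrow> complex"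
  assumes a: "a \<ge> 0" "b \<ge> 0" "a + b = 1"
    and i: "integrable lborel (\<lambda>z. norm (v z) powr r)" "integrable lborel (\<lambda>z. norm (v z) powr s)"
    and pos: "(LBINT z. norm (v z) powr r) > 0" "(LBINT z. norm (v z) powr s) > 0"
  shows "(LBINT z. norm (v z) powr (a * r + b * s))
    \<le> (LBINT z. norm (v z) powr r) powr a * (LBINT z. norm (v z) powr s) powr b"
proof -
  define R where "R = (LBINT z. norm (v z) powr r)"
  define S where "S = (LBINT z. norm (v z) powr s)"
  have RS: "R > 0" "S > 0" using pos by (auto simp: R_def S_def)
  have "(LBINT z. norm (v z) powr (a * r + b * s))
     \<le> (LBINT z. R powr a * S powr b * (a / R * norm (v z) powr r + b / S * norm (v z) powr s))"
  proof (rule integral_mono_AE')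
    show "integrable lborel (\<lambda>z. R powr a * S powr b * (a / R * norm (v z) powr r + b / S * norm (v z) powr s))"
      by (intro integrable_mult_right Bochner_Integration.integrable_add i)
    have "norm (v z) powr (a * r + b * s) \<le> R powr a * S powr b * (a / R * norm (v z) powr r + b / S * norm (v z) powr s)" for z
    proof (cases "v z = 0")
      case False
      define u where "u = norm (v z)"
      have u: "u > 0" using False by (simp add: u_def)
      have "(u powr r / R) powr a * (u powr s / S) powr b \<le> a * (u powr r / R) + b * (u powr s / S)"
        using a u RS by (intro Youngs_inequality_0) auto
      then have "R powr a * S powr b * ((u powr r / R) powr a * (u powr s / S) powr b)
          \<le> R powr a * S powr b * (a * (u powr r / R) + b * (u powr s / S))"
        by (intro mult_left_mono) auto
      moreover have "R powr a * S powr b * ((u powr r / R) powr a * (u powr s / S) powr b) = u powr (a * r + b * s)"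
        using RS u by (simp add: powr_divide powr_powr powr_add mult.commute)
      ultimately show ?thesis by (simp add: u_def)
    qed simp
    then show "AE z in lborel. norm (v z) powr (a * r + b * s) \<le> R powr a * S powr b * (a / R * norm (v z) powr r + b / S * norm (v z) powr s)"
      by simp
  qed (use a RS in auto)
  also have "\<dots> = R powr a * S powr b * (a / R * R + b / S * S)"
    using i by (simp add: R_def S_def)
  also have "\<dots> = R powr a * S powr b" using RS a by simp
  finally show ?thesis by (simp add: R_def S_def)
qed

theorem theorem7p2:
  fixes \<kappa> q :: real
  assumes "1/2 \<le> \<kappa>" "\<kappa> \<le> 1"
    and "q = 2 * (real (CARD('n) + 1) + 1) / (real (CARD('n) + 1) - 3 + 4 * \<kappa>)"
  shows "\<exists>C>0. \<forall>v :: (real^'n) \<times> real \<Rightarrow> complex. schwartz v \<longrightarrow>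
           Lp_norm q v \<le> C * rpow (Lp_norm 2 (schrod_op v)) (1 - \<kappa>) * rpow (Lp_norm 2 v) \<kappa>"
proof -
  define n where "n = real CARD('n)"
  have n: "n \<ge> 1" unfolding n_def by (simp add: Suc_leI)
  define p where "p = 2 * (n + 2) / (n + 4)"
  define r where "r = p / (p - 1)"
  define E where "E = n - 2 + 4 * \<kappa>"
  \<comment> \<open>The weight of the endpoint norm when the L^q norm is interpolated between L^2
    and L^r. The endpoint estimate supplies the norm of \<open>schrod_op v\<close> to the power 1/2,
    so the power \<open>1 - \<kappa>\<close> requires twice that as weight.\<close>
  define \<theta> where "\<theta> = 2 * (1 - \<kappa>)"
  \<comment> \<open>The matching weight on the exponents themselves, from
    \<open>(1 - b) * 2 + b * r = q\<close> and \<open>r - 2 = 4 / n\<close>.\<close>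
  define b where "b = 2 * n * (1 - \<kappa>) / E"
  define a where "a = 1 - b"
  have p12: "1 < p" "p < 2" using n by (auto simp: p_def field_simps)
  have r_eq: "r = 2 * (n + 2) / n"
  proof -
    have "p - 1 = n / (n + 4)" using n by (simp add: p_def field_simps)
    then show ?thesis using n by (simp add: r_def p_def)
  qed
  have En: "E \<ge> n" using assms(1) by (simp add: E_def)
  have E: "E > 0" using En n by simp
  have q_eq: "q = 2 * (n + 2) / E" using assms(3) by (simp add: n_def E_def algebra_simps)
  have q: "q > 0" using n E by (simp add: q_eq)
  have b: "0 \<le> b" using n E assms(2) by (simp add: b_def)
  have a: "0 \<le> a"
  proof -
    \<comment> \<open>Here the lower bound on \<kappa> enters: below 1/2 the exponent
      \<open>q\<close> would exceed the endpoint \<open>r\<close>.\<close>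
    have "0 \<le> (n + 2) * (2 * \<kappa> - 1)" using n assms(1) by (intro mult_nonneg_nonneg) auto
    then have "2 * n * (1 - \<kappa>) \<le> E" by (simp add: E_def algebra_simps)
    then show ?thesis using E by (simp add: a_def b_def)
  qed
  have rb: "r * b / q = \<theta>" using n E by (simp add: r_eq b_def q_eq \<theta>_def)
  have qab: "a * 2 + b * r = q"
  proof -
    have "r - 2 = 4 / n" using n by (simp add: r_eq field_simps)
    then have "b * (r - 2) = 8 * (1 - \<kappa>) / E" using n by (simp add: b_def)
    also have "\<dots> = (2 * (n + 2) - 2 * E) / E" by (simp add: E_def)
    also have "\<dots> = q - 2" using E by (simp add: q_eq diff_divide_distrib)
    finally show ?thesis by (simp add: a_def algebra_simps)
  qed
  have aq: "a / q = (1 - \<theta>) / 2"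
    using qab q rb by (simp add: field_simps)
  define C where "C = sqrt (4 * dual_const p) powr \<theta>"
  have D: "dual_const p > 0"
    unfolding dual_const_def using p12 by (intro mult_pos_pos add_pos_pos divide_pos_pos) auto
  have C: "C > 0" using D by (simp add: C_def)
  have "Lp_norm q v \<le> C * rpow (Lp_norm 2 (schrod_op v)) (1 - \<kappa>) * rpow (Lp_norm 2 v) \<kappa>"
    if v: "schwartz v" for v :: "(real^'n) \<times> real \<Rightarrow> complex"
  proof -
    define V where "V = (LBINT z. (norm (v z))\<^sup>2)"
    define W where "W = (LBINT z. (norm (schrod_op v z))\<^sup>2)"
    define X where "X = (LBINT z. norm (v z) powr r)"
    define Y where "Y = (LBINT z. norm (v z) powr q)"
    have rv: "rapid v" using rapid_iter_pderiv[OF v, of "[]"] by simp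
    have [measurable]: "v \<in> borel_measurable borel" by (rule rapid_measurable[OF rv])
    obtain B where B: "\<And>z. norm (v z) \<le> B" using rapid_bounded[OF rv] by blast
    have i: "integrable lborel (\<lambda>z. norm (v z) powr s)" if "s \<ge> 1" for s
      by (rule integrable_bounded_powr[OF rapid_integrable(1)[OF rv] B that])
    have r1: "r > 2" using n by (simp add: r_eq field_simps)
    have V0: "V \<ge> 0" and W0: "W \<ge> 0" and X0: "X \<ge> 0" by (simp_all add: V_def W_def X_def)
    have L2: "Lp_norm 2 v = V powr (1 / 2)" "Lp_norm 2 (schrod_op v) = W powr (1 / 2)"
      by (simp_all add: Lp_norm_def V_def W_def)
    have Lq: "Lp_norm q v = Y powr (1 / q)" by (simp add: Lp_norm_def Y_def)
    show ?thesis
    proof (cases "V = 0")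
      case True
      then have "AE z in lborel. v z = 0"
        using i[of 2] unfolding V_def by (subst (asm) integral_nonneg_eq_0_iff_AE) auto
      then have "Y = 0" unfolding Y_def by (intro integral_eq_zero_AE) auto
      then show ?thesis using C by (simp add: Lq rpow_def)
    next
      case False
      then have V: "V > 0" using V0 by simp
      have X: "X > 0"
      proof (rule ccontr)
        assume "\<not> X > 0"
        then have "X = 0" using X0 by simp
        then have "AE z in lborel. norm (v z) powr r = 0"
          using i[of r] r1 unfolding X_def by (subst (asm) integral_nonneg_eq_0_iff_AE) auto
        then have "V = 0" unfolding V_def by (intro integral_eq_zero_AE) auto
        then show False using V by simp
      qed
      have endpoint: "X powr (1 / r) \<le> sqrt (4 * dual_const p) * (W * V) powr (1 / 4)"
        by (rule schrodinger_endpoint_estimate[OF v _ r_def V_def V W_def X_def]) (simp add: p_def n_def)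
      \<comment> \<open>The endpoint estimate itself excludes a nonzero \<open>v\<close> with
        vanishing \<open>schrod_op v\<close>. With a positive base, \<open>rpow\<close> and
        \<open>powr\<close> agree also at exponent 0, which occurs for \<kappa> = 1.\<close>
      have W: "W > 0"
      proof (rule ccontr)
        assume "\<not> W > 0"
        then have "W = 0" using W0 by simp
        then show False using endpoint X by simp
      qed
      have "Y \<le> V powr a * X powr b"
      proof -
        have V': "V = (LBINT z. norm (v z) powr 2)" by (simp add: V_def)
        show ?thesis
          using Lp_interpolation[OF a b, of v 2 r] i[of 2] i[of r] r1 V X
          unfolding qab Y_def V' X_def by (simp add: a_def)
      qed
      then have "Y powr (1 / q) \<le> (V powr a * X powr b) powr (1 / q)"
        using q by (intro powr_mono2) (auto simp: Y_def)
      also have "\<dots> = V powr (a / q) * (X powr (1 / r)) powr \<theta>"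
        using V X r1 rb[symmetric] by (simp add: powr_mult powr_powr)
      also have "\<dots> \<le> V powr (a / q) * (sqrt (4 * dual_const p) * (W * V) powr (1 / 4)) powr \<theta>"
        using assms(2) by (intro mult_left_mono powr_mono2 endpoint) (auto simp: \<theta>_def)
      also have "\<dots> = C * W powr (\<theta> / 4) * (V powr (a / q) * V powr (\<theta> / 4))"
        using D V W by (simp add: C_def powr_mult powr_powr)
      also have "V powr (a / q) * V powr (\<theta> / 4) = V powr (\<kappa> / 2)"
        unfolding powr_add[symmetric] aq by (simp add: \<theta>_def field_simps)
      also have "\<theta> / 4 = (1 - \<kappa>) / 2" by (simp add: \<theta>_def)
      also have "W powr ((1 - \<kappa>) / 2) = rpow (Lp_norm 2 (schrod_op v)) (1 - \<kappa>)"
        using W by (simp add: rpow_def L2 powr_powr)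
      also have "V powr (\<kappa> / 2) = rpow (Lp_norm 2 v) \<kappa>"
        using V assms(1) by (simp add: rpow_def L2 powr_powr)
      finally show ?thesis by (simp add: Lq)
    qed
  qed
  with C show ?thesis by blast
qed

end
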